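(* Let $p\in(1,\infty)$, $\delta\ge0$, and let $(\mu_t)_{t\ge0}$ be the marginal laws of an $\mathbb{R}^d$-valued Lévy process starting in $0$ with $\int_{\mathbb{R}^d}|x|^p\,\mu_1(dx)<\infty$. Let $\mathscr{S}(t)$, $t\ge0$, be the operators on $C_0(\mathbb{R}^d)$ defined in the context. Let $f\in C_0(\mathbb{R}^d)$ and define $u\colon[0,\infty)\times\mathbb{R}^d\to\mathbb{R}$ by $u(t,x):=\mathscr{S}(t)f(x)$. Then $u$ is a viscosity solution (in the sense of the context) of $$\begin{cases}\partial_t u(t,x)=A^\mu u(t,\cdot)(x)+\delta|\nabla u(t,x)| & \text{for }(t,x)\in(0,\infty)\times\mathbb{R}^d,\\ u(0,x)=f(x)&\text{for }x\in\mathbb{R}^d,\end{cases}$$ where $A^\mu$ is the generator of the Lévy process and $\nabla$ denotes the spatial gradient.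
   Context: $|\cdot|$ is the Euclidean norm. $\mathcal{P}_p(\mathbb{R}^d)$ is the set of Borel probability measures on $\mathbb{R}^d$ with finite $p$-th moment, and $\mathcal{W}_p(\mu,\nu)=\inf_\gamma\big(\int|y-x|^p\,\gamma(dx,dy)\big)^{1/p}$, the infimum being over all couplings $\gamma$ of $\mu$ and $\nu$. $C_0(\mathbb{R}^d)$ is the space of real-valued continuous functions on $\mathbb{R}^d$ vanishing at infinity, with the supremum norm $\|\cdot\|_\infty$. Operators. For $t\ge0$, $f\in C_0(\mathbb{R}^d)$ and $x\in\mathbb{R}^d$, set $$S(t)f(x):=\sup\Big\{\int_{\mathbb{R}^d}f(x+y)\,\nu(dy):\nu\in\mathcal{P}_p(\mathbb{R}^d),\ \mathcal{W}_p(\mu_t,\nu)\le\delta t\Big\}.$$ Each $S(t)$ maps $C_0(\mathbb{R}^d)$ to itself. For $n\in\mathbb{N}$, $t\ge0$ let $k=\lfloor2^nt\rfloor$, $t_n=k2^{-n}$, and $\mathscr{S}^n(t):=S(2^{-n})\circ\cdots\circ S(2^{-n})\circ S(t-t_n)$ with $k$ factors $S(2^{-n})$. Finally $\mathscr{S}(t)f:=\lim_{n\to\infty}\mathscr{S}^n(t)f$ (pointwise; the limit exists and lies in $C_0(\mathbb{R}^d)$). Generator. $A^\mu$ with domain $D(A^\mu)\subset C_0(\mathbb{R}^d)$ is the infinitesimal generator of the Feller semigroup $S^\mu(t)f(x):=\int_{\mathbb{R}^d}f(x+y)\,\mu_t(dy)$ on $C_0(\mathbb{R}^d)$, i.e.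 $A^\mu f=\lim_{t\downarrow0}(S^\mu(t)f-f)/t$ in supremum norm, for those $f$ for which this limit exists. Viscosity solution. $C^1_0(\mathbb{R}^d)$ is the space of continuously differentiable $f\in C_0(\mathbb{R}^d)$ whose gradient vanishes at infinity. A test function is a map $v\colon(0,\infty)\to C_0(\mathbb{R}^d)$ that is differentiable with respect to the supremum norm and satisfies $v(t)\in D(A^\mu)\cap C^1_0(\mathbb{R}^d)$ for every $t\in(0,\infty)$; write $v(t,x)=v(t)(x)$. A continuous function $u\colon[0,\infty)\to C_0(\mathbb{R}^d)$ (with $u(t,x)=u(t)(x)$ and $u(0,\cdot)=f$) is a viscosity subsolution of $\partial_tu=\mathscr{A}u$, $u(0,\cdot)=f$, where $\mathscr{A}g:=A^\mu g+\delta|\nabla g|$ for $g\in D(A^\mu)\cap C_0^1(\mathbb{R}^d)$, if for every $(t,x)\in(0,\infty)\times\mathbb{R}^d$ and every test function $v$ with $u\le v$ on $(0,\infty)\times\mathbb{R}^d$ and $v(t,x)=u(t,x)$ one has $\partial_tv(t,x)\le\mathscr{A}v(t,x)$. It is a viscosity supersolution if the same holds with both "$\le$" replaced by "$\ge$", and a viscosity solution if it is both. *)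

theory Defs
  imports "HOL-Probability.Probability"
begin

section \<open>Levy processes\<close>

text \<open>
  Processes are indexed by \<^typ>\<open>real\<close>; only times \<open>t \<ge> 0\<close> matter. Path regularity is required in the
  form of continuity in probability, which is implied by right-continuity of the paths.
\<close>

definition levy_process ::
  "'w measure \<Rightarrow> (real \<Rightarrow> 'w \<Rightarrow> 'a::euclidean_space) \<Rightarrow> bool" where
  "levy_process M X \<longleftrightarrow>
     prob_space M \<and>
     (\<forall>t\<ge>0. X t \<in> borel_measurable M) \<and>
     (AE \<omega> in M. X 0 \<omega> = 0) \<and>
     (\<forall>(n::nat) (t::nat \<Rightarrow> real). 0 \<le> t 0 \<longrightarrow> mono_on {..n} t \<longrightarrow>
        prob_space.indep_vars M (\<lambda>_. borel) (\<lambda>i \<omega>. X (t (Suc i)) \<omega> - X (t i) \<omega>) {..<n}) \<and>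
     (\<forall>s\<ge>0. \<forall>h\<ge>0. distr M borel (\<lambda>\<omega>. X (s + h) \<omega> - X s \<omega>) = distr M borel (X h)) \<and>
     (\<forall>t\<ge>0. \<forall>\<epsilon>>0.
        ((\<lambda>s. measure M {\<omega> \<in> space M. norm (X s \<omega> - X t \<omega>) > \<epsilon>}) \<longlongrightarrow> 0) (at t within {0..}))"


section \<open>Wasserstein distance\<close>

definition wasserstein_space :: "real \<Rightarrow> 'a::euclidean_space measure set" where
  "wasserstein_space p =
     {\<nu>. prob_space \<nu> \<and> sets \<nu> = sets borel \<and> integrable \<nu> (\<lambda>x. norm x powr p)}"

definition couplings ::
  "'a::euclidean_space measure \<Rightarrow> 'a measure \<Rightarrow> ('a \<times> 'a) measure set" where
  "couplings \<mu> \<nu> = {\<gamma>. sets \<gamma> = sets borel \<and> distr \<gamma> borel fst = \<mu> \<and> distr \<gamma> borel snd = \<nu>}"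

text \<open>
  Meaningful for \<open>\<mu>, \<nu> \<in> wasserstein_space p\<close> only: there the integrand is integrable for every
  coupling (lemma \<open>integrable_coupling_cost\<close>) and couplings exist, so that the real-valued
  integral and infimum are the genuine ones.
\<close>

definition wasserstein :: "real \<Rightarrow> 'a::euclidean_space measure \<Rightarrow> 'a measure \<Rightarrow> real" where
  "wasserstein p \<mu> \<nu> =
     (INF \<gamma>\<in>couplings \<mu> \<nu>. (\<integral>(x, y). norm (y - x) powr p \<partial>\<gamma>) powr (1 / p))"

lemma integrable_coupling_cost:
  fixes \<mu> \<nu> :: "'a::euclidean_space measure"
  assumes p: "p > 0" and \<mu>: "\<mu> \<in> wasserstein_space p" and \<nu>: "\<nu> \<in> wasserstein_space p"
    and \<gamma>: "\<gamma> \<in> couplings \<mu> \<nu>"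
  shows "integrable \<gamma> (\<lambda>(x, y). norm (y - x) powr p)"
proof -
  have s [measurable_cong]: "sets \<gamma> = sets ((borel :: 'a measure) \<Otimes>\<^sub>M (borel :: 'a measure))"
    using \<gamma> unfolding borel_prod by (simp add: couplings_def)
  have "integrable (distr \<gamma> borel fst) (\<lambda>x. norm x powr p)"
    using \<mu> \<gamma> by (simp add: couplings_def wasserstein_space_def)
  then have 1: "integrable \<gamma> (\<lambda>z. norm (fst z) powr p)"
    by (subst (asm) integrable_distr_eq) auto
  have "integrable (distr \<gamma> borel snd) (\<lambda>x. norm x powr p)"
    using \<nu> \<gamma> by (simp add: couplings_def wasserstein_space_def)
  then have 2: "integrable \<gamma> (\<lambda>z. norm (snd z) powr p)"
    by (subst (asm) integrable_distr_eq) auto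
  have bound: "norm (y - x) powr p \<le> 2 powr p * (norm x powr p + norm y powr p)" for x y :: 'a
  proof -
    let ?m = "max (norm x) (norm y)"
    have "norm (y - x) \<le> 2 * ?m"
      using norm_triangle_ineq4[of y x] by linarith
    then have "norm (y - x) powr p \<le> (2 * ?m) powr p"
      using p by (intro powr_mono2) auto
    also have "\<dots> = 2 powr p * ?m powr p"
      by (subst powr_mult) auto
    also have "?m powr p \<le> norm x powr p + norm y powr p"
      by (simp add: max_def)
    finally show ?thesis by simp
  qed
  show ?thesis
  proof (rule Bochner_Integration.integrable_bound)
    show "integrable \<gamma> (\<lambda>z. 2 powr p * (norm (fst z) powr p + norm (snd z) powr p))"
      using 1 2 by simp
    show "(\<lambda>(x, y). norm (y - x) powr p) \<in> borel_measurable \<gamma>"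
      by measurable
    show "AE z in \<gamma>. norm (case z of (x, y) \<Rightarrow> norm (y - x) powr p)
            \<le> norm (2 powr p * (norm (fst z) powr p + norm (snd z) powr p))"
      using bound by (auto split: prod.split)
  qed
qed


section \<open>The operators\<close>

text \<open>
  Functions on the space are plain functions; \<open>C0\<close> is a subset of the library's \<^const>\<open>bcontfun\<close>
  (lemma \<open>C0_subset_bcontfun\<close>), and topological notions with respect to the supremum norm are
  expressed through \<^const>\<open>Bcontfun\<close>, i.e. in the normed space of bounded continuous functions.
\<close>

definition C0 :: "('a::euclidean_space \<Rightarrow> real) set" where
  "C0 = {f. continuous_on UNIV f \<and> (f \<longlongrightarrow> 0) at_infinity}"

lemma C0_subset_bcontfun: "C0 \<subseteq> bcontfun"
proof
  fix f :: "'a::euclidean_space \<Rightarrow> real" assume f: "f \<in> C0"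
  then have "eventually (\<lambda>x. dist (f x) 0 < 1) at_infinity"
    unfolding C0_def tendsto_iff by auto
  then obtain b where b: "\<And>x. b \<le> norm x \<Longrightarrow> \<bar>f x\<bar> < 1"
    unfolding eventually_at_infinity by auto
  have "compact (f ` cball 0 b)"
    using f by (intro compact_continuous_image) (auto simp: C0_def intro: continuous_on_subset)
  then have "bounded (f ` cball 0 b)" by (rule compact_imp_bounded)
  moreover have "range f \<subseteq> f ` cball 0 b \<union> cball 0 1"
  proof (rule image_subsetI)
    fix x show "f x \<in> f ` cball 0 b \<union> cball 0 1"
      using b[of x] by (cases "norm x \<le> b") auto
  qed
  ultimately have "bounded (range f)"
    by (meson bounded_Un bounded_cball bounded_subset)
  then show "f \<in> bcontfun" using f by (simp add: C0_def bcontfun_def)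
qed

text \<open>In the following, \<open>\<mu> t\<close> is the marginal law at time \<open>t\<close>.\<close>

definition wasserstein_op ::
  "real \<Rightarrow> real \<Rightarrow> (real \<Rightarrow> 'a::euclidean_space measure) \<Rightarrow> real \<Rightarrow> ('a \<Rightarrow> real) \<Rightarrow> 'a \<Rightarrow> real" where
  "wasserstein_op p \<delta> \<mu> t f x =
     Sup {(\<integral>y. f (x + y) \<partial>\<nu>) | \<nu>. \<nu> \<in> wasserstein_space p \<and> wasserstein p (\<mu> t) \<nu> \<le> \<delta> * t}"

definition dyadic_op ::
  "real \<Rightarrow> real \<Rightarrow> (real \<Rightarrow> 'a::euclidean_space measure) \<Rightarrow> nat \<Rightarrow> real \<Rightarrow> ('a \<Rightarrow> real) \<Rightarrow> 'a \<Rightarrow> real" where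
  "dyadic_op p \<delta> \<mu> n t f =
     (let k = nat \<lfloor>2 ^ n * t\<rfloor>; t\<^sub>n = real k / 2 ^ n
      in (wasserstein_op p \<delta> \<mu> (1 / 2 ^ n) ^^ k) (wasserstein_op p \<delta> \<mu> (t - t\<^sub>n) f))"

definition limit_op ::
  "real \<Rightarrow> real \<Rightarrow> (real \<Rightarrow> 'a::euclidean_space measure) \<Rightarrow> real \<Rightarrow> ('a \<Rightarrow> real) \<Rightarrow> 'a \<Rightarrow> real" where
  "limit_op p \<delta> \<mu> t f x = lim (\<lambda>n. dyadic_op p \<delta> \<mu> n t f x)"


section \<open>The generator\<close>

definition feller_op ::
  "(real \<Rightarrow> 'a::euclidean_space measure) \<Rightarrow> real \<Rightarrow> ('a \<Rightarrow> real) \<Rightarrow> 'a \<Rightarrow> real" where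
  "feller_op \<mu> t f x = (\<integral>y. f (x + y) \<partial>\<mu> t)"

lemma feller_op_C0:
  fixes \<mu> :: "real \<Rightarrow> 'a::euclidean_space measure"
  assumes "prob_space (\<mu> t)" and s [measurable_cong]: "sets (\<mu> t) = sets borel" and f: "f \<in> C0"
  shows "feller_op \<mu> t f \<in> C0"
proof -
  interpret prob_space "\<mu> t" by fact
  have cf: "continuous_on UNIV f" and lf: "(f \<longlongrightarrow> 0) at_infinity"
    using f by (auto simp: C0_def)
  have m [measurable]: "f \<in> borel_measurable borel"
    using cf by (rule borel_measurable_continuous_onI)
  obtain B where B: "\<And>x. norm (f x) \<le> B"
    using f C0_subset_bcontfun unfolding bcontfun_def bounded_iff by blast
  have conv: "((\<lambda>n. feller_op \<mu> t f (X n)) \<longlonglongrightarrow> (\<integral>y. g y \<partial>\<mu> t))"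
    if g: "\<And>y. (\<lambda>n. f (X n + y)) \<longlonglongrightarrow> g y" "g \<in> borel_measurable borel"
    for X :: "nat \<Rightarrow> 'a" and g
    unfolding feller_op_def
    by (rule integral_dominated_convergence[where w = "\<lambda>_. B"])
       (use g B in \<open>auto simp: measurable_cong_sets[OF s refl]\<close>)
  have "continuous_on UNIV (feller_op \<mu> t f)"
    unfolding continuous_on_sequentially
  proof (intro ballI allI impI, elim conjE)
    fix X :: "nat \<Rightarrow> 'a" and a assume X: "X \<longlonglongrightarrow> a"
    have "(\<lambda>n. f (X n + y)) \<longlonglongrightarrow> f (a + y)" for y
      using cf X by (intro continuous_on_tendsto_compose[OF cf] tendsto_intros) auto
    from conv[OF this] show "(feller_op \<mu> t f \<circ> X) \<longlonglongrightarrow> feller_op \<mu> t f a"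
      by (simp add: feller_op_def o_def)
  qed
  moreover have "(feller_op \<mu> t f \<longlongrightarrow> 0) at_infinity"
  proof (rule ccontr)
    assume "\<not> ?thesis"
    then obtain e where e: "e > 0" "\<not> eventually (\<lambda>x. dist (feller_op \<mu> t f x) 0 < e) at_infinity"
      unfolding tendsto_iff by auto
    then have "\<forall>n. \<exists>x. real n \<le> norm x \<and> \<bar>feller_op \<mu> t f x\<bar> \<ge> e"
      unfolding eventually_at_infinity by (auto simp: not_less)
    then obtain X where X: "\<And>n. real n \<le> norm (X n)" "\<And>n. \<bar>feller_op \<mu> t f (X n)\<bar> \<ge> e"
      by metis
    have "filterlim X at_infinity sequentially"
      using X(1) filterlim_at_top_mono[OF filterlim_real_sequentially]
      by (auto simp: filterlim_at_infinity_conv_norm_at_top)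
    then have "filterlim (\<lambda>n. X n + y) at_infinity sequentially" for y
      by (intro tendsto_add_filterlim_at_infinity') auto
    then have "(\<lambda>n. f (X n + y)) \<longlonglongrightarrow> 0" for y
      by (rule filterlim_compose[OF lf])
    from conv[OF this] have "(\<lambda>n. feller_op \<mu> t f (X n)) \<longlonglongrightarrow> 0" by simp
    then have "eventually (\<lambda>n. \<bar>feller_op \<mu> t f (X n)\<bar> < e) sequentially"
      using e(1) by (auto simp: tendsto_iff dist_real_def)
    then show False using X(2) by (auto simp: eventually_sequentially not_less[symmetric])
  qed
  ultimately show ?thesis by (simp add: C0_def)
qed

definition generator_quotient ::
  "(real \<Rightarrow> 'a::euclidean_space measure) \<Rightarrow> ('a \<Rightarrow> real) \<Rightarrow> real \<Rightarrow> ('a \<Rightarrow>\<^sub>C real)" where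
  "generator_quotient \<mu> f t = (Bcontfun (feller_op \<mu> t f) - Bcontfun f) /\<^sub>R t"

text \<open>
  A limit of the difference quotients in the supremum norm is automatically in \<open>C0\<close>, which is a closed
  subspace of the bounded continuous functions.
\<close>

definition generator_dom :: "(real \<Rightarrow> 'a::euclidean_space measure) \<Rightarrow> ('a \<Rightarrow> real) set" where
  "generator_dom \<mu> = {f \<in> C0. \<exists>g. (generator_quotient \<mu> f \<longlongrightarrow> g) (at_right 0)}"

definition generator ::
  "(real \<Rightarrow> 'a::euclidean_space measure) \<Rightarrow> ('a \<Rightarrow> real) \<Rightarrow> 'a \<Rightarrow> real" where
  "generator \<mu> f = apply_bcontfun (Lim (at_right 0) (generator_quotient \<mu> f))"


section \<open>Viscosity solutions\<close>

definition gradient :: "('a::euclidean_space \<Rightarrow> real) \<Rightarrow> 'a \<Rightarrow> 'a" where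
  "gradient f x = (THE D. GDERIV f x :> D)"

lemma gradient_eq: "GDERIV f x :> D \<Longrightarrow> gradient f x = D"
  unfolding gradient_def gderiv_def
  by (rule the_equality, assumption)
     (metis (no_types, lifting) has_derivative_unique inner_commute vector_eq_ldot)

definition C1_0 :: "('a::euclidean_space \<Rightarrow> real) set" where
  "C1_0 = {f \<in> C0. (\<forall>x. f differentiable (at x)) \<and> continuous_on UNIV (gradient f) \<and>
                   (gradient f \<longlongrightarrow> 0) at_infinity}"

definition hjb_op ::
  "real \<Rightarrow> (real \<Rightarrow> 'a::euclidean_space measure) \<Rightarrow> ('a \<Rightarrow> real) \<Rightarrow> 'a \<Rightarrow> real" where
  "hjb_op \<delta> \<mu> g x = generator \<mu> g x + \<delta> * norm (gradient g x)"

definition test_function ::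
  "(real \<Rightarrow> 'a::euclidean_space measure) \<Rightarrow> (real \<Rightarrow> 'a \<Rightarrow> real) \<Rightarrow> bool" where
  "test_function \<mu> v \<longleftrightarrow>
     (\<forall>t>0. v t \<in> generator_dom \<mu> \<inter> C1_0) \<and>
     (\<forall>t>0. (\<lambda>s. Bcontfun (v s)) differentiable (at t))"

definition C0_curve :: "(real \<Rightarrow> 'a::euclidean_space \<Rightarrow> real) \<Rightarrow> bool" where
  "C0_curve u \<longleftrightarrow> (\<forall>t\<ge>0. u t \<in> C0) \<and> continuous_on {0..} (\<lambda>t. Bcontfun (u t))"

definition viscosity_subsolution ::
  "real \<Rightarrow> (real \<Rightarrow> 'a::euclidean_space measure) \<Rightarrow> ('a \<Rightarrow> real) \<Rightarrow> (real \<Rightarrow> 'a \<Rightarrow> real) \<Rightarrow> bool" where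
  "viscosity_subsolution \<delta> \<mu> f u \<longleftrightarrow>
     C0_curve u \<and> u 0 = f \<and>
     (\<forall>t>0. \<forall>x. \<forall>v. test_function \<mu> v \<longrightarrow> (\<forall>s>0. \<forall>y. u s y \<le> v s y) \<longrightarrow> v t x = u t x \<longrightarrow>
        deriv (\<lambda>s. v s x) t \<le> hjb_op \<delta> \<mu> (v t) x)"

definition viscosity_supersolution ::
  "real \<Rightarrow> (real \<Rightarrow> 'a::euclidean_space measure) \<Rightarrow> ('a \<Rightarrow> real) \<Rightarrow> (real \<Rightarrow> 'a \<Rightarrow> real) \<Rightarrow> bool" where
  "viscosity_supersolution \<delta> \<mu> f u \<longleftrightarrow>
     C0_curve u \<and> u 0 = f \<and>
     (\<forall>t>0. \<forall>x. \<forall>v. test_function \<mu> v \<longrightarrow> (\<forall>s>0. \<forall>y. u s y \<ge> v s y) \<longrightarrow> v t x = u t x \<longrightarrow>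
        deriv (\<lambda>s. v s x) t \<ge> hjb_op \<delta> \<mu> (v t) x)"

definition viscosity_solution ::
  "real \<Rightarrow> (real \<Rightarrow> 'a::euclidean_space measure) \<Rightarrow> ('a \<Rightarrow> real) \<Rightarrow> (real \<Rightarrow> 'a \<Rightarrow> real) \<Rightarrow> bool" where
  "viscosity_solution \<delta> \<mu> f u \<longleftrightarrow>
     viscosity_subsolution \<delta> \<mu> f u \<and> viscosity_supersolution \<delta> \<mu> f u"

end

theory Submission
  imports Defs
begin

text \<open>
  Gluing couplings shows \<open>S(s) S(t) \<le> S(s + t)\<close>, so the dyadic iterates decrease in \<open>n\<close>. They are
  bounded below by the transition semigroup \<open>P\<close> of the process, which forces their limit into \<open>C0\<close> and,
  by Dini, makes the convergence uniform. Dynamic programming is only needed in the form of two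
  one-sided inequalities along dyadic steps \<open>h = 2\<^sup>-\<^sup>m\<close>: \<open>u(t) \<le> S(h) u(t - h)\<close>, and
  \<open>u(t, x) \<ge> P(h) u(t - h) (x + h a)\<close> for every constant drift with \<open>|a| \<le> \<delta>\<close>. Inserting a test function
  into the first and using the first-order expansion of \<open>S(h)\<close> gives the subsolution property; inserting
  it into the second with \<open>a\<close> along the gradient gives the supersolution property.
\<close>

section \<open>Couplings and transport cost\<close>

text \<open>Dyadic steps are singled out because, for arbitrary \<open>t\<close>, the iterate
  \<open>D n t\<close> splits off whole steps of length \<open>1 / 2 ^ n\<close> exactly, with the
  same remainder; removing any other time would change the remainder. The analytic core is the upper
  half of the expansion of S(h) g at a point x: a measure within cost \<delta> h of the law of the
  increment must not gain more than h \<delta> |grad g(x)| + o(h). Two effects threaten this, since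
  the gradient may be larger away from x. Mass may be transported far; as p > 1, displacements
  beyond a fixed length contribute at most a multiple of c powr p = o(h), with c = (\<delta> + e) h.
  Or the increment itself is large; there displacements are cut at a length M c, the short ones
  being paid for by the small probability of a large increment and the long ones by M powr (1 - p).
  Infima over couplings and suprema over measures are only approached, so the constants carry a
  slack that is finally sent to zero. Translation invariance makes every S(t) preserve each modulus
  of continuity, so all iterates are equicontinuous.\<close>

lemma le_powr_Young:
  fixes z p :: real
  assumes "p > 1" "z \<ge> 0"
  shows "z \<le> (1 - 1 / p) + z powr p / p"
  using Youngs_inequality[of p "p / (p - 1)" z 1] assms by (simp add: field_simps)

text \<open>Convexity of the power with weights a/(a+b) and b/(a+b). If \<open>a\<close> and
  \<open>b\<close> bound the p-th root costs of two couplings, the right-hand side integrates to at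
  most \<open>(a + b) powr p\<close>, so it plays the role of Minkowski's inequality. With
  \<open>a = b = 1\<close> it is the usual bound with constant
  \<open>2 powr (p - 1)\<close>.\<close>

lemma powr_add_weighted:
  fixes x y a b p :: real
  assumes p: "p > 1" and ab: "a > 0" "b > 0" and xy: "x \<ge> 0" "y \<ge> 0"
  shows "(x + y) powr p \<le> (a + b) powr (p - 1) * (a powr (1 - p) * x powr p + b powr (1 - p) * y powr p)"
proof -
  have neg: "z powr (1 - p) = 1 / z powr (p - 1)" for z :: real
    using powr_minus_divide[of z "p - 1"] by simp
  have one: "y powr p \<le> (a + b) powr (p - 1) * (b powr (1 - p) * y powr p)"
    if "a > 0" "b > 0" "y \<ge> 0" for a b y :: real
  proof -
    have "(a + b) powr (p - 1) * b powr (1 - p) = ((a + b) / b) powr (p - 1)"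
      using that by (simp add: powr_divide neg)
    moreover have "((a + b) / b) powr (p - 1) \<ge> 1"
      using that p by (intro ge_one_powr_ge_zero) auto
    ultimately show ?thesis
      using mult_right_mono[of 1 "(a + b) powr (p - 1) * b powr (1 - p)" "y powr p"]
      by (metis mult.assoc mult_1 powr_ge_zero)
  qed
  show ?thesis
  \<comment> \<open>Convexity is used on the open half-line only, so vanishing arguments are settled
    by \<open>one\<close>.\<close>
  proof (cases "x = 0 \<or> y = 0")
    case True
    then show ?thesis
      using one[of a b y] one[of b a x] ab xy p by (auto simp: add.commute)
  next
    case False
    define l where "l = a / (a + b)"
    have l: "l > 0" "l < 1" and l': "1 - l = b / (a + b)" using ab by (auto simp: l_def field_simps)
    have "convex_on {0<..} (\<lambda>x::real. x powr p)" using p by (intro powr_convex) auto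
    from convex_onD[OF this, of "1 - l" "x / l" "y / (1 - l)"]
    have "(x + y) powr p \<le> l * (x / l) powr p + (1 - l) * (y / (1 - l)) powr p"
      using l False xy by simp
    also have "l * (x / l) powr p = l powr (1 - p) * x powr p"
      using l xy by (simp add: powr_divide powr_diff)
    also have "(1 - l) * (y / (1 - l)) powr p = (1 - l) powr (1 - p) * y powr p"
      using l xy by (simp add: powr_divide powr_diff)
    also have "l powr (1 - p) = (a + b) powr (p - 1) * a powr (1 - p)"
      using ab by (simp add: l_def powr_divide neg)
    also have "(1 - l) powr (1 - p) = (a + b) powr (p - 1) * b powr (1 - p)"
      unfolding l' using ab by (simp add: powr_divide neg)
    finally show ?thesis by (simp add: algebra_simps)
  qed
qed

section \<open>Mixtures over a countable index\<close>

lemma measure_eqI_nn_integral: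
  assumes "sets M = sets N"
    and "\<And>h. h \<in> borel_measurable N \<Longrightarrow> (\<integral>\<^sup>+x. h x \<partial>M) = (\<integral>\<^sup>+x. h x \<partial>N)"
  shows "M = N"
proof (rule measure_eqI)
  fix A assume A: "A \<in> sets M"
  then show "emeasure M A = emeasure N A"
    using assms(2)[of "indicator A"] assms(1) by simp
qed fact

text \<open>The kernel factors through a discrete index space, on which every map is measurable;
  this makes the choice of \<open>K i\<close> for each index completely free.\<close>

lemma countable_mixture:
  fixes K :: "nat \<Rightarrow> 'b measure"
  assumes M: "prob_space M" and A [measurable]: "A \<in> M \<rightarrow>\<^sub>M count_space UNIV"
    and K: "\<And>i. prob_space (K i)" "\<And>i. sets (K i) = sets B"
    and T [measurable]: "(\<lambda>(x, y). T x y) \<in> M \<Otimes>\<^sub>M B \<rightarrow>\<^sub>M N"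
  defines "L \<equiv> M \<bind> (\<lambda>x. distr (K (A x)) N (T x))"
  shows "prob_space L" "sets L = sets N"
    and "\<And>h. h \<in> borel_measurable N \<Longrightarrow>
      (\<integral>\<^sup>+x. h x \<partial>L) = (\<integral>\<^sup>+x. \<integral>\<^sup>+y. h (T x y) \<partial>K (A x) \<partial>M)"
    and "\<And>g. (\<lambda>(x, y). g x y) \<in> borel_measurable (M \<Otimes>\<^sub>M B) \<Longrightarrow>
      (\<lambda>x. \<integral>\<^sup>+y. g x y \<partial>K (A x)) \<in> borel_measurable M"
proof -
  interpret prob_space M by fact
  have KA [measurable]: "(\<lambda>x. K (A x)) \<in> M \<rightarrow>\<^sub>M subprob_algebra B"
    by (rule measurable_compose[OF A])
       (use K in \<open>auto simp: space_subprob_algebra intro: prob_space_imp_subprob_space\<close>)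
  have D [measurable]: "(\<lambda>x. distr (K (A x)) N (T x)) \<in> M \<rightarrow>\<^sub>M subprob_algebra N"
    by (rule measurable_distr2) measurable
  have Tx: "T x \<in> K i \<rightarrow>\<^sub>M N" if "x \<in> space M" for x i
    using measurable_Pair2[OF T that] by (simp add: measurable_cong_sets[OF K(2) refl])
  show "prob_space L" unfolding L_def
    by (rule prob_space_bind[OF _ D]) (auto intro!: AE_I2 prob_space.prob_space_distr K Tx)
  show "sets L = sets N" unfolding L_def
    by (rule sets_bind) (auto simp: not_empty)
  show "(\<integral>\<^sup>+x. h x \<partial>L) = (\<integral>\<^sup>+x. \<integral>\<^sup>+y. h (T x y) \<partial>K (A x) \<partial>M)"
    if h [measurable]: "h \<in> borel_measurable N" for h
    unfolding L_def
    by (subst nn_integral_bind[OF h D]) (auto intro!: nn_integral_cong nn_integral_distr Tx)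
  show "(\<lambda>x. \<integral>\<^sup>+y. g x y \<partial>K (A x)) \<in> borel_measurable M"
    if "(\<lambda>(x, y). g x y) \<in> borel_measurable (M \<Otimes>\<^sub>M B)" for g
    by (rule nn_integral_measurable_subprob_algebra2[OF that KA])
qed

text \<open>Lifts a disintegration from nonnegative to bounded real integrands. The disintegration
  enters as a hypothesis, so that the lemma serves both the convolution of the laws and the glued
  mixtures.\<close>

lemma integral_mixture:
  fixes f :: "'b \<Rightarrow> real"
  assumes L: "prob_space L" and M: "prob_space M" and K: "\<And>x. x \<in> space M \<Longrightarrow> prob_space (K x)"
    and T: "\<And>x. x \<in> space M \<Longrightarrow> T x \<in> K x \<rightarrow>\<^sub>M L"
    and nn: "\<And>h. h \<in> borel_measurable L \<Longrightarrow>
      (\<integral>\<^sup>+x. h x \<partial>L) = (\<integral>\<^sup>+x. \<integral>\<^sup>+y. h (T x y) \<partial>K x \<partial>M)"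
    and mK: "\<And>h. h \<in> borel_measurable L \<Longrightarrow>
      (\<lambda>x. \<integral>\<^sup>+y. h (T x y) \<partial>K x) \<in> borel_measurable M"
    and f [measurable]: "f \<in> borel_measurable L" and B: "\<And>x. \<bar>f x\<bar> \<le> B"
  shows "(\<integral>x. f x \<partial>L) = (\<integral>x. \<integral>y. f (T x y) \<partial>K x \<partial>M)"
    and "integrable M (\<lambda>x. \<integral>y. f (T x y) \<partial>K x)"
proof -
  interpret L: prob_space L by fact
  interpret M: prob_space M by fact
  \<comment> \<open>Adding \<open>B\<close> makes the integrand nonnegative; since all measures are
    probabilities, both sides of the claim change by the same \<open>B\<close>.\<close>
  define g where "g = (\<lambda>x. f x + B)"
  have g [measurable]: "g \<in> borel_measurable L" and g0: "g x \<ge> 0" "\<bar>g x\<bar> \<le> 2 * B" for x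
    using B[of x] by (auto simp: g_def)
  have iL: "integrable L g" "integrable L f"
    by (rule L.integrable_const_bound[where B = "2 * B"]; use g0 in simp)
       (rule L.integrable_const_bound[where B = B]; use B in simp)
  have iK: "integrable (K x) (\<lambda>y. g (T x y))" "integrable (K x) (\<lambda>y. f (T x y))"
    if x: "x \<in> space M" for x
  proof -
    interpret K: prob_space "K x" using K x .
    show "integrable (K x) (\<lambda>y. g (T x y))"
      by (rule K.integrable_const_bound[where B = "2 * B"])
         (use g0 measurable_compose[OF T[OF x] g] in auto)
    show "integrable (K x) (\<lambda>y. f (T x y))"
      by (rule K.integrable_const_bound[where B = B])
         (use B measurable_compose[OF T[OF x] f] in auto)
  qed
  have nK: "(\<integral>\<^sup>+y. g (T x y) \<partial>K x) = ennreal (\<integral>y. g (T x y) \<partial>K x)" if "x \<in> space M" for x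
    by (rule nn_integral_eq_integral[OF iK(1)[OF that]]) (simp add: g0)
  have gf: "(\<integral>y. g (T x y) \<partial>K x) = (\<integral>y. f (T x y) \<partial>K x) + B" if x: "x \<in> space M" for x
  proof -
    interpret K: prob_space "K x" using K x .
    show ?thesis unfolding g_def using iK(2)[OF x] by (simp add: K.prob_space)
  qed
  have "(\<lambda>x. enn2real (\<integral>\<^sup>+y. g (T x y) \<partial>K x)) \<in> borel_measurable M"
    using mK[of "\<lambda>y. ennreal (g y)"] by measurable
  then have mg: "(\<lambda>x. \<integral>y. g (T x y) \<partial>K x) \<in> borel_measurable M"
    by (rule measurable_cong[THEN iffD1, rotated]) (simp add: nK g0 integral_nonneg)
  have ig0: "0 \<le> (\<integral>y. g (T x y) \<partial>K x)" for x by (simp add: g0 integral_nonneg)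
  have eq: "ennreal (\<integral>x. g x \<partial>L) = (\<integral>\<^sup>+x. ennreal (\<integral>y. g (T x y) \<partial>K x) \<partial>M)"
    using nn[of "\<lambda>y. ennreal (g y)"] nn_integral_eq_integral[OF iL(1)] g0
    by (simp add: nK cong: nn_integral_cong)
  have iM: "integrable M (\<lambda>x. \<integral>y. g (T x y) \<partial>K x)"
    by (rule integrableI_nonneg) (use mg ig0 eq in \<open>auto simp flip: eq\<close>)
  have "integrable M (\<lambda>x. (\<integral>y. g (T x y) \<partial>K x) - B)" using iM by simp
  then show i: "integrable M (\<lambda>x. \<integral>y. f (T x y) \<partial>K x)"
    by (rule Bochner_Integration.integrable_cong[THEN iffD1, rotated 2]) (simp_all add: gf)
  have "(\<integral>x. g x \<partial>L) = (\<integral>x. \<integral>y. g (T x y) \<partial>K x \<partial>M)"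
    using eq nn_integral_eq_integral[OF iM] ig0 g0 by (simp add: integral_nonneg)
  also have "\<dots> = (\<integral>x. (\<integral>y. f (T x y) \<partial>K x) + B \<partial>M)"
    by (intro Bochner_Integration.integral_cong) (simp_all add: gf)
  finally show "(\<integral>x. f x \<partial>L) = (\<integral>x. \<integral>y. f (T x y) \<partial>K x \<partial>M)"
    unfolding g_def using i iL by (simp add: M.prob_space L.prob_space)
qed

section \<open>Cost of a coupling and Wasserstein distance\<close>

text \<open>Extended-valued, so that it can be estimated before integrability is known; the Bochner
  integral in \<open>wasserstein\<close> would be 0 for a cost that is not integrable.\<close>

definition transport_cost :: "real \<Rightarrow> ('a::euclidean_space \<times> 'a) measure \<Rightarrow> ennreal" where
  "transport_cost p \<gamma> = (\<integral>\<^sup>+z. ennreal (norm (snd z - fst z) powr p) \<partial>\<gamma>)"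

text \<open>\<open>couplings\<close> prescribes marginals only; total mass one is inherited through
  the first of them.\<close>

lemma couplings_prob:
  assumes \<gamma>: "\<gamma> \<in> couplings \<mu> \<nu>" and \<mu>: "prob_space \<mu>"
  shows "prob_space \<gamma>"
proof
  have s [measurable_cong]: "sets \<gamma> = sets borel" and d: "distr \<gamma> borel fst = \<mu>"
    using \<gamma> by (auto simp: couplings_def)
  have "fst \<in> \<gamma> \<rightarrow>\<^sub>M borel" unfolding measurable_cong_sets[OF s refl] borel_prod[symmetric] by simp
  from emeasure_distr[OF this, of UNIV] show "emeasure \<gamma> (space \<gamma>) = 1"
    using prob_space.emeasure_space_1[OF \<mu>] by (simp add: d flip: d)
qed

lemma wasserstein_space_nn:
  "\<nu> \<in> wasserstein_space p \<longleftrightarrow> prob_space \<nu> \<and> sets \<nu> = sets borel \<and>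
     (\<integral>\<^sup>+x. ennreal (norm x powr p) \<partial>\<nu>) < \<infinity>"
proof -
  have "(\<lambda>x. norm x powr p) \<in> borel_measurable \<nu>" if "sets \<nu> = sets borel"
    unfolding measurable_cong_sets[OF that refl] by measurable
  then show ?thesis
    unfolding wasserstein_space_def by (auto simp: integrable_iff_bounded)
qed

lemma couplings_nonempty:
  fixes \<mu> \<nu> :: "'a::euclidean_space measure"
  assumes "prob_space \<mu>" "sets \<mu> = sets borel" "prob_space \<nu>" "sets \<nu> = sets borel"
  shows "\<mu> \<Otimes>\<^sub>M \<nu> \<in> couplings \<mu> \<nu>"
proof -
  interpret M: prob_space \<mu> by fact
  interpret N: prob_space \<nu> by fact
  interpret pair_prob_space \<mu> \<nu> ..
  have "sets (\<mu> \<Otimes>\<^sub>M \<nu>) = sets (borel :: ('a \<times> 'a) measure)"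
    unfolding borel_prod[symmetric] using assms by (intro sets_pair_measure_cong) auto
  moreover have "distr (\<mu> \<Otimes>\<^sub>M \<nu>) borel fst = \<mu>"
    using N.distr_pair_fst assms(2) by (metis distr_cong)
  moreover have "distr (\<mu> \<Otimes>\<^sub>M \<nu>) borel snd = \<nu>"
  proof (rule measure_eqI)
    fix A assume A: "A \<in> sets (distr (\<mu> \<Otimes>\<^sub>M \<nu>) borel snd)"
    then have [measurable]: "A \<in> sets \<nu>" using assms by simp
    have "emeasure (distr (\<mu> \<Otimes>\<^sub>M \<nu>) borel snd) A = emeasure (\<mu> \<Otimes>\<^sub>M \<nu>) (space \<mu> \<times> A)"
      using A assms
      by (subst emeasure_distr)
         (auto simp: space_pair_measure measurable_cong_sets[OF refl assms(4), symmetric]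
           dest: sets.sets_into_space intro!: arg_cong2[where f = emeasure])
    then show "emeasure (distr (\<mu> \<Otimes>\<^sub>M \<nu>) borel snd) A = emeasure \<nu> A"
      by (simp add: N.emeasure_pair_measure_Times M.emeasure_space_1)
  qed (simp add: assms)
  ultimately show ?thesis by (simp add: couplings_def)
qed

lemma transport_cost_eq:
  fixes \<mu> \<nu> :: "'a::euclidean_space measure"
  assumes p: "p > 0" and "\<mu> \<in> wasserstein_space p" "\<nu> \<in> wasserstein_space p" "\<gamma> \<in> couplings \<mu> \<nu>"
  shows "transport_cost p \<gamma> = ennreal (\<integral>(x, y). norm (y - x) powr p \<partial>\<gamma>)"
  using nn_integral_eq_integral[OF integrable_coupling_cost[OF assms]]
  by (simp add: transport_cost_def split_beta)

text \<open>The strict inequality buys an almost optimal coupling from the infimum. The set of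
  couplings is nonempty because it contains the product measure.\<close>

lemma wasserstein_lessE:
  fixes \<mu> \<nu> :: "'a::euclidean_space measure"
  assumes p: "p > 0" and \<mu>: "\<mu> \<in> wasserstein_space p" and \<nu>: "\<nu> \<in> wasserstein_space p"
    and W: "wasserstein p \<mu> \<nu> < c"
  obtains \<gamma> where "\<gamma> \<in> couplings \<mu> \<nu>" "transport_cost p \<gamma> \<le> ennreal (c powr p)"
proof -
  let ?I = "\<lambda>\<gamma>. \<integral>(x, y). norm (y - x) powr p \<partial>\<gamma>"
  have "couplings \<mu> \<nu> \<noteq> {}"
    using couplings_nonempty[of \<mu> \<nu>] \<mu> \<nu> unfolding wasserstein_space_def by blast
  then obtain \<gamma> where \<gamma>: "\<gamma> \<in> couplings \<mu> \<nu>" "?I \<gamma> powr (1 / p) < c"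
    using cInf_lessD[OF _ W[unfolded wasserstein_def]] by blast
  have "?I \<gamma> \<ge> 0" by (rule integral_nonneg_AE) (simp add: split_beta)
  then have "?I \<gamma> = (?I \<gamma> powr (1 / p)) powr p" using p by (simp add: powr_powr)
  also have "\<dots> \<le> c powr p" using \<gamma>(2) p by (intro powr_mono2) auto
  finally show thesis
    using that[OF \<gamma>(1)] transport_cost_eq[OF p \<mu> \<nu> \<gamma>(1)] by (simp add: ennreal_leI)
qed

text \<open>The moment of \<open>\<nu>\<close> is a conclusion: \<open>|y|\<close> is at most
  \<open>|y - x| + |x|\<close>, and both terms have finite p-th moment under the coupling.\<close>

lemma wasserstein_leI:
  fixes \<mu> \<nu> :: "'a::euclidean_space measure"
  assumes p: "p > 1" and \<mu>: "\<mu> \<in> wasserstein_space p"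
    and \<gamma>: "\<gamma> \<in> couplings \<mu> \<nu>" and c: "c \<ge> 0" and cost: "transport_cost p \<gamma> \<le> ennreal (c powr p)"
  shows "\<nu> \<in> wasserstein_space p" "wasserstein p \<mu> \<nu> \<le> c"
proof -
  interpret prob_space \<gamma> using couplings_prob[OF \<gamma>] \<mu> by (simp add: wasserstein_space_def)
  have s [measurable_cong]: "sets \<gamma> = sets ((borel :: 'a measure) \<Otimes>\<^sub>M (borel :: 'a measure))"
    using \<gamma> unfolding borel_prod by (simp add: couplings_def)
  have d1: "distr \<gamma> borel fst = \<mu>" and d2: "distr \<gamma> borel snd = \<nu>"
    using \<gamma> by (auto simp: couplings_def)
  have "(\<integral>\<^sup>+x. ennreal (norm x powr p) \<partial>\<nu>) = (\<integral>\<^sup>+z. ennreal (norm (snd z) powr p) \<partial>\<gamma>)"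
    unfolding d2[symmetric] by (subst nn_integral_distr) auto
  also have "\<dots> \<le> (\<integral>\<^sup>+z. ennreal (2 powr (p - 1)) *
      (ennreal (norm (snd z - fst z) powr p) + ennreal (norm (fst z) powr p)) \<partial>\<gamma>)"
  proof (rule nn_integral_mono)
    fix z :: "'a \<times> 'a"
    have "norm (snd z) powr p \<le> (norm (snd z - fst z) + norm (fst z)) powr p"
      using p norm_triangle_ineq[of "snd z - fst z" "fst z"] by (intro powr_mono2) auto
    also have "\<dots> \<le> 2 powr (p - 1) * (norm (snd z - fst z) powr p + norm (fst z) powr p)"
      using powr_add_weighted[OF p, of 1 1] by simp
    finally show "ennreal (norm (snd z) powr p) \<le> ennreal (2 powr (p - 1)) *
      (ennreal (norm (snd z - fst z) powr p) + ennreal (norm (fst z) powr p))"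
      by (simp add: ennreal_leI flip: ennreal_plus ennreal_mult)
  qed
  also have "\<dots> = ennreal (2 powr (p - 1)) * (transport_cost p \<gamma> + (\<integral>\<^sup>+z. ennreal (norm (fst z) powr p) \<partial>\<gamma>))"
    by (simp add: nn_integral_cmult nn_integral_add transport_cost_def)
  also have "(\<integral>\<^sup>+z. ennreal (norm (fst z) powr p) \<partial>\<gamma>) = (\<integral>\<^sup>+x. ennreal (norm x powr p) \<partial>\<mu>)"
    unfolding d1[symmetric] by (subst nn_integral_distr) auto
  also have "ennreal (2 powr (p - 1)) * (transport_cost p \<gamma> + \<dots>) < \<infinity>"
    using cost \<mu> by (auto simp: wasserstein_space_nn ennreal_mult_less_top intro: le_less_trans)
  finally show \<nu>: "\<nu> \<in> wasserstein_space p"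
    unfolding wasserstein_space_nn using prob_space_distr[of snd borel] by (simp add: d2 flip: d2)
  let ?I = "\<integral>(x, y). norm (y - x) powr p \<partial>\<gamma>"
  have I0: "?I \<ge> 0" by (rule integral_nonneg_AE) (simp add: split_beta)
  have "?I \<le> c powr p"
    using cost transport_cost_eq[OF _ \<mu> \<nu> \<gamma>] p by (simp add: ennreal_le_iff)
  then have "?I powr (1 / p) \<le> (c powr p) powr (1 / p)"
    using p I0 by (intro powr_mono2) auto
  also have "\<dots> = c" using p c by (simp add: powr_powr)
  finally have "?I powr (1 / p) \<le> c" .
  moreover have "wasserstein p \<mu> \<nu> \<le> ?I powr (1 / p)"
    unfolding wasserstein_def by (rule cINF_lower[OF _ \<gamma>]) (auto intro!: bdd_belowI[of _ 0])
  ultimately show "wasserstein p \<mu> \<nu> \<le> c" by simp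
qed

text \<open>Jensen's inequality by way of Young's inequality at scale \<open>c\<close>: integrating
  \<open>Z/c \<le> (1 - 1/p) + (Z/c) powr p / p\<close> gives at most 1. The same affine majorant in
  \<open>Z powr p\<close> supplies integrability of \<open>Z\<close>.\<close>

lemma transport_cost_mean:
  fixes \<gamma> :: "('a::euclidean_space \<times> 'a) measure"
  assumes p: "p > 1" and "prob_space \<gamma>" and s: "sets \<gamma> = sets borel"
    and c: "c > 0" and cost: "transport_cost p \<gamma> \<le> ennreal (c powr p)"
  defines "Z \<equiv> \<lambda>z. norm (snd z - fst z)"
  shows "integrable \<gamma> Z" "(\<integral>z. Z z \<partial>\<gamma>) \<le> c"
    and "integrable \<gamma> (\<lambda>z. Z z powr p)" "(\<integral>z. Z z powr p \<partial>\<gamma>) \<le> c powr p"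
proof -
  interpret prob_space \<gamma> by fact
  have [measurable_cong]: "sets \<gamma> = sets ((borel :: 'a measure) \<Otimes>\<^sub>M (borel :: 'a measure))"
    using s unfolding borel_prod .
  have mZ [measurable]: "Z \<in> borel_measurable \<gamma>" unfolding Z_def by measurable
  have nn: "(\<integral>\<^sup>+z. ennreal (Z z powr p) \<partial>\<gamma>) \<le> ennreal (c powr p)"
    using cost by (simp add: transport_cost_def Z_def)
  show i: "integrable \<gamma> (\<lambda>z. Z z powr p)"
    by (rule integrableI_nonneg) (use nn in \<open>auto intro: le_less_trans\<close>)
  show le: "(\<integral>z. Z z powr p \<partial>\<gamma>) \<le> c powr p"
    using nn nn_integral_eq_integral[OF i] by (simp add: ennreal_le_iff)
  have Z: "Z z \<le> c * (1 - 1 / p) + c * (c powr - p) / p * Z z powr p" "Z z \<ge> 0" for z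
  proof -
    show "Z z \<ge> 0" by (simp add: Z_def)
    have "Z z / c \<le> (1 - 1 / p) + (Z z / c) powr p / p"
      using p c by (intro le_powr_Young) (auto simp: Z_def)
    also have "(Z z / c) powr p = Z z powr p * c powr - p"
      using c by (simp add: Z_def powr_divide powr_minus_divide)
    finally show "Z z \<le> c * (1 - 1 / p) + c * (c powr - p) / p * Z z powr p"
      using c by (simp add: field_simps)
  qed
  have ir: "integrable \<gamma> (\<lambda>z. c * (1 - 1 / p) + c * (c powr - p) / p * Z z powr p)"
    using i by simp
  show iZ: "integrable \<gamma> Z"
    by (rule Bochner_Integration.integrable_bound[OF ir]) (use mZ order_trans[OF Z(1) abs_ge_self] Z(2) in \<open>auto intro!: AE_I2 simp del: split_paired_All\<close>)
  have "(\<integral>z. Z z \<partial>\<gamma>) \<le> (\<integral>z. c * (1 - 1 / p) + c * (c powr - p) / p * Z z powr p \<partial>\<gamma>)"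
    by (rule integral_mono[OF iZ ir]) (rule Z)
  also have "\<dots> = c * (1 - 1 / p) + c * (c powr - p) / p * (\<integral>z. Z z powr p \<partial>\<gamma>)"
    using i by (simp add: prob_space)
  also have "\<dots> \<le> c * (1 - 1 / p) + c * (c powr - p) / p * c powr p"
    using le p c by (intro add_left_mono mult_left_mono) auto
  also have "\<dots> = c" using c p by (simp add: powr_minus field_simps)
  finally show "(\<integral>z. Z z \<partial>\<gamma>) \<le> c" .
qed

section \<open>Functions vanishing at infinity\<close>

lemma C0_continuous: "f \<in> C0 \<Longrightarrow> continuous_on A f"
  by (auto simp: C0_def intro: continuous_on_subset)

lemma C0_measurable [measurable_dest]: "f \<in> C0 \<Longrightarrow> f \<in> borel_measurable borel"
  by (rule borel_measurable_continuous_onI) (rule C0_continuous)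

lemma C0_bounded:
  assumes "f \<in> C0"
  obtains B where "B \<ge> 0" "\<And>x. \<bar>f x\<bar> \<le> B"
proof -
  obtain B where B: "\<And>x. norm (f x) \<le> B"
    using assms C0_subset_bcontfun unfolding bcontfun_def bounded_iff by blast
  show thesis by (rule that[of "max B 0"]) (use B in \<open>auto simp: le_max_iff_disj\<close>)
qed

lemma C0_small_outside:
  assumes "f \<in> C0" "e > 0"
  obtains R where "R \<ge> 0" "\<And>x. norm x \<ge> R \<Longrightarrow> \<bar>f x\<bar> < e"
proof -
  have "eventually (\<lambda>x. dist (f x) 0 < e) at_infinity"
    using assms unfolding C0_def tendsto_iff by auto
  then obtain R where R: "\<And>x. R \<le> norm x \<Longrightarrow> \<bar>f x\<bar> < e"
    unfolding eventually_at_infinity by auto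
  show thesis by (rule that[of "max R 0"]) (use R in auto)
qed

lemma C0_uniform:
  fixes f :: "'a::euclidean_space \<Rightarrow> real"
  assumes f: "f \<in> C0" and e: "e > 0"
  obtains d where "d > 0" "\<And>a b. norm (a - b) < d \<Longrightarrow> \<bar>f a - f b\<bar> \<le> e"
proof -
  obtain R where R: "R \<ge> 0" "\<And>x. norm x \<ge> R \<Longrightarrow> \<bar>f x\<bar> < e / 2"
    using C0_small_outside[OF f, of "e / 2"] e by auto
  \<comment> \<open>The margin 1, matched by \<open>min d 1\<close> below, ensures that two close
    points lie either both in this ball or both at norm at least \<open>R\<close>, where
    \<open>f\<close> is small.\<close>
  have "uniformly_continuous_on (cball 0 (R + 1)) f"
    by (rule compact_uniformly_continuous) (use C0_continuous[OF f] in auto)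
  then obtain d where d: "d > 0"
    "\<And>a b. \<lbrakk>a \<in> cball 0 (R + 1); b \<in> cball 0 (R + 1); dist a b < d\<rbrakk> \<Longrightarrow> dist (f a) (f b) < e"
    unfolding uniformly_continuous_on_def using e by (metis dist_commute)
  show thesis
  proof (rule that[of "min d 1"])
    fix a b :: 'a assume ab: "norm (a - b) < min d 1"
    show "\<bar>f a - f b\<bar> \<le> e"
    proof (cases "norm a \<le> R + 1 \<and> norm b \<le> R + 1")
      case True
      then show ?thesis using d(2)[of a b] ab by (auto simp: dist_norm)
    next
      case False
      moreover have "norm a \<le> norm b + 1" "norm b \<le> norm a + 1"
        using ab norm_triangle_ineq3[of a b] by auto
      ultimately show ?thesis using R(2)[of a] R(2)[of b] by (auto simp: abs_if split: if_splits)
    qed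
  qed (use d in auto)
qed

text \<open>Beyond the distance \<open>d\<close> of uniform continuity, the oscillation
  \<open>2 * B\<close> is absorbed by the slope \<open>2 * B / d\<close>. A bound affine in the
  distance can be integrated against a coupling of which only the mean displacement is
  controlled.\<close>

lemma C0_almost_Lipschitz:
  fixes f :: "'a::euclidean_space \<Rightarrow> real"
  assumes f: "f \<in> C0" and e: "e > 0"
  obtains L where "L \<ge> 0" "\<And>a b. \<bar>f a - f b\<bar> \<le> e + L * norm (a - b)"
proof -
  obtain d where d: "d > 0" "\<And>a b. norm (a - b) < d \<Longrightarrow> \<bar>f a - f b\<bar> \<le> e"
    using C0_uniform[OF f e] by blast
  obtain B where B: "B \<ge> 0" "\<And>x. \<bar>f x\<bar> \<le> B" using C0_bounded[OF f] by blast
  show thesis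
  proof (rule that[of "2 * B / d"])
    fix a b :: 'a
    show "\<bar>f a - f b\<bar> \<le> e + 2 * B / d * norm (a - b)"
    proof (cases "norm (a - b) < d")
      case True
      then have "\<bar>f a - f b\<bar> \<le> e" by (rule d)
      moreover have "0 \<le> 2 * B / d * norm (a - b)" using B d by simp
      ultimately show ?thesis by linarith
    next
      case False
      have "\<bar>f a - f b\<bar> \<le> 2 * B" using B(2)[of a] B(2)[of b] by linarith
      also have "\<dots> = 2 * B / d * d" using d by simp
      also have "\<dots> \<le> 2 * B / d * norm (a - b)" using False B d by (intro mult_left_mono) auto
      finally show ?thesis using e by linarith
    qed
  qed (use B d in auto)
qed

lemma C0_ops:
  assumes "f \<in> C0" "g \<in> C0"
  shows "(\<lambda>x. f x + g x) \<in> C0" "(\<lambda>x. f x - g x) \<in> C0" "(\<lambda>x. c * f x) \<in> C0"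
  using assms by (auto simp: C0_def intro!: continuous_intros tendsto_eq_intros)

lemma integrable_C0_shift:
  assumes "f \<in> C0" "prob_space \<nu>" and s [measurable_cong]: "sets \<nu> = sets borel"
  shows "integrable \<nu> (\<lambda>y. f (x + y))"
proof -
  interpret prob_space \<nu> by fact
  obtain B where B: "\<And>x. \<bar>f x\<bar> \<le> B" using C0_bounded[OF assms(1)] by blast
  note [measurable] = C0_measurable[OF assms(1)]
  show ?thesis by (rule integrable_const_bound[where B = B]) (use B in auto)
qed

lemma integral_prob_le:
  fixes f g :: "'a \<Rightarrow> real"
  assumes "prob_space \<nu>" "integrable \<nu> f" "integrable \<nu> g" "\<And>y. f y \<le> g y + c"
  shows "(\<integral>y. f y \<partial>\<nu>) \<le> (\<integral>y. g y \<partial>\<nu>) + c"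
proof -
  interpret prob_space \<nu> by fact
  have "(\<integral>y. f y \<partial>\<nu>) \<le> (\<integral>y. g y + c \<partial>\<nu>)" using assms by (intro integral_mono) auto
  then show ?thesis using assms by (simp add: prob_space)
qed

section \<open>The perturbed operators\<close>

text \<open>The Levy process enters through its laws alone: a convolution semigroup with finite p-th
  moments that is stochastically continuous at time 0.\<close>

locale wasserstein_perturbation =
  fixes p \<delta> :: real and \<mu> :: "real \<Rightarrow> 'a::euclidean_space measure"
  assumes p: "p > 1" and \<delta>: "\<delta> \<ge> 0"
    and mu_space: "t \<ge> 0 \<Longrightarrow> \<mu> t \<in> wasserstein_space p"
    and mu_add: "\<lbrakk>s \<ge> 0; t \<ge> 0; h \<in> borel_measurable borel\<rbrakk> \<Longrightarrow>
      (\<integral>\<^sup>+z. h z \<partial>\<mu> (s + t)) = (\<integral>\<^sup>+x. \<integral>\<^sup>+y. h (x + y) \<partial>\<mu> t \<partial>\<mu> s)"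
    and mu_0: "\<mu> 0 = return borel 0"
    and mu_small: "r > 0 \<Longrightarrow> ((\<lambda>h. measure (\<mu> h) {y. norm y > r}) \<longlongrightarrow> 0) (at_right 0)"
begin

abbreviation "S \<equiv> wasserstein_op p \<delta> \<mu>"
abbreviation "P \<equiv> feller_op \<mu>"

definition ambiguity :: "real \<Rightarrow> 'a measure set" where
  "ambiguity t = {\<nu> \<in> wasserstein_space p. wasserstein p (\<mu> t) \<nu> \<le> \<delta> * t}"

lemma mu_prob: "t \<ge> 0 \<Longrightarrow> prob_space (\<mu> t)" and mu_sets: "t \<ge> 0 \<Longrightarrow> sets (\<mu> t) = sets borel"
  using mu_space by (auto simp: wasserstein_space_def)

lemma ambiguity_prob: "\<nu> \<in> ambiguity t \<Longrightarrow> prob_space \<nu>"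
  and ambiguity_sets: "\<nu> \<in> ambiguity t \<Longrightarrow> sets \<nu> = sets borel"
  by (auto simp: ambiguity_def wasserstein_space_def)

lemma ambiguity_integrable: "\<lbrakk>\<nu> \<in> ambiguity t; f \<in> C0\<rbrakk> \<Longrightarrow> integrable \<nu> (\<lambda>y. f (x + y))"
  by (rule integrable_C0_shift[OF _ ambiguity_prob ambiguity_sets])

lemma mu_integrable: "\<lbrakk>t \<ge> 0; f \<in> C0\<rbrakk> \<Longrightarrow> integrable (\<mu> t) (\<lambda>y. f (x + y))"
  by (rule integrable_C0_shift[OF _ mu_prob mu_sets])

section \<open>Transport bounds on the ambiguity sets\<close>

lemma ambiguity_coupling:
  assumes t: "t \<ge> 0" and \<nu>: "\<nu> \<in> ambiguity t" and c: "c > \<delta> * t"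
  obtains \<gamma> where "\<gamma> \<in> couplings (\<mu> t) \<nu>" "transport_cost p \<gamma> \<le> ennreal (c powr p)"
    "prob_space \<gamma>" "sets \<gamma> = sets borel"
proof -
  obtain \<gamma> where \<gamma>: "\<gamma> \<in> couplings (\<mu> t) \<nu>" "transport_cost p \<gamma> \<le> ennreal (c powr p)"
    by (rule wasserstein_lessE[of p "\<mu> t" \<nu> c]) (use p mu_space[OF t] \<nu> c in \<open>auto simp: ambiguity_def\<close>)
  moreover have "prob_space \<gamma>" using couplings_prob[OF \<gamma>(1) mu_prob[OF t]] .
  moreover have "sets \<gamma> = sets borel" using \<gamma> by (auto simp: couplings_def)
  ultimately show thesis using that by blast
qed

lemma integral_coupling_diff:
  fixes g :: "'a \<Rightarrow> real"
  assumes t: "t \<ge> 0" and \<gamma>: "\<gamma> \<in> couplings (\<mu> t) \<nu>" "sets \<gamma> = sets borel"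
    and g: "integrable \<nu> g" "integrable (\<mu> t) g"
  shows "integrable \<gamma> (\<lambda>z. g (snd z) - g (fst z))"
    and "(\<integral>z. g (snd z) - g (fst z) \<partial>\<gamma>) = (\<integral>y. g y \<partial>\<nu>) - (\<integral>y. g y \<partial>\<mu> t)"
proof -
  have [measurable_cong]: "sets \<gamma> = sets ((borel :: 'a measure) \<Otimes>\<^sub>M (borel :: 'a measure))"
    using \<gamma>(2) unfolding borel_prod .
  have d: "distr \<gamma> borel fst = \<mu> t" "distr \<gamma> borel snd = \<nu>"
    using \<gamma> by (auto simp: couplings_def)
  have [measurable]: "g \<in> borel_measurable borel"
    using borel_measurable_integrable[OF g(2)] by (simp add: measurable_cong_sets[OF mu_sets[OF t] refl])
  have "integrable \<gamma> (\<lambda>z. g (snd z))" "integrable \<gamma> (\<lambda>z. g (fst z))"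
    using g d integrable_distr_eq[of snd \<gamma> borel g] integrable_distr_eq[of fst \<gamma> borel g] by simp_all
  moreover have "(\<integral>y. g y \<partial>\<nu>) = (\<integral>z. g (snd z) \<partial>\<gamma>)" "(\<integral>y. g y \<partial>\<mu> t) = (\<integral>z. g (fst z) \<partial>\<gamma>)"
    using d integral_distr[of snd \<gamma> borel g] integral_distr[of fst \<gamma> borel g] by simp_all
  ultimately show "integrable \<gamma> (\<lambda>z. g (snd z) - g (fst z))"
    and "(\<integral>z. g (snd z) - g (fst z) \<partial>\<gamma>) = (\<integral>y. g y \<partial>\<nu>) - (\<integral>y. g y \<partial>\<mu> t)"
    by auto
qed

text \<open>The easy half of Kantorovich duality: integrate the almost-Lipschitz bound against a
  nearly optimal coupling and use its mean displacement.\<close>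

lemma ambiguity_transport:
  fixes g :: "'a \<Rightarrow> real"
  assumes t: "t \<ge> 0" and \<nu>: "\<nu> \<in> ambiguity t" and g: "g \<in> C0"
    and L: "L \<ge> 0" "\<And>a b. \<bar>g a - g b\<bar> \<le> e + L * norm (a - b)"
  shows "\<bar>(\<integral>y. g (x + y) \<partial>\<nu>) - (\<integral>y. g (x + y) \<partial>\<mu> t)\<bar> \<le> e + L * (\<delta> * t)"
proof (rule field_le_epsilon)
  fix \<eta> :: real assume \<eta>: "\<eta> > 0"
  \<comment> \<open>The slack costs \<open>L * (\<eta> / (L + 1)) \<le> \<eta>\<close>; the added 1
    covers \<open>L = 0\<close>.\<close>
  define c where "c = \<delta> * t + \<eta> / (L + 1)"
  have \<delta>t: "\<delta> * t \<ge> 0" using \<delta> t by simp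
  have c: "c > \<delta> * t" using \<eta> L by (auto simp: c_def)
  obtain \<gamma> where \<gamma>: "\<gamma> \<in> couplings (\<mu> t) \<nu>" "transport_cost p \<gamma> \<le> ennreal (c powr p)"
    and \<gamma>': "prob_space \<gamma>" "sets \<gamma> = sets borel"
    using ambiguity_coupling[OF t \<nu> c] .
  interpret prob_space \<gamma> by fact
  note cost = transport_cost_mean[OF p \<gamma>' order.strict_trans1[OF \<delta>t c] \<gamma>(2)]
  note diff = integral_coupling_diff[OF t \<gamma>(1) \<gamma>'(2) ambiguity_integrable[OF \<nu> g] mu_integrable[OF t g]]
  have bnd: "\<bar>g (x + snd z) - g (x + fst z)\<bar> \<le> e + L * norm (snd z - fst z)" for z
    using L(2)[of "x + snd z" "x + fst z"] by simp
  have "\<bar>\<integral>z. g (x + snd z) - g (x + fst z) \<partial>\<gamma>\<bar> \<le> (\<integral>z. \<bar>g (x + snd z) - g (x + fst z)\<bar> \<partial>\<gamma>)"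
    by (rule integral_abs_bound)
  also have "\<dots> \<le> (\<integral>z. e + L * norm (snd z - fst z) \<partial>\<gamma>)"
    using bnd diff(1) cost(1) by (intro integral_mono) auto
  also have "\<dots> = e + L * (\<integral>z. norm (snd z - fst z) \<partial>\<gamma>)"
    using cost(1) by (simp add: prob_space)
  also have "\<dots> \<le> e + L * c" using cost(2) L by (intro add_left_mono mult_left_mono) auto
  also have "\<dots> \<le> e + L * (\<delta> * t) + \<eta>"
  proof -
    have "L * (\<eta> / (L + 1)) \<le> \<eta>" using \<eta> L by (simp add: field_simps)
    then show ?thesis by (simp add: c_def distrib_left)
  qed
  finally show "\<bar>(\<integral>y. g (x + y) \<partial>\<nu>) - (\<integral>y. g (x + y) \<partial>\<mu> t)\<bar> \<le> e + L * (\<delta> * t) + \<eta>"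
    unfolding diff(2) .
qed

text \<open>Coupling each point with its translate costs exactly the length of the translation.
  These competitors produce the drift term of the equation from below.\<close>

lemma ambiguity_shift:
  assumes t: "t \<ge> 0" and a: "norm a \<le> \<delta>"
  shows "distr (\<mu> t) borel (\<lambda>y. y + t *\<^sub>R a) \<in> ambiguity t"
proof -
  interpret prob_space "\<mu> t" using mu_prob[OF t] .
  note [measurable_cong] = mu_sets[OF t]
  let ?\<gamma> = "distr (\<mu> t) (borel \<Otimes>\<^sub>M borel) (\<lambda>y. (y, y + t *\<^sub>R a))"
  have "distr ?\<gamma> borel fst = \<mu> t"
    by (subst distr_distr) (auto simp: comp_def mu_sets[OF t] intro!: distr_id2)
  moreover have "distr ?\<gamma> borel snd = distr (\<mu> t) borel (\<lambda>y. y + t *\<^sub>R a)"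
    by (subst distr_distr) (auto simp: comp_def)
  ultimately have \<gamma>: "?\<gamma> \<in> couplings (\<mu> t) (distr (\<mu> t) borel (\<lambda>y. y + t *\<^sub>R a))"
    by (simp add: couplings_def borel_prod)
  have "transport_cost p ?\<gamma> = ennreal (norm (t *\<^sub>R a) powr p)"
    unfolding transport_cost_def by (subst nn_integral_distr) (auto simp: emeasure_space_1)
  also have "\<dots> \<le> ennreal ((\<delta> * t) powr p)"
    using mult_right_mono[OF a t] t p by (intro ennreal_leI powr_mono2) (auto simp: mult.commute)
  finally show ?thesis
    using wasserstein_leI[OF p mu_space[OF t] \<gamma>, of "\<delta> * t"] \<delta> t by (auto simp: ambiguity_def)
qed

text \<open>Also supplies nonemptiness of the set under the supremum in \<open>S\<close>, without
  which \<open>Sup\<close> would say nothing.\<close>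

lemma mu_ambiguity: "t \<ge> 0 \<Longrightarrow> \<mu> t \<in> ambiguity t"
  using ambiguity_shift[of t 0] \<delta> mu_sets[of t] by (simp add: distr_id2)

section \<open>The supremum operators on C0\<close>

lemma S_least: "\<lbrakk>t \<ge> 0; \<And>\<nu>. \<nu> \<in> ambiguity t \<Longrightarrow> (\<integral>y. f (x + y) \<partial>\<nu>) \<le> b\<rbrakk> \<Longrightarrow> S t f x \<le> b"
  unfolding wasserstein_op_def
  by (rule cSup_least) (use mu_ambiguity[of t] in \<open>auto simp: ambiguity_def\<close>)

lemma S_upper:
  assumes f: "f \<in> C0" and \<nu>: "\<nu> \<in> ambiguity t"
  shows "(\<integral>y. f (x + y) \<partial>\<nu>) \<le> S t f x"
proof -
  obtain B where B: "\<And>x. \<bar>f x\<bar> \<le> B" using C0_bounded[OF f] by blast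
  show ?thesis unfolding wasserstein_op_def
  proof (rule cSup_upper)
    show "bdd_above {(\<integral>y. f (x + y) \<partial>\<nu>) | \<nu>. \<nu> \<in> wasserstein_space p \<and> wasserstein p (\<mu> t) \<nu> \<le> \<delta> * t}"
    proof (rule bdd_aboveI[of _ B], clarify)
      fix \<kappa> assume "\<kappa> \<in> wasserstein_space p" "wasserstein p (\<mu> t) \<kappa> \<le> \<delta> * t"
      then have \<kappa>: "\<kappa> \<in> ambiguity t" by (simp add: ambiguity_def)
      interpret prob_space \<kappa> using ambiguity_prob[OF \<kappa>] .
      show "(\<integral>y. f (x + y) \<partial>\<kappa>) \<le> B"
        using integral_le_const[OF ambiguity_integrable[OF \<kappa> f], of x B] B by (auto simp: abs_le_iff)
    qed
  qed (use \<nu> in \<open>auto simp: ambiguity_def\<close>)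
qed

lemma S_approx:
  assumes "t \<ge> 0" "e > 0"
  obtains \<nu> where "\<nu> \<in> ambiguity t" "S t f x - e \<le> (\<integral>y. f (x + y) \<partial>\<nu>)"
proof -
  have "\<exists>\<nu>\<in>ambiguity t. S t f x - e \<le> (\<integral>y. f (x + y) \<partial>\<nu>)"
    using S_least[of t f x "S t f x - e"] assms by (force simp: not_le)
  then show thesis using that by blast
qed

lemma P_le_S: "\<lbrakk>t \<ge> 0; f \<in> C0\<rbrakk> \<Longrightarrow> P t f x \<le> S t f x"
  unfolding feller_op_def by (rule S_upper[OF _ mu_ambiguity])

lemma S_mono_add:
  assumes "t \<ge> 0" "f \<in> C0" "g \<in> C0" "\<And>x. f x \<le> g x + c"
  shows "S t f x \<le> S t g x + c"
proof (rule S_least)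
  fix \<nu> assume \<nu>: "\<nu> \<in> ambiguity t"
  have "(\<integral>y. f (x + y) \<partial>\<nu>) \<le> (\<integral>y. g (x + y) \<partial>\<nu>) + c"
    using assms \<nu> by (intro integral_prob_le ambiguity_integrable[OF \<nu>] ambiguity_prob[OF \<nu>]) auto
  also have "\<dots> \<le> S t g x + c" using S_upper[OF assms(3) \<nu>] by simp
  finally show "(\<integral>y. f (x + y) \<partial>\<nu>) \<le> S t g x + c" .
qed fact

lemma S_mono: "\<lbrakk>t \<ge> 0; f \<in> C0; g \<in> C0; \<And>x. f x \<le> g x\<rbrakk> \<Longrightarrow> S t f x \<le> S t g x"
  using S_mono_add[of t f g 0] by simp

text \<open>The same \<open>\<nu>\<close> competes at both points, so translation invariance
  preserves the pair \<open>d\<close>, \<open>e\<close>. Since the pair is unchanged, iterates and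
  limits inherit it.\<close>

lemma S_modulus:
  assumes "t \<ge> 0" "f \<in> C0" "\<And>a b. norm (a - b) < d \<Longrightarrow> \<bar>f a - f b\<bar> \<le> e" "norm (a - b) < d"
  shows "\<bar>S t f a - S t f b\<bar> \<le> e"
proof -
  have *: "S t f a \<le> S t f b + e" if ab: "norm (a - b) < d" for a b
  proof (rule S_least)
    fix \<nu> assume \<nu>: "\<nu> \<in> ambiguity t"
    have "(\<integral>y. f (a + y) \<partial>\<nu>) \<le> (\<integral>y. f (b + y) \<partial>\<nu>) + e"
    proof (intro integral_prob_le ambiguity_integrable[OF \<nu>] ambiguity_prob[OF \<nu>] assms)
      fix y show "f (a + y) \<le> f (b + y) + e"
        using assms(3)[of "a + y" "b + y"] ab by auto
    qed
    also have "\<dots> \<le> S t f b + e" using S_upper[OF assms(2) \<nu>] by simp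
    finally show "(\<integral>y. f (a + y) \<partial>\<nu>) \<le> S t f b + e" .
  qed fact
  show ?thesis using *[of a b] *[of b a] assms(4) by (auto simp: norm_minus_commute abs_le_iff)
qed

lemma P_C0: "\<lbrakk>t \<ge> 0; f \<in> C0\<rbrakk> \<Longrightarrow> P t f \<in> C0"
  by (rule feller_op_C0[OF mu_prob mu_sets])

text \<open>Continuity is inherited from the modulus. For the decay, the values must be small
  uniformly over the ambiguity set: \<open>|f|\<close> is dominated up to \<open>e\<close> by a flat
  tent-like \<open>g\<close>, and passing from \<open>\<nu>\<close> to \<open>\<mu> t\<close>
  changes the integral of \<open>g\<close> by at most \<open>e\<close>. What remains is
  \<open>P t g\<close>, which vanishes at infinity.\<close>

lemma S_C0:
  assumes t: "t \<ge> 0" and f: "f \<in> C0"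
  shows "S t f \<in> C0"
proof -
  have "continuous_on UNIV (S t f)"
    unfolding continuous_on_iff
  proof clarsimp
    fix x :: 'a and e :: real assume e: "e > 0"
    obtain d where d: "d > 0" "\<And>a b. norm (a - b) < d \<Longrightarrow> \<bar>f a - f b\<bar> \<le> e / 2"
      using C0_uniform[OF f, of "e / 2"] e by auto
    show "\<exists>d>0. \<forall>x'. dist x' x < d \<longrightarrow> dist (S t f x') (S t f x) < e"
      using S_modulus[OF t f d(2)] d(1) e by (intro exI[of _ d]) (fastforce simp: dist_norm)
  qed
  moreover have "(S t f \<longlongrightarrow> 0) at_infinity"
  proof (rule tendstoI)
    fix e0 :: real assume "e0 > 0"
    define e where "e = e0 / 4"
    have e: "e > 0" using \<open>e0 > 0\<close> by (simp add: e_def)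
    obtain R where R: "R \<ge> 0" "\<And>x. norm x \<ge> R \<Longrightarrow> \<bar>f x\<bar> < e"
      using C0_small_outside[OF f e] by blast
    obtain B where B: "B \<ge> 0" "\<And>x. \<bar>f x\<bar> \<le> B" using C0_bounded[OF f] by blast
    define L where "L = e / (\<delta> * t + 1)"
    have \<delta>t: "\<delta> * t \<ge> 0" using \<delta> t by simp
    have L: "L > 0" "L * (\<delta> * t) \<le> e" using e \<delta>t by (auto simp: L_def field_simps)
    \<comment> \<open>a majorant of \<open>f - e\<close> in \<open>C0\<close> whose Lipschitz constant is so small that transport costs at most \<open>e\<close>\<close>
    define g where "g = (\<lambda>z::'a. max 0 (B - L * max 0 (norm z - R)))"
    have gL: "\<bar>g a - g b\<bar> \<le> 0 + L * norm (a - b)" for a b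
    proof -
      have "\<bar>L * max 0 (norm a - R) - L * max 0 (norm b - R)\<bar> = L * \<bar>max 0 (norm a - R) - max 0 (norm b - R)\<bar>"
        using L by (simp add: abs_mult flip: right_diff_distrib)
      also have "\<dots> \<le> L * norm (a - b)"
        using L norm_triangle_ineq3[of a b] by (intro mult_left_mono) (auto simp: max_def)
      finally show ?thesis unfolding g_def by (auto simp: max_def split: if_splits)
    qed
    have g0: "g z = 0" if "norm z \<ge> R + B / L" for z
    proof -
      have "B = L * (B / L)" using L by simp
      also have "\<dots> \<le> L * max 0 (norm z - R)" using that L by (intro mult_left_mono) auto
      finally show ?thesis by (simp add: g_def)
    qed
    have "eventually (\<lambda>z. g z = 0) at_infinity"
      unfolding eventually_at_infinity using g0 by blast
    then have "(g \<longlongrightarrow> 0) at_infinity" by (rule tendsto_eventually)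
    moreover have "continuous_on UNIV g" unfolding g_def by (intro continuous_intros)
    ultimately have gC: "g \<in> C0" by (simp add: C0_def)
    have fg: "\<bar>f z\<bar> \<le> g z + e" for z
      using R(2)[of z] B(2)[of z] e by (cases "norm z \<ge> R") (auto simp: g_def max_def)
    have bnd: "\<bar>\<integral>y. f (x + y) \<partial>\<nu>\<bar> \<le> P t g x + 2 * e" if \<nu>: "\<nu> \<in> ambiguity t" for \<nu> x
    proof -
      have "\<bar>\<integral>y. f (x + y) \<partial>\<nu>\<bar> \<le> (\<integral>y. \<bar>f (x + y)\<bar> \<partial>\<nu>)" by (rule integral_abs_bound)
      also have "\<dots> \<le> (\<integral>y. g (x + y) \<partial>\<nu>) + e"
        by (rule integral_prob_le[OF ambiguity_prob[OF \<nu>]])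
           (use ambiguity_integrable[OF \<nu>] f gC fg in auto)
      also have "\<dots> \<le> (P t g x + L * (\<delta> * t)) + e"
        using ambiguity_transport[OF t \<nu> gC _ gL, of x] L by (simp add: feller_op_def abs_le_iff)
      finally show ?thesis using L by simp
    qed
    have S: "\<bar>S t f x\<bar> \<le> P t g x + 2 * e" for x
    proof -
      have "S t f x \<le> P t g x + 2 * e" using bnd[of _ x] by (intro S_least[OF t]) (simp add: abs_le_iff)
      moreover have "- S t f x \<le> P t g x + 2 * e"
        using bnd[OF mu_ambiguity[OF t], of x] S_upper[OF f mu_ambiguity[OF t], of x] by (simp add: abs_le_iff)
      ultimately show ?thesis by simp
    qed
    have "(P t g \<longlongrightarrow> 0) at_infinity" using P_C0[OF t gC] by (simp add: C0_def)
    then have "eventually (\<lambda>x. dist (P t g x) 0 < e) at_infinity" using e by (rule tendstoD)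
    then show "eventually (\<lambda>x. dist (S t f x) 0 < e0) at_infinity"
    proof eventually_elim
      case (elim x)
      then show ?case using S[of x] e unfolding e_def dist_real_def by linarith
    qed
  qed
  ultimately show ?thesis by (simp add: C0_def)
qed

section \<open>Behaviour as time tends to zero\<close>

lemma P_0: "f \<in> C0 \<Longrightarrow> P 0 f = f"
  by (rule ext) (simp add: feller_op_def mu_0 integral_return C0_measurable measurable_compose[OF _ C0_measurable])

lemma S_small_of_P:
  assumes t: "t \<ge> 0" and f: "f \<in> C0"
    and L: "L \<ge> 0" "\<And>a b. \<bar>f a - f b\<bar> \<le> e + L * norm (a - b)"
  shows "S t f x \<le> P t f x + e + L * (\<delta> * t)"
proof (rule S_least[OF t])
  fix \<nu> assume "\<nu> \<in> ambiguity t"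
  from ambiguity_transport[OF t this f L, of x]
  show "(\<integral>y. f (x + y) \<partial>\<nu>) \<le> P t f x + e + L * (\<delta> * t)"
    by (simp add: feller_op_def abs_le_iff)
qed

text \<open>At time 0 the allowed transport distance is 0, so by the almost-Lipschitz bound every
  competitor integrates \<open>f\<close> like the point mass at 0, up to an arbitrary
  \<open>e\<close>.\<close>

lemma S_0: assumes f: "f \<in> C0" shows "S 0 f = f"
proof (rule ext)
  fix x
  have "S 0 f x \<le> f x"
  proof (rule field_le_epsilon)
    fix e :: real assume "e > 0"
    then obtain L where "L \<ge> 0" "\<And>a b. \<bar>f a - f b\<bar> \<le> e + L * norm (a - b)"
      using C0_almost_Lipschitz[OF f] by blast
    from S_small_of_P[OF _ f this, of 0 x] show "S 0 f x \<le> f x + e" by (simp add: P_0 f)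
  qed
  moreover have "f x \<le> S 0 f x" using P_le_S[of 0 f x] f by (simp add: P_0)
  ultimately show "S 0 f x = f x" by simp
qed

lemma P_small:
  assumes f: "f \<in> C0" and e: "e > 0"
  obtains d where "d > 0" "\<And>h x. \<lbrakk>0 \<le> h; h < d\<rbrakk> \<Longrightarrow> \<bar>P h f x - f x\<bar> \<le> e"
proof -
  obtain r where r: "r > 0" "\<And>a b. norm (a - b) < r \<Longrightarrow> \<bar>f a - f b\<bar> \<le> e / 2"
    using C0_uniform[OF f, of "e / 2"] e by auto
  obtain B where B: "B \<ge> 0" "\<And>x. \<bar>f x\<bar> \<le> B" using C0_bounded[OF f] by blast
  \<comment> \<open>On large increments \<open>f\<close> may vary by \<open>2 * B\<close>; the mass
    bound makes this at most \<open>e / 2\<close>, also when \<open>B = 0\<close>.\<close>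
  have "eventually (\<lambda>h. dist (measure (\<mu> h) {y. norm y > r / 2}) 0 < e / (4 * B + 4)) (at_right 0)"
    using mu_small[of "r / 2"] r e B by (intro tendstoD) auto
  then obtain d where d: "d > 0" "\<And>h. \<lbrakk>0 < h; h < d\<rbrakk> \<Longrightarrow> measure (\<mu> h) {y. norm y > r / 2} < e / (4 * B + 4)"
    unfolding eventually_at_right_field by auto
  show thesis
  proof (rule that[OF d(1)])
    fix h x assume h: "0 \<le> h" "h < d"
    show "\<bar>P h f x - f x\<bar> \<le> e"
    proof (cases "h = 0")
      case True
      then show ?thesis using e by (simp add: P_0 f)
    next
      case False
      interpret prob_space "\<mu> h" using mu_prob h by simp
      note [measurable_cong] = mu_sets[OF h(1)]
      let ?A = "{y. norm y > r / 2}"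
      have [measurable]: "?A \<in> sets borel" by measurable
      then have A: "?A \<in> events" by (simp add: mu_sets[OF h(1)])
      have iA: "integrable (\<mu> h) (indicat_real ?A)" "(\<integral>y. indicat_real ?A y \<partial>\<mu> h) = prob ?A"
        using A by (simp_all add: emeasure_eq_measure)
      have bnd: "\<bar>f (x + y) - f x\<bar> \<le> e / 2 + 2 * B * indicat_real ?A y" for y
      proof (cases "y \<in> ?A")
        case True
        then show ?thesis using B(2)[of "x + y"] B(2)[of x] e by (simp add: abs_le_iff)
      next
        case False
        then show ?thesis using r(2)[of "x + y" x] r(1) by auto
      qed
      have "P h f x - f x = (\<integral>y. f (x + y) - f x \<partial>\<mu> h)"
        using mu_integrable[OF h(1) f] by (simp add: feller_op_def prob_space)
      also have "\<bar>\<dots>\<bar> \<le> (\<integral>y. \<bar>f (x + y) - f x\<bar> \<partial>\<mu> h)" by (rule integral_abs_bound)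
      also have "\<dots> \<le> (\<integral>y. e / 2 + 2 * B * indicat_real ?A y \<partial>\<mu> h)"
        using bnd mu_integrable[OF h(1) f] iA by (intro integral_mono) auto
      also have "\<dots> = e / 2 + 2 * B * prob ?A" using iA by (simp add: prob_space)
      also have "\<dots> \<le> e / 2 + 2 * B * (e / (4 * B + 4))"
        using d(2)[of h] h False B by (intro add_left_mono mult_left_mono) auto
      also have "\<dots> \<le> e" using B e by (simp add: field_simps)
      finally show ?thesis .
    qed
  qed
qed

text \<open>\<open>S h f\<close> lies between \<open>P h f\<close> and
  \<open>P h f + e / 3 + L * (\<delta> * h)\<close>; the second entry of \<open>d'\<close> makes the
  last term at most \<open>e / 3\<close>, and \<open>P h f\<close> is within \<open>e / 3\<close> of
  \<open>f\<close>.\<close>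

lemma S_small:
  assumes f: "f \<in> C0" and e: "e > 0"
  obtains d where "d > 0" "\<And>h x. \<lbrakk>0 \<le> h; h < d\<rbrakk> \<Longrightarrow> \<bar>P h f x - f x\<bar> \<le> e"
    "\<And>h x. \<lbrakk>0 \<le> h; h < d\<rbrakk> \<Longrightarrow> \<bar>S h f x - f x\<bar> \<le> e"
proof -
  obtain d where d: "d > 0" "\<And>h x. \<lbrakk>0 \<le> h; h < d\<rbrakk> \<Longrightarrow> \<bar>P h f x - f x\<bar> \<le> e / 3"
    using P_small[OF f, of "e / 3"] e by auto
  obtain L where L: "L \<ge> 0" "\<And>a b. \<bar>f a - f b\<bar> \<le> e / 3 + L * norm (a - b)"
    using C0_almost_Lipschitz[OF f, of "e / 3"] e by auto
  define d' where "d' = min d (e / (3 * (L * \<delta> + 1)))"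
  have L\<delta>: "L * \<delta> \<ge> 0" using L \<delta> by simp
  show thesis
  proof (rule that[of d'])
    show "d' > 0" using d e L\<delta> by (simp add: d'_def)
    show "\<bar>P h f x - f x\<bar> \<le> e" if "0 \<le> h" "h < d'" for h x
      using d(2)[of h x] that e by (simp add: d'_def)
    show "\<bar>S h f x - f x\<bar> \<le> e" if h: "0 \<le> h" "h < d'" for h x
    proof -
      have "L * (\<delta> * h) \<le> (L * \<delta>) * (e / (3 * (L * \<delta> + 1)))"
        using h L\<delta> by (simp only: mult.assoc[symmetric]) (intro mult_left_mono, auto simp: d'_def)
      also have "\<dots> \<le> e / 3" using e L\<delta> by (simp add: field_simps)
      finally have "S h f x \<le> P h f x + 2 * e / 3"
        using S_small_of_P[OF h(1) f L, of x] by simp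
      moreover have "P h f x \<le> S h f x" using P_le_S[OF h(1) f] .
      moreover have "\<bar>P h f x - f x\<bar> \<le> e / 3" using d(2)[of h x] h by (simp add: d'_def)
      ultimately show ?thesis using e by linarith
    qed
  qed
qed

lemma P_semigroup:
  assumes s: "s \<ge> 0" and t: "t \<ge> 0" and f: "f \<in> C0"
  shows "P s (P t f) x = P (s + t) f x"
proof -
  obtain B where B: "\<And>x. \<bar>f x\<bar> \<le> B" using C0_bounded[OF f] by blast
  note [measurable] = C0_measurable[OF f]
  have st: "s + t \<ge> 0" using s t by simp
  interpret t: prob_space "\<mu> t" using mu_prob[OF t] .
  have cong: "borel_measurable (\<mu> (s + t)) = borel_measurable (borel :: 'a measure)"
     "borel_measurable (\<mu> s) = borel_measurable (borel :: 'a measure)"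
    using mu_sets[OF st] mu_sets[OF s] by (auto intro!: measurable_cong_sets)
  have tcong: "T \<in> \<mu> t \<rightarrow>\<^sub>M \<mu> (s + t) \<longleftrightarrow> T \<in> borel_measurable borel" for T :: "'a \<Rightarrow> 'a"
    using measurable_cong_sets[OF mu_sets[OF t] mu_sets[OF st]] by simp
  have "(\<integral>y. f (x + y) \<partial>\<mu> (s + t)) = (\<integral>y. \<integral>w. f (x + (y + w)) \<partial>\<mu> t \<partial>\<mu> s)"
  proof (rule integral_mixture(1)[where B = B])
    show "(\<lambda>y. f (x + y)) \<in> borel_measurable (\<mu> (s + t))" unfolding cong by measurable
    fix h :: "'a \<Rightarrow> ennreal" assume "h \<in> borel_measurable (\<mu> (s + t))"
    then have [measurable]: "h \<in> borel_measurable borel" unfolding cong .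
    show "(\<integral>\<^sup>+y. h y \<partial>\<mu> (s + t)) = (\<integral>\<^sup>+x. \<integral>\<^sup>+y. h (x + y) \<partial>\<mu> t \<partial>\<mu> s)"
      by (rule mu_add[OF s t]) measurable
    have "(\<lambda>x. \<integral>\<^sup>+y. h (x + y) \<partial>\<mu> t) \<in> borel_measurable borel"
      by (rule t.borel_measurable_nn_integral) (use mu_sets[OF t] in measurable)
    then show "(\<lambda>x. \<integral>\<^sup>+y. h (x + y) \<partial>\<mu> t) \<in> borel_measurable (\<mu> s)" unfolding cong .
  qed (use mu_prob s t st B in \<open>auto simp: tcong\<close>)
  then show ?thesis by (simp add: feller_op_def add.assoc)
qed

end

section \<open>Composition and first-order expansion\<close>

text \<open>Existence behind the definite description in \<open>gradient\<close>: the Riesz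
  representative of the derivative, assembled from its values on the basis.\<close>

lemma C1_0_gderiv:
  fixes g :: "'a::euclidean_space \<Rightarrow> real"
  assumes "g \<in> C1_0"
  shows "GDERIV g x :> gradient g x"
proof -
  obtain D where D: "(g has_derivative D) (at x)"
    using assms by (auto simp: C1_0_def differentiable_def)
  interpret D: linear D using has_derivative_linear[OF D] .
  have "D v = v \<bullet> (\<Sum>b\<in>Basis. D b *\<^sub>R b)" for v
  proof -
    have "D v = D (\<Sum>b\<in>Basis. (v \<bullet> b) *\<^sub>R b)" by (simp add: euclidean_representation)
    also have "\<dots> = (\<Sum>b\<in>Basis. (v \<bullet> b) * D b)" by (simp add: D.sum D.scale)
    finally show ?thesis by (simp add: inner_sum_right mult.commute)
  qed
  then have "GDERIV g x :> (\<Sum>b\<in>Basis. D b *\<^sub>R b)"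
    using D unfolding gderiv_def by (metis (no_types, lifting) ext)
  then show ?thesis using gradient_eq by metis
qed

lemma C1_0_mean_value:
  fixes g :: "'a::euclidean_space \<Rightarrow> real"
  assumes g: "g \<in> C1_0" and C: "convex C" "\<And>z. z \<in> C \<Longrightarrow> norm (gradient g z) \<le> K"
    and ab: "a \<in> C" "b \<in> C"
  shows "\<bar>g a - g b\<bar> \<le> K * norm (a - b)"
proof -
  have "norm (g a - g b) \<le> K * norm (a - b)"
  proof (rule differentiable_bound[OF C(1) _ _ ab])
    fix z assume z: "z \<in> C"
    show "(g has_derivative (\<lambda>h. h \<bullet> gradient g z)) (at z within C)"
      using C1_0_gderiv[OF g, of z] unfolding gderiv_def by (rule has_derivative_at_withinI)
    show "onorm (\<lambda>h. h \<bullet> gradient g z) \<le> K"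
    proof (rule onorm_le)
      fix h :: 'a
      have "\<bar>h \<bullet> gradient g z\<bar> \<le> norm h * norm (gradient g z)" by (rule Cauchy_Schwarz_ineq2)
      also have "\<dots> \<le> norm h * K" using C(2)[OF z] by (rule mult_left_mono) simp
      finally show "norm (h \<bullet> gradient g z) \<le> K * norm h" by (simp add: mult.commute)
    qed
  qed
  then show ?thesis by simp
qed

lemma C1_0_gradient_bounded:
  fixes g :: "'a::euclidean_space \<Rightarrow> real"
  assumes g: "g \<in> C1_0"
  obtains G where "G \<ge> 0" "\<And>x. norm (gradient g x) \<le> G"
proof -
  have "continuous_on UNIV (gradient g)" "(gradient g \<longlongrightarrow> 0) at_infinity"
    using g by (auto simp: C1_0_def)
  then have "(\<lambda>x. norm (gradient g x)) \<in> C0"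
    unfolding C0_def by (auto intro!: continuous_intros tendsto_norm_zero)
  then obtain G where "G \<ge> 0" "\<And>x. \<bar>norm (gradient g x)\<bar> \<le> G" using C0_bounded by blast
  then show thesis using that by simp
qed

text \<open>As the exponent \<open>1 - p\<close> is negative, \<open>z powr (1 - p)\<close> is
  largest at the threshold \<open>K\<close>. This is how p > 1 makes long displacements
  negligible.\<close>

lemma le_powr_truncate:
  fixes z K p :: real
  assumes "p > 1" "K > 0" "z \<ge> K"
  shows "z \<le> K powr (1 - p) * z powr p"
proof -
  have "z = z powr (1 - p) * z powr p" using assms by (simp flip: powr_add)
  also have "\<dots> \<le> K powr (1 - p) * z powr p"
    using assms by (intro mult_right_mono powr_mono2') auto
  finally show ?thesis .
qed

context wasserstein_perturbation
begin

text \<open>Draw a pair from a coupling of the first stage, then a pair from the coupling of the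
  second stage whose index is read off the first, and add them. The displacements add, and the
  weighted convexity inequality makes the p-th root costs add as well.\<close>

lemma ambiguity_glue:
  assumes s: "s \<ge> 0" and t: "t \<ge> 0" and \<nu>: "\<nu> \<in> ambiguity s"
    and K: "\<And>i::nat. K i \<in> ambiguity t" and A: "A \<in> borel \<rightarrow>\<^sub>M count_space UNIV"
  shows "\<nu> \<bind> (\<lambda>y. distr (K (A y)) borel (\<lambda>w. y + w)) \<in> ambiguity (s + t)" (is "?N \<in> _")
proof -
  note sets_\<nu> = ambiguity_sets[OF \<nu>] and sets_K = ambiguity_sets[OF K]
  have A\<nu> [measurable]: "A \<in> \<nu> \<rightarrow>\<^sub>M count_space UNIV"
    using A by (simp add: measurable_cong_sets[OF sets_\<nu> refl])
  have "(\<lambda>(y, w). y + w) \<in> \<nu> \<Otimes>\<^sub>M borel \<rightarrow>\<^sub>M borel"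
    using sets_\<nu>[measurable_cong] by measurable
  note N = countable_mixture[where K = K, OF ambiguity_prob[OF \<nu>] A\<nu> ambiguity_prob[OF K] sets_K this]
  have \<delta>s: "\<delta> * s \<ge> 0" and \<delta>t: "\<delta> * t \<ge> 0" using \<delta> s t by auto
  have st: "s + t \<ge> 0" using s t by simp
  \<comment> \<open>Couplings are nearly optimal only, hence the slack \<open>e\<close>, shared
    equally by the two stages and removed at the end.\<close>
  have main: "?N \<in> wasserstein_space p \<and> wasserstein p (\<mu> (s + t)) ?N \<le> \<delta> * (s + t) + e"
    if e: "e > 0" for e
  proof -
    define c1 where "c1 = \<delta> * s + e / 2"
    define c2 where "c2 = \<delta> * t + e / 2"
    have c: "\<delta> * s < c1" "\<delta> * t < c2" "c1 > 0" "c2 > 0" "c1 + c2 = \<delta> * (s + t) + e"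
      using e \<delta>s \<delta>t by (auto simp: c1_def c2_def field_simps)
    obtain \<gamma> where \<gamma>: "\<gamma> \<in> couplings (\<mu> s) \<nu>" "transport_cost p \<gamma> \<le> ennreal (c1 powr p)"
      "prob_space \<gamma>" "sets \<gamma> = sets borel"
      using ambiguity_coupling[OF s \<nu> c(1)] .
    have "\<exists>\<kappa>. \<kappa> \<in> couplings (\<mu> t) (K i) \<and> transport_cost p \<kappa> \<le> ennreal (c2 powr p) \<and>
      prob_space \<kappa> \<and> sets \<kappa> = sets borel" for i
      using ambiguity_coupling[OF t K c(2)] by blast
    then obtain \<kappa> where \<kappa>: "\<And>i. \<kappa> i \<in> couplings (\<mu> t) (K i)"
      "\<And>i. transport_cost p (\<kappa> i) \<le> ennreal (c2 powr p)"
      "\<And>i. prob_space (\<kappa> i)" "\<And>i. sets (\<kappa> i) = sets borel" by metis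
    have s\<gamma>: "sets \<gamma> = sets ((borel :: 'a measure) \<Otimes>\<^sub>M (borel :: 'a measure))"
      and s\<kappa>: "sets (\<kappa> i) = sets ((borel :: 'a measure) \<Otimes>\<^sub>M (borel :: 'a measure))" for i
      using \<gamma>(4) \<kappa>(4) unfolding borel_prod by auto
    note [measurable_cong] = s\<gamma> s\<kappa>
    have d\<gamma>: "distr \<gamma> borel fst = \<mu> s" "distr \<gamma> borel snd = \<nu>"
      and d\<kappa>: "distr (\<kappa> i) borel fst = \<mu> t" "distr (\<kappa> i) borel snd = K i" for i
      using \<gamma>(1) \<kappa>(1) by (auto simp: couplings_def)
    have [measurable]: "A \<in> borel \<rightarrow>\<^sub>M count_space UNIV" by fact
    have A\<gamma>: "(\<lambda>z. A (snd z)) \<in> \<gamma> \<rightarrow>\<^sub>M count_space UNIV" by measurable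
    have plus: "(\<lambda>(z, w). (fst z + fst w, snd z + snd w)) \<in>
        \<gamma> \<Otimes>\<^sub>M (borel \<Otimes>\<^sub>M borel) \<rightarrow>\<^sub>M (borel :: 'a measure) \<Otimes>\<^sub>M (borel :: 'a measure)"
      by measurable
    \<comment> \<open>The index depends on \<open>snd z\<close>, but every \<open>\<kappa> i\<close>
      has first marginal \<open>\<mu> t\<close>. Hence the first marginal of \<open>\<Gamma>\<close>
      is the plain convolution, and only the second one sees the choice of \<open>K\<close>.\<close>
    define \<Gamma> where "\<Gamma> = \<gamma> \<bind> (\<lambda>z. distr (\<kappa> (A (snd z))) (borel \<Otimes>\<^sub>M borel)
        (\<lambda>w. (fst z + fst w, snd z + snd w)))"
    note \<Gamma> = countable_mixture[where K = \<kappa>, OF \<gamma>(3) A\<gamma> \<kappa>(3) s\<kappa> plus, folded \<Gamma>_def]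
    note [measurable_cong] = \<Gamma>(2)
    have "distr \<Gamma> borel fst = \<mu> (s + t)"
    proof (rule measure_eqI_nn_integral)
      fix h :: "'a \<Rightarrow> ennreal" assume "h \<in> borel_measurable (\<mu> (s + t))"
      then have h [measurable]: "h \<in> borel_measurable borel"
        by (simp add: measurable_cong_sets[OF mu_sets[OF st] refl])
      interpret t: prob_space "\<mu> t" using mu_prob[OF t] .
      have [measurable]: "(\<lambda>x. \<integral>\<^sup>+y. h (x + y) \<partial>\<mu> t) \<in> borel_measurable borel"
        by (rule t.borel_measurable_nn_integral) (use mu_sets[OF t] in measurable)
      have fst_\<kappa>: "(\<integral>\<^sup>+w. h (a + fst w) \<partial>\<kappa> i) = (\<integral>\<^sup>+y. h (a + y) \<partial>\<mu> t)" for a i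
        using nn_integral_distr[of fst "\<kappa> i" borel "\<lambda>y. h (a + y)"] by (simp flip: d\<kappa>(1)[of i])
      have "(\<integral>\<^sup>+x. h x \<partial>distr \<Gamma> borel fst) = (\<integral>\<^sup>+z. h (fst z) \<partial>\<Gamma>)"
        by (rule nn_integral_distr) auto
      also have "\<dots> = (\<integral>\<^sup>+z. \<integral>\<^sup>+w. h (fst z + fst w) \<partial>\<kappa> (A (snd z)) \<partial>\<gamma>)"
        by (subst \<Gamma>(3)) auto
      also have "\<dots> = (\<integral>\<^sup>+z. \<integral>\<^sup>+y. h (fst z + y) \<partial>\<mu> t \<partial>\<gamma>)"
        by (simp add: fst_\<kappa>)
      also have "\<dots> = (\<integral>\<^sup>+x. \<integral>\<^sup>+y. h (x + y) \<partial>\<mu> t \<partial>\<mu> s)"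
        unfolding d\<gamma>(1)[symmetric] by (intro nn_integral_distr[symmetric]) auto
      also have "\<dots> = (\<integral>\<^sup>+x. h x \<partial>\<mu> (s + t))" using mu_add[OF s t h] by simp
      finally show "(\<integral>\<^sup>+x. h x \<partial>distr \<Gamma> borel fst) = (\<integral>\<^sup>+x. h x \<partial>\<mu> (s + t))" .
    qed (simp add: mu_sets[OF st])
    moreover have "distr \<Gamma> borel snd = ?N"
    proof (rule measure_eqI_nn_integral)
      fix h :: "'a \<Rightarrow> ennreal" assume "h \<in> borel_measurable ?N"
      then have h [measurable]: "h \<in> borel_measurable borel"
        by (simp add: measurable_cong_sets[OF N(2) refl])
      have "(\<lambda>(y, w). h (y + w)) \<in> borel_measurable (\<nu> \<Otimes>\<^sub>M borel)"
        using sets_\<nu>[measurable_cong] by measurable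
      note mN = N(4)[OF this]
      then have [measurable]:
        "(\<lambda>y. \<integral>\<^sup>+w. h (y + w) \<partial>K (A y)) \<in> borel_measurable borel"
        by (simp add: measurable_cong_sets[OF sets_\<nu> refl])
      have snd_\<kappa>: "(\<integral>\<^sup>+w. h (a + snd w) \<partial>\<kappa> i) = (\<integral>\<^sup>+y. h (a + y) \<partial>K i)" for a i
        using nn_integral_distr[of snd "\<kappa> i" borel "\<lambda>y. h (a + y)"] by (simp flip: d\<kappa>(2)[of i])
      have "(\<integral>\<^sup>+x. h x \<partial>distr \<Gamma> borel snd) = (\<integral>\<^sup>+z. h (snd z) \<partial>\<Gamma>)"
        by (rule nn_integral_distr) auto
      also have "\<dots> = (\<integral>\<^sup>+z. \<integral>\<^sup>+w. h (snd z + snd w) \<partial>\<kappa> (A (snd z)) \<partial>\<gamma>)"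
        by (subst \<Gamma>(3)) auto
      also have "\<dots> = (\<integral>\<^sup>+z. \<integral>\<^sup>+w. h (snd z + w) \<partial>K (A (snd z)) \<partial>\<gamma>)"
        by (simp add: snd_\<kappa>)
      also have "\<dots> = (\<integral>\<^sup>+y. \<integral>\<^sup>+w. h (y + w) \<partial>K (A y) \<partial>\<nu>)"
        using nn_integral_distr[of snd \<gamma> borel "\<lambda>y. \<integral>\<^sup>+w. h (y + w) \<partial>K (A y)"] d\<gamma>(2) mN by simp
      also have "\<dots> = (\<integral>\<^sup>+x. h x \<partial>?N)" by (rule N(3)[OF h, symmetric])
      finally show "(\<integral>\<^sup>+x. h x \<partial>distr \<Gamma> borel snd) = (\<integral>\<^sup>+x. h x \<partial>?N)" .
    qed (simp add: N(2))
    ultimately have cpl: "\<Gamma> \<in> couplings (\<mu> (s + t)) ?N"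
      using \<Gamma>(2) unfolding borel_prod by (simp add: couplings_def)
    \<comment> \<open>The weights are the two cost bounds:
      \<open>c1 powr (1 - p) * c1 powr p = c1\<close>, likewise for \<open>c2\<close>, and
      \<open>?C * (c1 + c2) = (c1 + c2) powr p\<close>.\<close>
    let ?C = "(c1 + c2) powr (p - 1)"
    have "transport_cost p \<Gamma> =
        (\<integral>\<^sup>+z. \<integral>\<^sup>+w. ennreal (norm ((snd z + snd w) - (fst z + fst w)) powr p) \<partial>\<kappa> (A (snd z)) \<partial>\<gamma>)"
      unfolding transport_cost_def by (subst \<Gamma>(3)) auto
    also have "\<dots> \<le> (\<integral>\<^sup>+z. ennreal (?C * c1 powr (1 - p)) * ennreal (norm (snd z - fst z) powr p) + ennreal (?C * c2) \<partial>\<gamma>)"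
    proof (rule nn_integral_mono)
      fix z :: "'a \<times> 'a"
      interpret \<kappa>: prob_space "\<kappa> (A (snd z))" by (rule \<kappa>)
      have "(\<integral>\<^sup>+w. ennreal (norm ((snd z + snd w) - (fst z + fst w)) powr p) \<partial>\<kappa> (A (snd z)))
        \<le> (\<integral>\<^sup>+w. ennreal (?C * c1 powr (1 - p)) * ennreal (norm (snd z - fst z) powr p)
            + ennreal (?C * c2 powr (1 - p)) * ennreal (norm (snd w - fst w) powr p) \<partial>\<kappa> (A (snd z)))"
      proof (rule nn_integral_mono)
        fix w :: "'a \<times> 'a"
        have "norm ((snd z + snd w) - (fst z + fst w)) powr p
          \<le> (norm (snd z - fst z) + norm (snd w - fst w)) powr p"
          using p norm_triangle_ineq[of "snd z - fst z" "snd w - fst w"]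
          by (intro powr_mono2) (auto simp: algebra_simps)
        also have "\<dots> \<le> ?C * (c1 powr (1 - p) * norm (snd z - fst z) powr p
            + c2 powr (1 - p) * norm (snd w - fst w) powr p)"
          using c by (intro powr_add_weighted[OF p]) auto
        finally show "ennreal (norm ((snd z + snd w) - (fst z + fst w)) powr p) \<le>
          ennreal (?C * c1 powr (1 - p)) * ennreal (norm (snd z - fst z) powr p)
            + ennreal (?C * c2 powr (1 - p)) * ennreal (norm (snd w - fst w) powr p)"
          by (simp add: ennreal_leI distrib_left mult.assoc flip: ennreal_plus ennreal_mult)
      qed
      also have "\<dots> = ennreal (?C * c1 powr (1 - p)) * ennreal (norm (snd z - fst z) powr p)
          + ennreal (?C * c2 powr (1 - p)) * transport_cost p (\<kappa> (A (snd z)))"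
        unfolding transport_cost_def
        by (subst nn_integral_add) (auto simp: nn_integral_cmult \<kappa>.emeasure_space_1)
      also have "\<dots> \<le> ennreal (?C * c1 powr (1 - p)) * ennreal (norm (snd z - fst z) powr p)
          + ennreal (?C * c2 powr (1 - p)) * ennreal (c2 powr p)"
        by (intro add_left_mono mult_left_mono \<kappa>) auto
      also have "ennreal (?C * c2 powr (1 - p)) * ennreal (c2 powr p) = ennreal (?C * c2)"
        using c by (simp add: mult.assoc flip: ennreal_mult powr_add)
      finally show "(\<integral>\<^sup>+w. ennreal (norm ((snd z + snd w) - (fst z + fst w)) powr p) \<partial>\<kappa> (A (snd z)))
        \<le> ennreal (?C * c1 powr (1 - p)) * ennreal (norm (snd z - fst z) powr p) + ennreal (?C * c2)" .
    qed
    also have "\<dots> = ennreal (?C * c1 powr (1 - p)) * transport_cost p \<gamma> + ennreal (?C * c2)"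
      unfolding transport_cost_def
      by (subst nn_integral_add) (auto simp: nn_integral_cmult prob_space.emeasure_space_1[OF \<gamma>(3)])
    also have "\<dots> \<le> ennreal (?C * c1 powr (1 - p)) * ennreal (c1 powr p) + ennreal (?C * c2)"
      by (intro add_right_mono mult_left_mono \<gamma>) auto
    also have "\<dots> = ennreal (?C * c1 + ?C * c2)"
      using c by (simp add: mult.assoc flip: ennreal_mult powr_add ennreal_plus)
    also have "?C * c1 + ?C * c2 = (c1 + c2) powr p"
    proof -
      have "z powr (p - 1) * z = z powr p" if "z > 0" for z :: real
        using that by (simp add: powr_diff)
      from this[of "c1 + c2"] show ?thesis using c(3,4) by (simp add: distrib_left)
    qed
    finally show ?thesis
      using wasserstein_leI[OF p mu_space[OF st] cpl, of "c1 + c2"] c by auto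
  qed
  have "wasserstein p (\<mu> (s + t)) ?N \<le> \<delta> * (s + t)"
    by (rule field_le_epsilon) (simp add: main)
  with main[of 1] show ?thesis unfolding ambiguity_def by simp
qed

text \<open>
  Choosing near-optimal second-stage measures on a countable partition into small cells replaces a
  measurable selection; the uniform modulus of continuity absorbs the error.
\<close>

lemma S_compose:
  assumes s: "s \<ge> 0" and t: "t \<ge> 0" and f: "f \<in> C0"
  shows "S s (S t f) x \<le> S (s + t) f x"
proof (rule S_least[OF s], rule field_le_epsilon)
  fix \<nu> and e0 :: real assume \<nu>: "\<nu> \<in> ambiguity s" and "e0 > 0"
  \<comment> \<open>Three losses: moving \<open>S t f\<close> to the centre of the cell,
    near-optimality of \<open>K i\<close> there, and moving \<open>f\<close> back.\<close>
  define e where "e = e0 / 3"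
  have e: "e > 0" using \<open>e0 > 0\<close> by (simp add: e_def)
  obtain d where d: "d > 0" "\<And>a b. norm (a - b) < d \<Longrightarrow> \<bar>f a - f b\<bar> \<le> e"
    using C0_uniform[OF f e] by blast
  obtain D :: "'a set" where D: "countable D" "\<And>X. open X \<Longrightarrow> X \<noteq> {} \<Longrightarrow> \<exists>d\<in>D. d \<in> X"
    using countable_dense_exists by blast
  define q where "q = from_nat_into D"
  have "\<exists>i. norm (y - q i) < d" for y
  proof -
    obtain z where "z \<in> D" "z \<in> ball y d" using D(2)[of "ball y d"] d by auto
    then show ?thesis using from_nat_into_surj[OF D(1)] unfolding q_def by (auto simp: dist_norm)
  qed
  \<comment> \<open>The first dense point within distance \<open>d\<close> names the cell of
    \<open>y\<close>; the cells are disjoint, and the index is measurable.\<close>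
  define A where "A = (\<lambda>y. LEAST i. norm (y - q i) < d)"
  have Aq: "norm (y - q (A y)) < d" for y
    unfolding A_def by (rule LeastI_ex) fact
  have A: "A \<in> borel \<rightarrow>\<^sub>M count_space UNIV" unfolding A_def by measurable
  have "\<exists>\<kappa>. \<kappa> \<in> ambiguity t \<and> S t f (x + q i) - e \<le> (\<integral>w. f (x + q i + w) \<partial>\<kappa>)" for i
    using S_approx[OF t e] by metis
  then obtain K where K: "\<And>i. K i \<in> ambiguity t"
    "\<And>i. S t f (x + q i) - e \<le> (\<integral>w. f (x + q i + w) \<partial>K i)" by metis
  note prob = ambiguity_prob[OF \<nu>] ambiguity_prob[OF K(1)]
  note sets = ambiguity_sets[OF \<nu>] ambiguity_sets[OF K(1)]
  have A\<nu>: "A \<in> \<nu> \<rightarrow>\<^sub>M count_space UNIV"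
    using A by (simp add: measurable_cong_sets[OF sets(1) refl])
  have plus: "(\<lambda>(y, w). y + w) \<in> \<nu> \<Otimes>\<^sub>M borel \<rightarrow>\<^sub>M borel"
    using sets(1)[measurable_cong] by measurable
  define N where "N = \<nu> \<bind> (\<lambda>y. distr (K (A y)) borel (\<lambda>w. y + w))"
  note mix = countable_mixture[where K = K, OF prob(1) A\<nu> prob(2) sets(2) plus, folded N_def]
  obtain B where B: "\<And>x. \<bar>f x\<bar> \<le> B" using C0_bounded[OF f] by blast
  note [measurable] = C0_measurable[OF f]
  have cong: "borel_measurable N = borel_measurable borel" using mix(2) by (auto intro!: measurable_cong_sets)
  have int: "(\<integral>z. f (x + z) \<partial>N) = (\<integral>y. \<integral>w. f (x + (y + w)) \<partial>K (A y) \<partial>\<nu>)"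
    "integrable \<nu> (\<lambda>y. \<integral>w. f (x + (y + w)) \<partial>K (A y))"
  proof (atomize(full), rule conjI)
    have M: "(\<lambda>z. f (x + z)) \<in> borel_measurable N" unfolding cong by measurable
    have T: "(+) y \<in> K (A y) \<rightarrow>\<^sub>M N" for y
      unfolding measurable_cong_sets[OF sets(2) mix(2)] by measurable
    have mh: "(\<lambda>y. \<integral>\<^sup>+w. h (y + w) \<partial>K (A y)) \<in> borel_measurable \<nu>" if "h \<in> borel_measurable N" for h
    proof (rule mix(4))
      have [measurable]: "h \<in> borel_measurable borel" using that unfolding cong .
      show "(\<lambda>(y, w). h (y + w)) \<in> borel_measurable (\<nu> \<Otimes>\<^sub>M borel)"
        using sets(1)[measurable_cong] by measurable
    qed
    show "(\<integral>z. f (x + z) \<partial>N) = (\<integral>y. \<integral>w. f (x + (y + w)) \<partial>K (A y) \<partial>\<nu>)"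
      by (rule integral_mixture(1)[OF mix(1) prob(1) prob(2) T _ mh M B]) (simp_all add: mix(3) cong)
    show "integrable \<nu> (\<lambda>y. \<integral>w. f (x + (y + w)) \<partial>K (A y))"
      by (rule integral_mixture(2)[OF mix(1) prob(1) prob(2) T _ mh M B]) (simp_all add: mix(3) cong)
  qed
  have "(\<integral>y. S t f (x + y) \<partial>\<nu>) \<le> (\<integral>y. \<integral>w. f (x + (y + w)) \<partial>K (A y) \<partial>\<nu>) + e0"
  proof (rule integral_prob_le[OF prob(1) ambiguity_integrable[OF \<nu> S_C0[OF t f]] int(2)])
    fix y
    have "S t f (x + y) \<le> S t f (x + q (A y)) + e"
      using S_modulus[where d = d, OF t f d(2), of "x + y" "x + q (A y)"] Aq[of y] by (simp add: abs_le_iff)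
    also have "S t f (x + q (A y)) \<le> (\<integral>w. f (x + q (A y) + w) \<partial>K (A y)) + e"
      using K(2)[of "A y"] by simp
    also have "(\<integral>w. f (x + q (A y) + w) \<partial>K (A y)) \<le> (\<integral>w. f (x + y + w) \<partial>K (A y)) + e"
    proof (rule integral_prob_le[OF prob(2) ambiguity_integrable[OF K(1) f] ambiguity_integrable[OF K(1) f]])
      fix w
      show "f (x + q (A y) + w) \<le> f (x + y + w) + e"
        using d(2)[of "x + y + w" "x + q (A y) + w"] Aq[of y] by (simp add: abs_le_iff)
    qed
    finally show "S t f (x + y) \<le> (\<integral>w. f (x + (y + w)) \<partial>K (A y)) + e0"
      by (simp add: e_def add.assoc)
  qed
  also have "(\<integral>y. \<integral>w. f (x + (y + w)) \<partial>K (A y) \<partial>\<nu>) \<le> S (s + t) f x"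
    unfolding int(1)[symmetric] N_def by (rule S_upper[OF f ambiguity_glue[OF s t \<nu> K(1) A]])
  finally show "(\<integral>y. S t f (x + y) \<partial>\<nu>) \<le> S (s + t) f x + e0" by simp
qed

text \<open>Separates the spatial part of a test function from its time-derivative part in the
  subsolution argument.\<close>

lemma S_subadditive:
  assumes t: "t \<ge> 0" and f: "f \<in> C0" and g: "g \<in> C0" and c: "c \<ge> 0"
  shows "S t (\<lambda>x. f x + c * g x) x \<le> S t f x + c * S t g x"
proof (rule S_least[OF t])
  fix \<nu> assume \<nu>: "\<nu> \<in> ambiguity t"
  have "(\<integral>y. f (x + y) + c * g (x + y) \<partial>\<nu>) = (\<integral>y. f (x + y) \<partial>\<nu>) + c * (\<integral>y. g (x + y) \<partial>\<nu>)"
    using ambiguity_integrable[OF \<nu> f] ambiguity_integrable[OF \<nu> g] by simp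
  also have "\<dots> \<le> S t f x + c * S t g x"
    by (intro add_mono mult_left_mono S_upper[OF _ \<nu>] f g c)
  finally show "(\<integral>y. f (x + y) + c * g (x + y) \<partial>\<nu>) \<le> S t f x + c * S t g x" .
qed

lemma shift_le_S:
  assumes t: "t \<ge> 0" and f: "f \<in> C0" and a: "norm a \<le> \<delta>"
  shows "P t f (x + t *\<^sub>R a) \<le> S t f x"
proof -
  note [measurable] = C0_measurable[OF f] and [measurable_cong] = mu_sets[OF t]
  have "P t f (x + t *\<^sub>R a) = (\<integral>y. f (x + y) \<partial>distr (\<mu> t) borel (\<lambda>y. y + t *\<^sub>R a))"
    by (subst integral_distr) (auto simp: feller_op_def algebra_simps)
  also have "\<dots> \<le> S t f x" by (rule S_upper[OF f ambiguity_shift[OF t a]])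
  finally show ?thesis .
qed

section \<open>First-order expansions at a point\<close>

text \<open>Unfolds the norm limit of the difference quotients into an estimate uniform in the base
  point. Continuity comes for free, because the limit is an element of the space of bounded
  continuous functions.\<close>

lemma generator_uniform:
  assumes g: "g \<in> generator_dom \<mu>"
  shows "e > 0 \<Longrightarrow> eventually (\<lambda>h. \<forall>x. \<bar>P h g x - g x - h * generator \<mu> g x\<bar> \<le> e * h) (at_right 0)"
    and "isCont (generator \<mu> g) x"
proof -
  obtain G where gC: "g \<in> C0" and G: "(generator_quotient \<mu> g \<longlongrightarrow> G) (at_right 0)"
    using g by (auto simp: generator_dom_def)
  have gen: "generator \<mu> g = apply_bcontfun G"
    unfolding generator_def using tendsto_Lim[OF _ G] by simp
  show "isCont (generator \<mu> g) x"
    unfolding gen using continuous_on_apply_bcontfun[of UNIV G] by (simp add: continuous_on_eq_continuous_at del: continuous_on_apply_bcontfun)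
  have "eventually (\<lambda>h::real. h > 0) (at_right 0)" by (simp add: eventually_at_right_less)
  moreover assume "e > 0"
  note uniform_limitD[OF tendsto_bcontfun_uniform_limit[OF G] this]
  ultimately show "eventually (\<lambda>h. \<forall>x. \<bar>P h g x - g x - h * generator \<mu> g x\<bar> \<le> e * h) (at_right 0)"
  proof eventually_elim
    case (elim h)
    show ?case
    proof
      fix x
      have "P h g \<in> bcontfun" "g \<in> bcontfun"
        using P_C0[of h g] elim gC C0_subset_bcontfun by auto
      then have "apply_bcontfun (generator_quotient \<mu> g h) x = (P h g x - g x) / h"
        by (simp add: generator_quotient_def Bcontfun_inverse scaleR_bcontfun.rep_eq minus_bcontfun.rep_eq
            divide_inverse mult.commute)
      moreover have "dist (generator_quotient \<mu> g h x) (G x) < e" using elim by simp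
      ultimately have lt: "\<bar>(P h g x - g x) / h - generator \<mu> g x\<bar> < e"
        by (simp add: gen dist_real_def)
      have eq: "P h g x - g x - h * generator \<mu> g x = h * ((P h g x - g x) / h - generator \<mu> g x)"
        using elim by (simp add: field_simps)
      from lt have "h * \<bar>(P h g x - g x) / h - generator \<mu> g x\<bar> \<le> h * e"
        using elim by (intro mult_left_mono) auto
      then show "\<bar>P h g x - g x - h * generator \<mu> g x\<bar> \<le> e * h"
        using elim by (subst eq) (simp add: abs_mult mult.commute)
    qed
  qed
qed

text \<open>The gain over \<open>P h g\<close> is at most mean displacement times the local gradient
  bound \<open>D\<close>, plus three errors with the common factor \<open>c\<close>. For fixed
  \<open>r\<close>, these become relatively small by taking \<open>M\<close> large first and
  \<open>h\<close>, \<open>c\<close> small afterwards.\<close>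

lemma ambiguity_gradient_bound:
  assumes g: "g \<in> C1_0"
    and G: "G \<ge> 0" "\<And>z. norm (gradient g z) \<le> G"
    and r: "r > 0" "\<And>z. norm (z - x) < 2 * r \<Longrightarrow> norm (gradient g z) \<le> D"
    and h: "h \<ge> 0" and c: "\<delta> * h < c" and M: "M > 0" and \<nu>: "\<nu> \<in> ambiguity h"
  shows "(\<integral>y. g (x + y) \<partial>\<nu>) \<le> P h g x +
    c * (D + G * (M * measure (\<mu> h) {y. norm y > r} + M powr (1 - p) + r powr (1 - p) * c powr (p - 1)))"
proof -
  have gC: "g \<in> C0" using g by (simp add: C1_0_def)
  have "\<delta> * h \<ge> 0" using \<delta> h by simp
  with c have c0: "c > 0" by simp
  have D: "D \<ge> 0" using r(2)[of x] r(1) by (simp add: order_trans[OF norm_ge_zero])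
  obtain \<gamma> where \<gamma>: "\<gamma> \<in> couplings (\<mu> h) \<nu>" "transport_cost p \<gamma> \<le> ennreal (c powr p)"
    and \<gamma>': "prob_space \<gamma>" "sets \<gamma> = sets borel"
    using ambiguity_coupling[OF h \<nu> c] .
  interpret prob_space \<gamma> by fact
  have s [measurable_cong]: "sets \<gamma> = sets ((borel :: 'a measure) \<Otimes>\<^sub>M (borel :: 'a measure))"
    using \<gamma>'(2) unfolding borel_prod .
  note cost = transport_cost_mean[OF p \<gamma>' c0 \<gamma>(2)]
  note diff = integral_coupling_diff[OF h \<gamma>(1) \<gamma>'(2) ambiguity_integrable[OF \<nu> gC, of x] mu_integrable[OF h gC]]
  let ?Z = "\<lambda>z::'a \<times> 'a. norm (snd z - fst z)"
  let ?A = "{y::'a. norm y > r}"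
  \<comment> \<open>A cut proportional to \<open>c\<close> gives
    \<open>K powr (1 - p) * c powr p = M powr (1 - p) * c\<close>, of the same order as the main
    term.\<close>
  define K where "K = M * c"
  have K: "K > 0" using M c0 by (simp add: K_def)
  have [measurable]: "?A \<in> sets borel" by measurable
  have iA: "integrable \<gamma> (\<lambda>z. indicat_real ?A (fst z))"
    by (rule integrable_const_bound[where B = 1]) (auto simp: indicator_def)
  have "distr \<gamma> borel fst = \<mu> h" using \<gamma>(1) by (simp add: couplings_def)
  then have A: "(\<integral>z. indicat_real ?A (fst z) \<partial>\<gamma>) = measure (\<mu> h) ?A"
    using integral_distr[of fst \<gamma> borel "indicat_real ?A"]
    by (simp add: sets_eq_imp_space_eq[OF mu_sets[OF h]])
  have bnd: "g (x + snd z) - g (x + fst z) \<le>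
      D * ?Z z + G * (K * indicat_real ?A (fst z) + K powr (1 - p) * ?Z z powr p + r powr (1 - p) * ?Z z powr p)" for z
  proof -
    have global: "g (x + snd z) - g (x + fst z) \<le> G * ?Z z"
      using C1_0_mean_value[OF g convex_UNIV G(2), of "x + snd z" "x + fst z"] by (simp add: abs_le_iff)
    have nn: "0 \<le> D * ?Z z" "0 \<le> K * indicat_real ?A (fst z)" "0 \<le> K powr (1 - p) * ?Z z powr p"
       "0 \<le> r powr (1 - p) * ?Z z powr p" using D K by auto
    \<comment> \<open>Only in the last case do both end points stay in the ball of radius
      \<open>2 * r\<close> around \<open>x\<close>, where the gradient is at most \<open>D\<close>.
      The first three use the global constant \<open>G\<close>, and each is charged to one of the
      three error terms.\<close>
    consider "norm (fst z) > r" "?Z z \<le> K" | "norm (fst z) > r" "?Z z \<ge> K" | "norm (fst z) \<le> r" "?Z z \<ge> r"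
      | "norm (fst z) \<le> r" "?Z z < r" by linarith
    then show ?thesis
    proof cases
      case 1
      then have "?Z z \<le> K * indicat_real ?A (fst z)" by simp
      then have "G * ?Z z \<le> G * (K * indicat_real ?A (fst z) + K powr (1 - p) * ?Z z powr p + r powr (1 - p) * ?Z z powr p)"
        using nn by (intro mult_left_mono G(1)) linarith
      then show ?thesis using global nn by linarith
    next
      case 2
      then have "?Z z \<le> K powr (1 - p) * ?Z z powr p" using le_powr_truncate[OF p K] by simp
      then have "G * ?Z z \<le> G * (K * indicat_real ?A (fst z) + K powr (1 - p) * ?Z z powr p + r powr (1 - p) * ?Z z powr p)"
        using nn by (intro mult_left_mono G(1)) linarith
      then show ?thesis using global nn by linarith
    next
      case 3
      then have "?Z z \<le> r powr (1 - p) * ?Z z powr p" using le_powr_truncate[OF p r(1)] by simp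
      then have "G * ?Z z \<le> G * (K * indicat_real ?A (fst z) + K powr (1 - p) * ?Z z powr p + r powr (1 - p) * ?Z z powr p)"
        using nn by (intro mult_left_mono G(1)) linarith
      then show ?thesis using global nn by linarith
    next
      case 4
      have "norm (snd z) < 2 * r" using 4 norm_triangle_sub[of "snd z" "fst z"] by linarith
      then have "\<bar>g (x + snd z) - g (x + fst z)\<bar> \<le> D * norm ((x + snd z) - (x + fst z))"
        using 4 r by (intro C1_0_mean_value[OF g convex_ball[of x "2 * r"]])
          (auto simp: dist_norm norm_minus_commute)
      then have "g (x + snd z) - g (x + fst z) \<le> D * ?Z z" by (simp add: abs_le_iff)
      moreover have "0 \<le> G * (K * indicat_real ?A (fst z) + K powr (1 - p) * ?Z z powr p + r powr (1 - p) * ?Z z powr p)"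
        using nn G(1) by (intro mult_nonneg_nonneg) linarith+
      ultimately show ?thesis by linarith
    qed
  qed
  have "(\<integral>z. g (x + snd z) - g (x + fst z) \<partial>\<gamma>) \<le>
      (\<integral>z. D * ?Z z + G * (K * indicat_real ?A (fst z) + K powr (1 - p) * ?Z z powr p + r powr (1 - p) * ?Z z powr p) \<partial>\<gamma>)"
    using cost(1,3) iA bnd diff(1) by (intro integral_mono) auto
  also have "\<dots> = D * (\<integral>z. ?Z z \<partial>\<gamma>) + G * (K * measure (\<mu> h) ?A
      + K powr (1 - p) * (\<integral>z. ?Z z powr p \<partial>\<gamma>) + r powr (1 - p) * (\<integral>z. ?Z z powr p \<partial>\<gamma>))"
    using cost(1,3) iA A by simp
  also have "\<dots> \<le> D * c + G * (K * measure (\<mu> h) ?A + K powr (1 - p) * c powr p + r powr (1 - p) * c powr p)"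
    using cost(2,4) D G(1) by (intro add_mono mult_left_mono order_refl) auto
  also have "K powr (1 - p) * c powr p = M powr (1 - p) * c"
    using c0 M by (simp add: K_def powr_mult mult.assoc flip: powr_add)
  also have "c powr p = c * c powr (p - 1)" using c0 by (simp add: powr_diff)
  finally show ?thesis
    using diff(2) by (simp add: feller_op_def K_def algebra_simps)
qed

text \<open>The order of choices matters: \<open>r\<close> from continuity of the gradient at
  \<open>x\<close>, then \<open>M\<close> so that \<open>G * M powr (1 - p) \<le> e\<close>, and
  only then \<open>h\<close>, which makes the probability of large increments and
  \<open>c powr (p - 1)\<close> small.\<close>

lemma S_generator_upper:
  assumes g: "g \<in> generator_dom \<mu>" "g \<in> C1_0" and e0: "e0 > 0"
  shows "eventually (\<lambda>h. S h g x \<le> g x + h * (generator \<mu> g x + \<delta> * norm (gradient g x) + e0)) (at_right 0)"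
proof -
  define N where "N = norm (gradient g x)"
  \<comment> \<open>The total error is \<open>(\<delta> + e) * (N + 4 * e) + e - \<delta> * N = e *
    (1 + 4 * \<delta> + N + 4 * e)\<close>, and \<open>e \<le> 1\<close> bounds the last summand in
    the bracket by 4.\<close>
  define e where "e = min 1 (e0 / (5 + 4 * \<delta> + N))"
  have den: "5 + 4 * \<delta> + N > 0" using \<delta> by (simp add: N_def add_pos_nonneg)
  have e: "e > 0" "e \<le> 1" "e * (5 + 4 * \<delta> + N) \<le> e0"
  proof -
    show "e > 0" "e \<le> 1" using e0 den by (auto simp: e_def)
    have "e * (5 + 4 * \<delta> + N) \<le> e0 / (5 + 4 * \<delta> + N) * (5 + 4 * \<delta> + N)"
      using den by (intro mult_right_mono) (auto simp: e_def)
    then show "e * (5 + 4 * \<delta> + N) \<le> e0" using den by simp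
  qed
  obtain G where G: "G \<ge> 0" "\<And>z. norm (gradient g z) \<le> G" using C1_0_gradient_bounded[OF g(2)] by blast
  have "continuous_on UNIV (gradient g)" using g by (simp add: C1_0_def)
  then obtain d where d: "d > 0" "\<And>z. dist z x < d \<Longrightarrow> dist (gradient g z) (gradient g x) < e"
    unfolding continuous_on_iff using e(1) by blast
  define r where "r = d / 2"
  have r: "norm (gradient g z) \<le> N + e" if "norm (z - x) < 2 * r" for z
  proof -
    have "norm (gradient g z - gradient g x) < e"
      using d(2)[of z] that by (simp add: r_def dist_norm)
    then show ?thesis using norm_triangle_sub[of "gradient g z" "gradient g x"] unfolding N_def by linarith
  qed
  have r0: "r > 0" using d by (simp add: r_def)
  define M where "M = (e / (G + 1)) powr (1 / (1 - p))"
  have M: "M > 0" using e G by (simp add: M_def)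
  have "M powr (1 - p) = e / (G + 1)" using e G p by (simp add: M_def powr_powr)
  moreover have "G * (e / (G + 1)) \<le> e" using e G by (simp add: field_simps)
  ultimately have GM: "G * M powr (1 - p) \<le> e" by simp
  have "((\<lambda>h. G * (M * measure (\<mu> h) {y. norm y > r})) \<longlongrightarrow> G * (M * 0)) (at_right 0)"
    by (intro tendsto_intros mu_small r0)
  from order_tendstoD(2)[OF this, of e] e
  have ev1: "eventually (\<lambda>h. G * (M * measure (\<mu> h) {y. norm y > r}) < e) (at_right 0)" by simp
  have pos: "eventually (\<lambda>h::real. h > 0) (at_right 0)" by (simp add: eventually_at_right_less)
  have "((\<lambda>h. ((\<delta> + e) * h) powr (p - 1)) \<longlongrightarrow> 0) (at_right 0)"
  proof (rule tendsto_zero_powrI)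
    show "((\<lambda>h. (\<delta> + e) * h) \<longlongrightarrow> 0) (at_right 0)" by (auto intro!: tendsto_eq_intros)
    show "\<forall>\<^sub>F h in at_right 0. 0 \<le> (\<delta> + e) * h" using pos by eventually_elim (use \<delta> e in auto)
  qed (use p in auto)
  then have "((\<lambda>h. G * (r powr (1 - p) * ((\<delta> + e) * h) powr (p - 1))) \<longlongrightarrow> G * (r powr (1 - p) * 0)) (at_right 0)"
    by (intro tendsto_intros)
  from order_tendstoD(2)[OF this, of e] e
  have ev2: "eventually (\<lambda>h. G * (r powr (1 - p) * ((\<delta> + e) * h) powr (p - 1)) < e) (at_right 0)" by simp
  show ?thesis
    using ev1 ev2 pos generator_uniform(1)[OF g(1) e(1)]
  proof eventually_elim
    case (elim h)
    \<comment> \<open>The summand \<open>e * h\<close> keeps \<open>?c\<close> strictly above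
      \<open>\<delta> * h\<close>, as an almost optimal coupling demands, even for
      \<open>\<delta> = 0\<close>.\<close>
    let ?c = "(\<delta> + e) * h"
    let ?R = "G * (M * measure (\<mu> h) {y. norm y > r} + M powr (1 - p) + r powr (1 - p) * ?c powr (p - 1))"
    have "?R \<le> 3 * e" using elim(1,2) GM by (simp add: distrib_left)
    then have c: "?c * (N + e + ?R) \<le> ?c * (N + 4 * e)" using \<delta> e elim by (intro mult_left_mono) auto
    have Ph: "P h g x \<le> g x + h * generator \<mu> g x + e * h"
      using elim(4) by (auto simp: abs_le_iff algebra_simps)
    have "S h g x \<le> P h g x + ?c * (N + e + ?R)"
    proof (rule S_least)
      fix \<nu> assume "\<nu> \<in> ambiguity h"
      then show "(\<integral>y. g (x + y) \<partial>\<nu>) \<le> P h g x + ?c * (N + e + ?R)"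
        using elim(3) e(1) by (intro ambiguity_gradient_bound[OF g(2) G r0 r] M) auto
    qed (use elim in auto)
    also have "\<dots> \<le> g x + h * generator \<mu> g x + e * h + ?c * (N + 4 * e)" using Ph c by linarith
    also have "\<dots> = g x + h * (generator \<mu> g x + \<delta> * N + e * (1 + 4 * \<delta> + N + 4 * e))"
      by (simp add: algebra_simps)
    also have "\<dots> \<le> g x + h * (generator \<mu> g x + \<delta> * N + e0)"
    proof -
      have "e * (1 + 4 * \<delta> + N + 4 * e) \<le> e * (5 + 4 * \<delta> + N)"
        using e by (intro mult_left_mono) auto
      then show ?thesis using e(3) elim(3) by (intro add_left_mono mult_left_mono) auto
    qed
    finally show ?case by (simp add: N_def)
  qed
qed

text \<open>The base point moves with \<open>h\<close>, so the generator expansion must hold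
  uniformly in space. Continuity of \<open>generator \<mu> g\<close> then returns to
  \<open>x\<close>, and the displacement contributes the directional derivative along
  \<open>a\<close>; each of the three steps costs \<open>e / 3\<close>.\<close>

lemma P_generator_lower:
  assumes g: "g \<in> generator_dom \<mu>" "g \<in> C1_0" and e: "e > 0"
  shows "eventually (\<lambda>h. P h g (x + h *\<^sub>R a) \<ge> g x + h * (generator \<mu> g x + a \<bullet> gradient g x - e)) (at_right 0)"
proof -
  have arith: "P1 \<ge> g0 + h * (G + b - e)"
    if "P1 \<ge> g1 + k - e / 3 * h" "k \<ge> h * (G - e / 3)" "g1 \<ge> g0 + h * b - e / 3 * h"
    for P1 g0 g1 G b k h :: real
    using that by (simp add: algebra_simps)
  have pos: "eventually (\<lambda>h::real. h > 0) (at_right 0)" by (simp add: eventually_at_right_less)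
  have "((\<lambda>h::real. x + h *\<^sub>R a) \<longlongrightarrow> x + 0 *\<^sub>R a) (at_right 0)" by (intro tendsto_intros)
  then have "((\<lambda>h. generator \<mu> g (x + h *\<^sub>R a)) \<longlongrightarrow> generator \<mu> g x) (at_right 0)"
    by (intro isCont_tendsto_compose[OF generator_uniform(2)[OF g(1)]]) simp
  from tendstoD[OF this, of "e / 3"] e
  have ev: "eventually (\<lambda>h. dist (generator \<mu> g (x + h *\<^sub>R a)) (generator \<mu> g x) < e / 3) (at_right 0)" by simp
  have "((\<lambda>h. g (x + h *\<^sub>R a)) has_derivative (\<lambda>h. (h *\<^sub>R a) \<bullet> gradient g x)) (at 0)"
  proof (rule has_derivative_compose[where f = "\<lambda>h. x + h *\<^sub>R a"])
    show "((\<lambda>h. x + h *\<^sub>R a) has_derivative (\<lambda>h. h *\<^sub>R a)) (at 0)"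
      by (auto intro!: derivative_eq_intros)
    show "(g has_derivative (\<lambda>h. h \<bullet> gradient g x)) (at (x + 0 *\<^sub>R a))"
      using C1_0_gderiv[OF g(2), of x] by (simp add: gderiv_def)
  qed
  then obtain d where d: "d > 0"
    "\<And>h. \<bar>h\<bar> < d \<Longrightarrow> \<bar>g (x + h *\<^sub>R a) - g x - h * (a \<bullet> gradient g x)\<bar> \<le> e / 3 * \<bar>h\<bar>"
  proof -
    assume der: "((\<lambda>h. g (x + h *\<^sub>R a)) has_derivative (\<lambda>h. (h *\<^sub>R a) \<bullet> gradient g x)) (at 0)"
      and *: "\<And>d. \<lbrakk>d > 0; \<And>h. \<bar>h\<bar> < d \<Longrightarrow> \<bar>g (x + h *\<^sub>R a) - g x - h * (a \<bullet> gradient g x)\<bar> \<le> e / 3 * \<bar>h\<bar>\<rbrakk> \<Longrightarrow> thesis"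
    have "e / 3 > 0" using e by simp
    with der obtain d where "d > 0" "\<And>h. norm (h - 0) < d \<Longrightarrow>
        norm (g (x + h *\<^sub>R a) - g (x + 0 *\<^sub>R a) - ((h - 0) *\<^sub>R a) \<bullet> gradient g x) \<le> e / 3 * norm (h - 0)"
      unfolding has_derivative_at_alt by blast
    then show thesis using *[of d] by simp
  qed
  have unif: "eventually (\<lambda>h. \<forall>x. \<bar>P h g x - g x - h * generator \<mu> g x\<bar> \<le> e / 3 * h) (at_right 0)"
    by (rule generator_uniform(1)[OF g(1)]) (use e in simp)
  have "eventually (\<lambda>h. h < d) (at_right 0)"
    using d(1) by (auto simp: eventually_at_right_field)
  then show ?thesis
    using pos ev unif
  proof eventually_elim
    case (elim h)
    note h = elim(1,2) and G = elim(3) and u = elim(4)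
    have "P h g (x + h *\<^sub>R a) \<ge> g (x + h *\<^sub>R a) + h * generator \<mu> g (x + h *\<^sub>R a) - e / 3 * h"
      using u[rule_format, of "x + h *\<^sub>R a"] by linarith
    moreover have "h * generator \<mu> g (x + h *\<^sub>R a) \<ge> h * (generator \<mu> g x - e / 3)"
      using G h unfolding dist_real_def by (intro mult_left_mono) linarith+
    moreover have "g (x + h *\<^sub>R a) \<ge> g x + h * (a \<bullet> gradient g x) - e / 3 * h"
      using abs_le_D2[OF d(2)[of h]] h by simp
    ultimately show ?case by (rule arith)
  qed
qed

end

section \<open>Dyadic iteration\<close>

lemma abs_diff_limit_le:
  fixes a b :: "nat \<Rightarrow> real"
  assumes "a \<longlonglongrightarrow> x" "b \<longlonglongrightarrow> y" "eventually (\<lambda>n. \<bar>a n - b n\<bar> \<le> e) sequentially"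
  shows "\<bar>x - y\<bar> \<le> e"
  by (rule tendsto_upperbound[OF tendsto_rabs[OF tendsto_diff[OF assms(1,2)]] assms(3)]) simp

context wasserstein_perturbation
begin

lemma P_mono:
  assumes "t \<ge> 0" "f \<in> C0" "g \<in> C0" "\<And>x. f x \<le> g x + c"
  shows "P t f x \<le> P t g x + c"
  unfolding feller_op_def
  using assms by (intro integral_prob_le mu_prob mu_integrable) auto

lemma S_iter_C0: "\<lbrakk>h \<ge> 0; f \<in> C0\<rbrakk> \<Longrightarrow> (S h ^^ k) f \<in> C0"
  by (induction k) (auto intro: S_C0)

lemma S_iter_mono_add:
  assumes "h \<ge> 0" "f \<in> C0" "g \<in> C0" "\<And>x. f x \<le> g x + c"
  shows "(S h ^^ k) f x \<le> (S h ^^ k) g x + c"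
proof (induction k arbitrary: x)
  case (Suc k)
  show ?case using assms Suc by (auto intro!: S_mono_add S_iter_C0)
qed (use assms in simp)

lemma S_iter_diff:
  assumes "h \<ge> 0" "f \<in> C0" "g \<in> C0" "\<And>x. \<bar>f x - g x\<bar> \<le> c"
  shows "\<bar>(S h ^^ k) f x - (S h ^^ k) g x\<bar> \<le> c"
proof -
  have "f x \<le> g x + c" "g x \<le> f x + c" for x using assms(4)[of x] by (auto simp: abs_le_iff)
  then show ?thesis
    using S_iter_mono_add[OF assms(1-3), of c k x] S_iter_mono_add[OF assms(1,3,2), of c k x]
    by (auto simp: abs_le_iff)
qed

lemma S_iter_modulus:
  assumes h: "h \<ge> 0" and f: "f \<in> C0" and d: "\<And>a b. norm (a - b) < d \<Longrightarrow> \<bar>f a - f b\<bar> \<le> e"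
    and ab: "norm (a - b) < d"
  shows "\<bar>(S h ^^ k) f a - (S h ^^ k) f b\<bar> \<le> e"
  using ab
proof (induction k arbitrary: a b)
  case (Suc k)
  show ?case using S_modulus[OF h S_iter_C0[OF h f] Suc.IH Suc.prems] by simp
qed (use d in simp)

lemma S_iter_le:
  assumes h: "h \<ge> 0" and f: "f \<in> C0"
  shows "(S h ^^ k) f x \<le> S (real k * h) f x"
proof (induction k arbitrary: x)
  case (Suc k)
  have kh: "real k * h \<ge> 0" using h by simp
  have "(S h ^^ Suc k) f x \<le> S h (S (real k * h) f) x"
    using Suc h f kh by (auto intro!: S_mono S_iter_C0 S_C0)
  also have "\<dots> \<le> S (h + real k * h) f x" by (rule S_compose[OF h kh f])
  finally show ?case by (simp add: algebra_simps)
qed (simp add: S_0 f)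

text \<open>\<open>P\<close> commutes with translations and is a semigroup, so the drifts of the
  single steps accumulate to \<open>(real k * h) *\<^sub>R a\<close>. The case \<open>a = 0\<close>
  later yields the lower bound by \<open>P\<close>.\<close>

lemma shift_le_S_iter:
  assumes h: "h \<ge> 0" and f: "f \<in> C0" and a: "norm a \<le> \<delta>"
  shows "P (real k * h) f (x + (real k * h) *\<^sub>R a) \<le> (S h ^^ k) f x"
proof (induction k arbitrary: x)
  case (Suc k)
  let ?s = "real k * h"
  have kh: "?s \<ge> 0" using h by simp
  have "P (real (Suc k) * h) f (x + (real (Suc k) * h) *\<^sub>R a) = P h (P ?s f) (x + h *\<^sub>R a + ?s *\<^sub>R a)"
  proof -
    have s: "real (Suc k) * h = h + ?s" by (simp add: distrib_right)
    show ?thesis unfolding s P_semigroup[OF h kh f] by (simp only: scaleR_add_left add.assoc)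
  qed
  also have "\<dots> = (\<integral>y. P ?s f (x + h *\<^sub>R a + y + ?s *\<^sub>R a) \<partial>\<mu> h)"
    by (simp add: feller_op_def[of _ h] algebra_simps)
  also have "\<dots> \<le> (\<integral>y. (S h ^^ k) f (x + h *\<^sub>R a + y) \<partial>\<mu> h)"
  proof (rule integral_mono)
    show "integrable (\<mu> h) (\<lambda>y. P ?s f (x + h *\<^sub>R a + y + ?s *\<^sub>R a))"
      using mu_integrable[OF h P_C0[OF kh f], of "x + h *\<^sub>R a + ?s *\<^sub>R a"] by (simp add: algebra_simps)
  qed (intro mu_integrable h S_iter_C0 f Suc)+
  also have "\<dots> = P h ((S h ^^ k) f) (x + h *\<^sub>R a)" by (simp add: feller_op_def)
  also have "\<dots> \<le> S h ((S h ^^ k) f) x" by (rule shift_le_S[OF h S_iter_C0[OF h f] a])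
  finally show ?case by simp
qed (simp add: P_0 f)

section \<open>Dyadic approximants and their limit\<close>

abbreviation "D n t f \<equiv> dyadic_op p \<delta> \<mu> n t f"
abbreviation "L t f \<equiv> limit_op p \<delta> \<mu> t f"

definition dyadic_steps :: "nat \<Rightarrow> real \<Rightarrow> nat" where
  "dyadic_steps n t = nat \<lfloor>2 ^ n * t\<rfloor>"

definition dyadic_rest :: "nat \<Rightarrow> real \<Rightarrow> real" where
  "dyadic_rest n t = t - real (dyadic_steps n t) / 2 ^ n"

lemma dyadic_op_eq: "D n t f = (S (1 / 2 ^ n) ^^ dyadic_steps n t) (S (dyadic_rest n t) f)"
  by (simp add: dyadic_op_def dyadic_rest_def dyadic_steps_def Let_def)

lemma dyadic_split: "t = real (dyadic_steps n t) * (1 / 2 ^ n) + dyadic_rest n t"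
  by (simp add: dyadic_rest_def)

lemma dyadic_rest_bounds:
  assumes "t \<ge> 0"
  shows "dyadic_rest n t \<ge> 0" "dyadic_rest n t < 1 / 2 ^ n"
proof -
  have "0 \<le> 2 ^ n * t" using assms by simp
  then have "real (dyadic_steps n t) \<le> 2 ^ n * t" "2 ^ n * t < real (dyadic_steps n t) + 1"
    unfolding dyadic_steps_def by (simp_all add: of_nat_nat)
  then have "real (dyadic_steps n t) / 2 ^ n \<le> t" "t < (real (dyadic_steps n t) + 1) / 2 ^ n"
    by (simp_all add: pos_divide_le_eq pos_less_divide_eq mult.commute)
  then show "dyadic_rest n t \<ge> 0" "dyadic_rest n t < 1 / 2 ^ n"
    by (simp_all add: dyadic_rest_def add_divide_distrib)
qed

lemma dyadic_steps_unique:
  assumes "t = real k / 2 ^ n + r" "0 \<le> r" "r < 1 / 2 ^ n"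
  shows "dyadic_steps n t = k" "dyadic_rest n t = r"
proof -
  have "\<lfloor>2 ^ n * t\<rfloor> = int k"
  proof (rule floor_unique)
    have "2 ^ n * t = real k + 2 ^ n * r" using assms(1) by (simp add: distrib_left)
    moreover have "2 ^ n * r < 1" using assms(3) by (simp add: field_simps)
    moreover have "0 \<le> 2 ^ n * r" using assms(2) by simp
    ultimately show "real_of_int (int k) \<le> 2 ^ n * t" "2 ^ n * t < real_of_int (int k) + 1" by simp_all
  qed
  then show "dyadic_steps n t = k" by (simp add: dyadic_steps_def)
  then show "dyadic_rest n t = r" using assms(1) by (simp add: dyadic_rest_def)
qed

text \<open>Subtracting a multiple of the step lowers the number of steps and leaves the remainder
  untouched. Every splitting in time rests on this exact identity.\<close>

lemma dyadic_shift:
  assumes t: "real j / 2 ^ n \<le> t"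
  shows "D n t f = (S (1 / 2 ^ n) ^^ j) (D n (t - real j / 2 ^ n) f)"
proof -
  let ?s = "t - real j / 2 ^ n"
  have s: "?s \<ge> 0" using t by simp
  have "t = real (j + dyadic_steps n ?s) / 2 ^ n + dyadic_rest n ?s"
    using dyadic_split[of ?s n] by (simp add: add_divide_distrib)
  from dyadic_steps_unique[OF this dyadic_rest_bounds[OF s]]
  show ?thesis by (simp add: dyadic_op_eq funpow_add)
qed

lemma D_C0: "\<lbrakk>t \<ge> 0; f \<in> C0\<rbrakk> \<Longrightarrow> D n t f \<in> C0"
  unfolding dyadic_op_eq by (intro S_iter_C0 S_C0 dyadic_rest_bounds) auto

lemma D_modulus:
  assumes t: "t \<ge> 0" and f: "f \<in> C0" and "\<And>a b. norm (a - b) < d \<Longrightarrow> \<bar>f a - f b\<bar> \<le> e" "norm (a - b) < d"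
  shows "\<bar>D n t f a - D n t f b\<bar> \<le> e"
  unfolding dyadic_op_eq
  by (rule S_iter_modulus[where d = d])
     (simp, rule S_C0[OF dyadic_rest_bounds(1)[OF t] f],
      rule S_modulus[where d = d, OF dyadic_rest_bounds(1)[OF t] f assms(3)], assumption+, rule assms(4))

lemma D_le_S:
  assumes t: "t \<ge> 0" and f: "f \<in> C0"
  shows "D n t f x \<le> S t f x"
proof -
  have r: "dyadic_rest n t \<ge> 0" by (rule dyadic_rest_bounds[OF t])
  have "D n t f x \<le> S (real (dyadic_steps n t) * (1 / 2 ^ n)) (S (dyadic_rest n t) f) x"
    unfolding dyadic_op_eq by (rule S_iter_le) (use S_C0[OF r f] in auto)
  also have "\<dots> \<le> S (real (dyadic_steps n t) * (1 / 2 ^ n) + dyadic_rest n t) f x"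
    by (rule S_compose) (use r f in auto)
  finally show ?thesis unfolding dyadic_split[of t n, symmetric] .
qed

lemma P_le_D:
  assumes t: "t \<ge> 0" and f: "f \<in> C0"
  shows "P t f x \<le> D n t f x"
proof -
  let ?s = "real (dyadic_steps n t) * (1 / 2 ^ n)"
  have r: "dyadic_rest n t \<ge> 0" by (rule dyadic_rest_bounds[OF t])
  have "P ?s (P (dyadic_rest n t) f) x = P t f x"
    using P_semigroup[OF _ r f, of ?s x] unfolding dyadic_split[of t n, symmetric] by simp
  then have "P t f x = P ?s (P (dyadic_rest n t) f) x" by simp
  also have "\<dots> \<le> P ?s (S (dyadic_rest n t) f) x"
    using P_mono[of ?s "P (dyadic_rest n t) f" "S (dyadic_rest n t) f" 0 x] r f
    by (simp add: P_C0 S_C0 P_le_S)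
  also have "\<dots> \<le> D n t f x"
    using shift_le_S_iter[of "1 / 2 ^ n" "S (dyadic_rest n t) f" 0] \<delta> r f
    by (simp add: dyadic_op_eq S_C0)
  finally show ?thesis .
qed

text \<open>Each step of length \<open>2 * h\<close> is replaced by two of length \<open>h\<close>,
  which lowers the value by \<open>S_compose\<close>. The remainder \<open>r\<close> may itself
  contain one more step \<open>h\<close>, which is then split off in the same way.\<close>

lemma D_Suc_le:
  assumes t: "t \<ge> 0" and f: "f \<in> C0"
  shows "D (Suc n) t f x \<le> D n t f x"
proof -
  define h :: real where "h = 1 / 2 ^ Suc n"
  define k where "k = dyadic_steps n t"
  define r where "r = dyadic_rest n t"
  have h: "h > 0" "1 / 2 ^ n = h + h" "real (2 * k) / 2 ^ Suc n = real k / 2 ^ n" by (auto simp: h_def)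
  have r: "0 \<le> r" "r < h + h" using dyadic_rest_bounds[OF t, of n] h(2) by (simp_all add: r_def)
  have t_eq: "t = real (2 * k) / 2 ^ Suc n + r"
    unfolding h(3) using dyadic_split[of t n] by (simp add: k_def r_def)
  have two: "(S h ^^ (2 * k)) g x \<le> (S (1 / 2 ^ n) ^^ k) g x" if g: "g \<in> C0" for g x
  proof (induction k arbitrary: x)
    case (Suc k)
    have "(S h ^^ (2 * Suc k)) g x = S h (S h ((S h ^^ (2 * k)) g)) x" by simp
    also have "\<dots> \<le> S h (S h ((S (1 / 2 ^ n) ^^ k) g)) x"
      using h(1) g Suc by (intro S_mono S_C0 S_iter_C0) auto
    also have "\<dots> \<le> S (h + h) ((S (1 / 2 ^ n) ^^ k) g) x"
      using h(1) g by (intro S_compose S_iter_C0) auto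
    finally show ?case by (simp add: h(2))
  qed simp
  \<comment> \<open>\<open>g\<close> is the innermost function once a possible odd step is moved
    next to the remainder: \<open>S r f\<close>, or \<open>S h (S (r - h) f)\<close> if
    \<open>r \<ge> h\<close>. An even number of outer steps is left, to be paired.\<close>
  have "\<exists>g. g \<in> C0 \<and> (\<forall>x. g x \<le> S r f x) \<and> D (Suc n) t f = (S h ^^ (2 * k)) g"
  proof (cases "r < h")
    case True
    with dyadic_steps_unique[OF t_eq r(1)] S_C0[OF r(1) f]
    show ?thesis by (intro exI[of _ "S r f"]) (auto simp: dyadic_op_eq h_def)
  next
    case False
    have "t = real (2 * k + 1) / 2 ^ Suc n + (r - h)"
      using t_eq by (simp add: h_def add_divide_distrib)
    from dyadic_steps_unique[OF this] False r
    have "D (Suc n) t f = (S h ^^ (2 * k + 1)) (S (r - h) f)" by (simp add: dyadic_op_eq h_def)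
    moreover have "S h (S (r - h) f) x \<le> S r f x" for x
      using S_compose[of h "r - h" f x] False h(1) f by simp
    ultimately show ?thesis
      using False h(1) f S_C0[of h "S (r - h) f"] S_C0[of "r - h" f]
      by (intro exI[of _ "S h (S (r - h) f)"]) (simp add: funpow_swap1)
  qed
  then obtain g where g: "g \<in> C0" "\<And>x. g x \<le> S r f x" "D (Suc n) t f = (S h ^^ (2 * k)) g" by blast
  have "D (Suc n) t f x \<le> (S (1 / 2 ^ n) ^^ k) g x" unfolding g(3) by (rule two[OF g(1)])
  also have "\<dots> \<le> (S (1 / 2 ^ n) ^^ k) (S r f) x"
    using S_iter_mono_add[of "1 / 2 ^ n" g "S r f" 0 k x] g S_C0[OF r(1) f] by simp
  also have "\<dots> = D n t f x" by (simp add: dyadic_op_eq k_def r_def)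
  finally show ?thesis .
qed

text \<open>Monotone and bounded below by \<open>P t f\<close>; hence the \<open>lim\<close> in
  \<open>limit_op\<close> is a genuine limit.\<close>

lemma D_tendsto:
  assumes t: "t \<ge> 0" and f: "f \<in> C0"
  shows "(\<lambda>n. D n t f x) \<longlonglongrightarrow> L t f x" "L t f x \<le> D n t f x"
proof -
  have dec: "decseq (\<lambda>n. D n t f x)" by (rule decseq_SucI) (rule D_Suc_le[OF t f])
  have "convergent (\<lambda>n. D n t f x)"
    by (rule decseq_convergent[OF dec]) (use P_le_D[OF t f] in \<open>auto simp: convergent_def\<close>)
  then show lim: "(\<lambda>n. D n t f x) \<longlonglongrightarrow> L t f x"
    unfolding limit_op_def by (simp add: convergent_LIMSEQ_iff)
  show "L t f x \<le> D n t f x" by (rule decseq_ge[OF dec lim])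
qed

lemma L_bounds:
  assumes t: "t \<ge> 0" and f: "f \<in> C0"
  shows "P t f x \<le> L t f x" "L t f x \<le> S t f x"
proof -
  show "P t f x \<le> L t f x"
    by (rule LIMSEQ_le_const[OF D_tendsto(1)[OF t f]]) (simp add: P_le_D[OF t f])
  show "L t f x \<le> S t f x"
    by (rule order_trans[OF D_tendsto(2)[OF t f] D_le_S[OF t f]])
qed

lemma L_0: "f \<in> C0 \<Longrightarrow> L 0 f = f"
  using L_bounds[of 0 f] by (intro ext antisym) (simp_all add: P_0 S_0)

lemma L_modulus:
  assumes t: "t \<ge> 0" and f: "f \<in> C0" and "\<And>a b. norm (a - b) < d \<Longrightarrow> \<bar>f a - f b\<bar> \<le> e" "norm (a - b) < d"
  shows "\<bar>L t f a - L t f b\<bar> \<le> e"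
  by (rule abs_diff_limit_le[OF D_tendsto(1)[OF t f] D_tendsto(1)[OF t f]])
     (rule always_eventually, rule allI, rule D_modulus[where d = d, OF t f assms(3,4)])

lemma L_C0:
  assumes t: "t \<ge> 0" and f: "f \<in> C0"
  shows "L t f \<in> C0"
proof -
  have "continuous_on UNIV (L t f)"
    unfolding continuous_on_iff
  proof clarsimp
    fix x :: 'a and e :: real assume e: "e > 0"
    obtain d where d: "d > 0" "\<And>a b. norm (a - b) < d \<Longrightarrow> \<bar>f a - f b\<bar> \<le> e / 2"
      using C0_uniform[OF f, of "e / 2"] e by auto
    show "\<exists>d>0. \<forall>x'. dist x' x < d \<longrightarrow> dist (L t f x') (L t f x) < e"
      using L_modulus[OF t f d(2)] d(1) e by (intro exI[of _ d]) (fastforce simp: dist_norm)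
  qed
  moreover have "(L t f \<longlongrightarrow> 0) at_infinity"
    by (rule tendsto_sandwich[of "P t f" _ _ "S t f"])
       (use L_bounds[OF t f] P_C0[OF t f] S_C0[OF t f] in \<open>auto simp: C0_def\<close>)
  ultimately show ?thesis by (simp add: C0_def)
qed

text \<open>On a large ball, a finite net suffices because all approximants and the limit share one
  modulus. Outside, \<open>D n t f\<close> and \<open>L t f\<close> are squeezed between
  \<open>P t f\<close> and \<open>S t f\<close>, both small.\<close>

lemma D_uniform:
  assumes t: "t \<ge> 0" and f: "f \<in> C0" and e: "e > 0"
  shows "eventually (\<lambda>n. \<forall>x. D n t f x \<le> L t f x + e) sequentially"
proof -
  obtain d where d: "d > 0" "\<And>a b. norm (a - b) < d \<Longrightarrow> \<bar>f a - f b\<bar> \<le> e / 3"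
    using C0_uniform[OF f, of "e / 3"] e by auto
  obtain R1 where R1: "\<And>x. norm x \<ge> R1 \<Longrightarrow> \<bar>S t f x\<bar> < e / 2"
    using C0_small_outside[OF S_C0[OF t f], of "e / 2"] e by auto
  obtain R2 where R2: "\<And>x. norm x \<ge> R2 \<Longrightarrow> \<bar>P t f x\<bar> < e / 2"
    using C0_small_outside[OF P_C0[OF t f], of "e / 2"] e by auto
  obtain F where F: "finite F" "cball (0::'a) (max R1 R2) \<subseteq> (\<Union>c\<in>F. ball c d)"
    using conjunct2[OF iffD1[OF compact_eq_totally_bounded compact_cball[of "0::'a" "max R1 R2"]],
      rule_format, OF d(1)] by (auto intro: that)
  have "eventually (\<lambda>n. \<forall>c\<in>F. D n t f c < L t f c + e / 3) sequentially"
    using F(1) e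
    by (intro eventually_ball_finite ballI order_tendstoD(2)[OF D_tendsto(1)[OF t f]]) auto
  then show ?thesis
  proof (eventually_elim, intro allI)
    fix n x assume n: "\<forall>c\<in>F. D n t f c < L t f c + e / 3"
    show "D n t f x \<le> L t f x + e"
    proof (cases "norm x \<le> max R1 R2")
      case True
      then obtain c where c: "c \<in> F" "norm (c - x) < d" using F(2) by (auto simp: dist_norm)
      then have "\<bar>D n t f c - D n t f x\<bar> \<le> e / 3" "\<bar>L t f c - L t f x\<bar> \<le> e / 3"
        using D_modulus[where d = d, OF t f d(2)] L_modulus[where d = d, OF t f d(2)] by auto
      then show ?thesis using bspec[OF n c(1)] by linarith
    next
      case False
      then have "\<bar>S t f x\<bar> < e / 2" "\<bar>P t f x\<bar> < e / 2" using R1[of x] R2[of x] by auto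
      then show ?thesis using L_bounds(1)[OF t f, of x] D_le_S[OF t f, of n x] by linarith
    qed
  qed
qed

section \<open>One-sided dynamic programming and continuity in time\<close>

lemma dyadic_refine:
  fixes m n :: nat
  assumes "m \<le> n"
  shows "real (2 ^ (n - m)) * (1 / 2 ^ n) = 1 / 2 ^ m" "real (2 ^ (n - m)) / 2 ^ n = 1 / 2 ^ m"
proof -
  have "(2::real) ^ n = 2 ^ m * 2 ^ (n - m)" using assms by (simp flip: power_add)
  then show "real (2 ^ (n - m)) * (1 / 2 ^ n) = 1 / 2 ^ m" "real (2 ^ (n - m)) / 2 ^ n = 1 / 2 ^ m"
    by simp_all
qed

text \<open>In \<open>D n t f\<close> the outermost \<open>2 ^ (n - m)\<close> fine steps collapse
  into a single \<open>S\<close> of length \<open>1 / 2 ^ m\<close>. Uniform convergence then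
  replaces \<open>D n\<close> by \<open>L\<close> inside \<open>S\<close> at the price of
  \<open>e\<close>.\<close>

lemma L_le_S_L:
  assumes t: "1 / 2 ^ m \<le> t" and f: "f \<in> C0"
  shows "L t f x \<le> S (1 / 2 ^ m) (L (t - 1 / 2 ^ m) f) x"
proof (rule field_le_epsilon)
  fix e :: real assume e: "e > 0"
  let ?h = "1 / 2 ^ m :: real" and ?s = "t - 1 / 2 ^ m"
  have s: "?s \<ge> 0" "?h \<ge> 0" using t by auto
  then have t0: "t \<ge> 0" using t by linarith
  have "eventually (\<lambda>n. n \<ge> m \<and> (\<forall>x. D n ?s f x \<le> L ?s f x + e)) sequentially"
    by (intro eventually_conj eventually_ge_at_top D_uniform s f e)
  then obtain n where n: "n \<ge> m" "\<And>x. D n ?s f x \<le> L ?s f x + e"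
    unfolding eventually_sequentially by blast
  note ref = dyadic_refine[OF n(1)]
  have "L t f x \<le> D n t f x" by (rule D_tendsto[OF t0 f])
  also have "\<dots> = (S (1 / 2 ^ n) ^^ (2 ^ (n - m))) (D n ?s f) x"
    using dyadic_shift[of "2 ^ (n - m)" n t f] t unfolding ref by simp
  also have "\<dots> \<le> S ?h (D n ?s f) x"
    using S_iter_le[of "1 / 2 ^ n" "D n ?s f" "2 ^ (n - m)" x] D_C0[OF s(1) f] unfolding ref by simp
  also have "\<dots> \<le> S ?h (L ?s f) x + e"
    by (rule S_mono_add[OF s(2) D_C0[OF s(1) f] L_C0[OF s(1) f] n(2)])
  finally show "L t f x \<le> S ?h (L ?s f) x + e" .
qed

text \<open>Here \<open>L \<le> D n\<close> already points in the right direction inside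
  \<open>P\<close>, so the bound holds for every fine \<open>n\<close> and passes to the pointwise
  limit.\<close>

lemma shift_L_le_L:
  assumes t: "1 / 2 ^ m \<le> t" and f: "f \<in> C0" and a: "norm a \<le> \<delta>"
  shows "P (1 / 2 ^ m) (L (t - 1 / 2 ^ m) f) (x + (1 / 2 ^ m) *\<^sub>R a) \<le> L t f x"
proof -
  let ?h = "1 / 2 ^ m :: real" and ?s = "t - 1 / 2 ^ m"
  have s: "?s \<ge> 0" "?h \<ge> 0" using t by auto
  then have t0: "t \<ge> 0" using t by linarith
  have "P ?h (L ?s f) (x + ?h *\<^sub>R a) \<le> D n t f x" if n: "n \<ge> m" for n
  proof -
    note ref = dyadic_refine[OF n]
    have "P ?h (L ?s f) (x + ?h *\<^sub>R a) \<le> P ?h (D n ?s f) (x + ?h *\<^sub>R a)"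
      using P_mono[OF s(2) L_C0[OF s(1) f] D_C0[OF s(1) f], of n 0] D_tendsto(2)[OF s(1) f] by simp
    also have "\<dots> \<le> (S (1 / 2 ^ n) ^^ (2 ^ (n - m))) (D n ?s f) x"
      using shift_le_S_iter[of "1 / 2 ^ n" "D n ?s f" a "2 ^ (n - m)" x] D_C0[OF s(1) f] a
      unfolding ref by simp
    also have "\<dots> = D n t f x"
      using dyadic_shift[of "2 ^ (n - m)" n t f] t unfolding ref by simp
    finally show ?thesis .
  qed
  then show ?thesis by (intro LIMSEQ_le_const[OF D_tendsto(1)[OF t0 f]]) auto
qed

lemma D_small:
  assumes "f \<in> C0" "e > 0"
  obtains d where "d > 0" "\<And>n h x. \<lbrakk>0 \<le> h; h < d\<rbrakk> \<Longrightarrow> \<bar>D n h f x - f x\<bar> \<le> e"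
proof -
  obtain d where d: "d > 0" "\<And>h x. \<lbrakk>0 \<le> h; h < d\<rbrakk> \<Longrightarrow> \<bar>P h f x - f x\<bar> \<le> e"
    "\<And>h x. \<lbrakk>0 \<le> h; h < d\<rbrakk> \<Longrightarrow> \<bar>S h f x - f x\<bar> \<le> e"
    using S_small[OF assms] by blast
  show thesis
  proof (rule that[OF d(1)])
    fix n h x assume h: "0 \<le> h" "h < d"
    show "\<bar>D n h f x - f x\<bar> \<le> e"
      using d(2)[OF h, of x] d(3)[OF h, of x] P_le_D[OF h(1) assms(1), of x n] D_le_S[OF h(1) assms(1), of n x]
      by (simp add: abs_le_iff)
  qed
qed

text \<open>Both times share the whole steps contained in the smaller one, and iterates of
  \<open>S\<close> do not increase supremum distances. This leaves two short times at which
  \<open>D n\<close> is close to the identity.\<close>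

lemma L_time_continuous:
  assumes f: "f \<in> C0" and e: "e > 0"
  obtains d where "d > 0"
    "\<And>s t x. \<lbrakk>0 \<le> s; 0 \<le> t; \<bar>t - s\<bar> < d\<rbrakk> \<Longrightarrow> \<bar>L t f x - L s f x\<bar> \<le> e"
proof -
  obtain d where d: "d > 0" "\<And>n h x. \<lbrakk>0 \<le> h; h < d\<rbrakk> \<Longrightarrow> \<bar>D n h f x - f x\<bar> \<le> e / 2"
    using D_small[OF f, of "e / 2"] e by auto
  \<comment> \<open>Half of \<open>d\<close> is for \<open>t - s\<close>, the other half for the
    remainder \<open>s - q\<close> below one step.\<close>
  have *: "\<bar>L t f x - L s f x\<bar> \<le> e" if st: "0 \<le> s" "s \<le> t" "t - s < d / 2" for s t x
  proof (rule abs_diff_limit_le)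
    show "(\<lambda>n. D n t f x) \<longlonglongrightarrow> L t f x" "(\<lambda>n. D n s f x) \<longlonglongrightarrow> L s f x"
      using st f by (auto intro!: D_tendsto)
    have "(\<lambda>n. (1 / 2) ^ n) \<longlonglongrightarrow> (0::real)" by (rule LIMSEQ_power_zero) simp
    from order_tendstoD(2)[OF this, of "d / 2"] d(1)
    have "eventually (\<lambda>n. 1 / 2 ^ n < d / 2) sequentially" by (simp add: power_one_over)
    then show "eventually (\<lambda>n. \<bar>D n t f x - D n s f x\<bar> \<le> e) sequentially"
    proof eventually_elim
      case (elim n)
      define q where "q = real (dyadic_steps n s) / 2 ^ n"
      have q: "q \<le> s" "s - q < 1 / 2 ^ n"
        using dyadic_rest_bounds[OF st(1), of n] by (simp_all add: dyadic_rest_def q_def)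
      have C: "D n (t - q) f \<in> C0" "D n (s - q) f \<in> C0" using q st f by (auto intro!: D_C0)
      have "\<bar>D n (t - q) f y - D n (s - q) f y\<bar> \<le> e" for y
      proof -
        have "\<bar>D n (t - q) f y - f y\<bar> \<le> e / 2" "\<bar>D n (s - q) f y - f y\<bar> \<le> e / 2"
          using d(2)[of "t - q" n y] d(2)[of "s - q" n y] q st elim by linarith+
        then show ?thesis by linarith
      qed
      then show ?case
        using S_iter_diff[OF _ C, of "1 / 2 ^ n" e "dyadic_steps n s" x] q st
          dyadic_shift[of "dyadic_steps n s" n t f] dyadic_shift[of "dyadic_steps n s" n s f]
        by (simp add: q_def)
    qed
  qed
  show thesis
  proof (rule that[of "d / 2"])
    fix s t x assume st: "0 \<le> s" "0 \<le> t" "\<bar>t - s\<bar> < d / 2"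
    show "\<bar>L t f x - L s f x\<bar> \<le> e"
      using *[of s t x] *[of t s x] st by (cases "s \<le> t") (auto simp: abs_minus_commute)
  qed (use d in simp)
qed

end

section \<open>Viscosity property\<close>

text \<open>The derivative in the supremum norm becomes a backward difference estimate uniform in
  space. \<open>V\<close> lies in \<open>C0\<close> as a uniform limit of differences of
  \<open>C0\<close> functions, which makes the small-time estimates for \<open>S\<close> and
  \<open>P\<close> applicable to it.\<close>

lemma test_function_derivative:
  fixes v :: "real \<Rightarrow> 'a::euclidean_space \<Rightarrow> real"
  assumes v: "test_function \<mu> v" and t: "t > 0"
  obtains V where "V \<in> C0" "\<And>x. deriv (\<lambda>s. v s x) t = V x"
    "\<And>e. e > 0 \<Longrightarrow> eventually (\<lambda>h. \<forall>x. \<bar>v (t - h) x - v t x + h * V x\<bar> \<le> e * h) (at_right 0)"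
proof -
  have vC: "v s \<in> C0" if "s > 0" for s using v that by (auto simp: test_function_def C1_0_def)
  obtain B' where B': "((\<lambda>s. Bcontfun (v s)) has_derivative B') (at t)"
    using v t by (auto simp: test_function_def differentiable_def)
  define B where "B = B' 1"
  have B: "B' h = h *\<^sub>R B" for h
    using linear_scale[OF has_derivative_linear[OF B'], of h 1] by (simp add: B_def)
  have key: "\<exists>d>0. \<forall>s x. \<bar>s - t\<bar> < d \<longrightarrow> \<bar>v s x - v t x - (s - t) * B x\<bar> \<le> e * \<bar>s - t\<bar>" if e: "e > 0" for e
  proof -
    obtain d where d: "d > 0" "\<And>s. norm (s - t) < d \<Longrightarrow>
        norm (Bcontfun (v s) - Bcontfun (v t) - B' (s - t)) \<le> e * norm (s - t)"
      using B' e unfolding has_derivative_at_alt by blast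
    \<comment> \<open>The radius \<open>min d t\<close> keeps \<open>s\<close> positive; only there
      is \<open>v s\<close> known to be bounded and continuous, so that \<open>Bcontfun\<close> can
      be inverted.\<close>
    have "\<bar>v s x - v t x - (s - t) * B x\<bar> \<le> e * \<bar>s - t\<bar>" if s: "\<bar>s - t\<bar> < min d t" for s x
    proof -
      have "s > 0" using s t by linarith
      then have "v s \<in> bcontfun" "v t \<in> bcontfun" using vC t C0_subset_bcontfun by blast+
      then have "v s x - v t x - (s - t) * B x
          = apply_bcontfun (Bcontfun (v s) - Bcontfun (v t) - B' (s - t)) x"
        by (simp add: B Bcontfun_inverse minus_bcontfun.rep_eq scaleR_bcontfun.rep_eq)
      then have "\<bar>v s x - v t x - (s - t) * B x\<bar> \<le> norm (Bcontfun (v s) - Bcontfun (v t) - B' (s - t))"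
        using norm_bounded[of "Bcontfun (v s) - Bcontfun (v t) - B' (s - t)" x] by simp
      also have "\<dots> \<le> e * \<bar>s - t\<bar>" using d(2)[of s] s by simp
      finally show ?thesis .
    qed
    then show ?thesis using d(1) t by (intro exI[of _ "min d t"]) auto
  qed
  have D: "((\<lambda>s. v s x) has_real_derivative B x) (at t)" for x
    unfolding has_field_derivative_def has_derivative_at_alt
  proof (intro conjI allI impI)
    show "bounded_linear ((*) (B x))" by (rule bounded_linear_mult_right)
    fix e :: real assume "e > 0"
    from key[OF this] show "\<exists>d>0. \<forall>y. norm (y - t) < d \<longrightarrow>
        norm (v y x - v t x - B x * (y - t)) \<le> e * norm (y - t)"
      by (auto simp: mult.commute)
  qed
  have small: "eventually (\<lambda>h. h > 0 \<and> h < t \<and> (\<forall>x. \<bar>v (t - h) x - v t x + h * B x\<bar> \<le> e * h)) (at_right 0)"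
    if e: "e > 0" for e
  proof -
    obtain d where d: "d > 0" "\<And>s x. \<bar>s - t\<bar> < d \<Longrightarrow> \<bar>v s x - v t x - (s - t) * B x\<bar> \<le> e * \<bar>s - t\<bar>"
      using key[OF e] by blast
    show ?thesis unfolding eventually_at_right_field
    proof (intro exI[of _ "min d t"] conjI allI impI)
      fix h x assume h: "0 < h" "h < min d t"
      then show "\<bar>v (t - h) x - v t x + h * B x\<bar> \<le> e * h" using d(2)[of "t - h" x] by simp
    qed (use d t in auto)
  qed
  have "(B \<longlongrightarrow> 0) at_infinity"
  proof (rule tendstoI)
    fix e :: real assume e: "e > 0"
    have "eventually (\<lambda>h. h > 0 \<and> h < t \<and> (\<forall>x. \<bar>v (t - h) x - v t x + h * B x\<bar> \<le> e / 2 * h)) (at_right 0)"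
      using e by (intro small) simp
    then obtain h where h: "h > 0" "h < t" "\<And>x. \<bar>v (t - h) x - v t x + h * B x\<bar> \<le> e / 2 * h"
      using eventually_happens[of _ "at_right (0::real)"] by auto
    have "(\<lambda>x. v (t - h) x - v t x) \<in> C0" using h t by (intro C0_ops vC) auto
    then have "((\<lambda>x. v (t - h) x - v t x) \<longlongrightarrow> 0) at_infinity" by (simp add: C0_def)
    then have "eventually (\<lambda>x. dist (v (t - h) x - v t x) 0 < e / 2 * h) at_infinity"
      using e h(1) by (intro tendstoD) auto
    then show "eventually (\<lambda>x. dist (B x) 0 < e) at_infinity"
    proof eventually_elim
      case (elim x)
      have arith: "\<bar>b\<bar> < k + k" if "\<bar>a\<bar> < k" "\<bar>a + b\<bar> \<le> k" for a b k :: real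
        using that by linarith
      have "\<bar>h * B x\<bar> < e / 2 * h + e / 2 * h"
        using elim by (intro arith[OF _ h(3)]) (simp add: dist_real_def)
      then have "\<bar>h * B x\<bar> < h * e" by (simp add: mult.commute)
      then show ?case using h(1) by (simp add: abs_mult)
    qed
  qed
  then have "apply_bcontfun B \<in> C0" by (simp add: C0_def)
  then show thesis
  proof (rule that)
    show "deriv (\<lambda>s. v s x) t = B x" for x by (rule DERIV_imp_deriv[OF D])
    show "eventually (\<lambda>h. \<forall>x. \<bar>v (t - h) x - v t x + h * B x\<bar> \<le> e * h) (at_right 0)" if "e > 0" for e
      using small[OF that] by eventually_elim simp
  qed
qed

lemma dyadic_at_right: "filterlim (\<lambda>m. 1 / 2 ^ m :: real) (at_right 0) sequentially"
proof -
  have "(\<lambda>m. (1 / 2) ^ m) \<longlonglongrightarrow> (0::real)" by (rule LIMSEQ_power_zero) simp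
  then show ?thesis by (auto simp: filterlim_at power_one_over)
qed

context wasserstein_perturbation
begin

lemma L_curve:
  assumes f: "f \<in> C0" and u: "\<And>t. t \<ge> 0 \<Longrightarrow> u t = L t f"
  shows "C0_curve u"
proof -
  have uC: "u t \<in> C0" if "t \<ge> 0" for t using that u L_C0 f by simp
  have "continuous_on {0..} (\<lambda>t. Bcontfun (u t))"
    unfolding continuous_on_iff
  proof (intro ballI allI impI)
    fix t e :: real assume t: "t \<in> {0..}" and e: "e > 0"
    obtain d where d: "d > 0"
      "\<And>s t x. \<lbrakk>0 \<le> s; 0 \<le> t; \<bar>t - s\<bar> < d\<rbrakk> \<Longrightarrow> \<bar>L t f x - L s f x\<bar> \<le> e / 2"
      using L_time_continuous[OF f, of "e / 2"] e by auto
    have "dist (Bcontfun (u s)) (Bcontfun (u t)) < e" if s: "s \<in> {0..}" "dist s t < d" for s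
    proof -
      have "u s \<in> bcontfun" "u t \<in> bcontfun" using uC s t C0_subset_bcontfun by auto
      then have "dist (Bcontfun (u s)) (Bcontfun (u t)) \<le> e / 2"
        using d(2)[of t s] s t by (intro dist_bound) (simp add: Bcontfun_inverse dist_real_def u)
      then show ?thesis using e by simp
    qed
    then show "\<exists>d>0. \<forall>s\<in>{0..}. dist s t < d \<longrightarrow> dist (Bcontfun (u s)) (Bcontfun (u t)) < e"
      using d(1) by blast
  qed
  then show ?thesis using uC by (simp add: C0_curve_def)
qed

lemma L_subsolution:
  assumes f: "f \<in> C0" and v: "test_function \<mu> v" and t: "t > 0"
    and le: "\<And>s y. s > 0 \<Longrightarrow> L s f y \<le> v s y" and eq: "v t x = L t f x"
  shows "deriv (\<lambda>s. v s x) t \<le> hjb_op \<delta> \<mu> (v t) x"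
proof -
  have vt: "v s \<in> generator_dom \<mu>" "v s \<in> C1_0" "v s \<in> C0" if "s > 0" for s
    using v that by (auto simp: test_function_def C1_0_def)
  obtain V where V: "V \<in> C0" "\<And>x. deriv (\<lambda>s. v s x) t = V x"
    "\<And>e. e > 0 \<Longrightarrow> eventually (\<lambda>h. \<forall>x. \<bar>v (t - h) x - v t x + h * V x\<bar> \<le> e * h) (at_right 0)"
    using test_function_derivative[OF v t] by blast
  \<comment> \<open>Going back in time gives \<open>v (t - h) = v t + h * W\<close> up to
    \<open>e * h\<close>; with the sign moved into \<open>W\<close>, the coefficient is nonnegative,
    as subadditivity of \<open>S\<close> requires.\<close>
  define W where "W = (\<lambda>x. - 1 * V x)"
  have W: "W \<in> C0" unfolding W_def by (rule C0_ops(3)[OF V(1) V(1)])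
  let ?H = "hjb_op \<delta> \<mu> (v t) x"
  have "V x \<le> ?H"
  proof (rule field_le_epsilon)
    fix e0 :: real assume "e0 > 0"
    \<comment> \<open>One \<open>e\<close> each for the expansion of \<open>S h (v t)\<close>, for
      \<open>S h W\<close> against \<open>W\<close>, and for the time difference.\<close>
    define e where "e = e0 / 3"
    have e: "e > 0" using \<open>e0 > 0\<close> by (simp add: e_def)
    obtain d where d: "d > 0" "\<And>h x. \<lbrakk>0 \<le> h; h < d\<rbrakk> \<Longrightarrow> \<bar>P h W x - W x\<bar> \<le> e"
      "\<And>h x. \<lbrakk>0 \<le> h; h < d\<rbrakk> \<Longrightarrow> \<bar>S h W x - W x\<bar> \<le> e"
      using S_small[OF W e] by blast
    have "eventually (\<lambda>h. h \<in> {0<..<min t d}) (at_right 0)"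
      using t d(1) by (intro eventually_at_right_real) auto
    then have "eventually (\<lambda>h. h \<in> {0<..<min t d} \<and> S h (v t) x \<le> v t x + h * (?H + e)
        \<and> (\<forall>x. \<bar>v (t - h) x - v t x + h * V x\<bar> \<le> e * h)) (at_right 0)"
      using S_generator_upper[OF vt(1,2)[OF t] e] unfolding hjb_op_def
      by (intro eventually_conj V(3)[OF e])
    from eventually_compose_filterlim[OF this dyadic_at_right]
    obtain m where "1 / 2 ^ m \<in> {0<..<min t d} \<and> S (1 / 2 ^ m) (v t) x \<le> v t x + 1 / 2 ^ m * (?H + e)
        \<and> (\<forall>x. \<bar>v (t - 1 / 2 ^ m) x - v t x + 1 / 2 ^ m * V x\<bar> \<le> e * (1 / 2 ^ m))"
      using eventually_happens[of _ sequentially] by auto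
    then obtain h where h_def: "h = 1 / 2 ^ m" and h: "0 < h" "h < t" "h < d"
      and gen: "S h (v t) x \<le> v t x + h * (?H + e)"
      and der: "\<And>x. \<bar>v (t - h) x - v t x + h * V x\<bar> \<le> e * h" by auto
    have th: "t - h > 0" "t \<ge> 0" "h \<ge> 0" using h by auto
    have "v t x \<le> S h (L (t - h) f) x"
      using L_le_S_L[of m t f x] h f unfolding h_def[symmetric] eq by simp
    also have "\<dots> \<le> S h (v (t - h)) x"
      using th f by (intro S_mono vt(3) le L_C0) auto
    also have "\<dots> \<le> S h (\<lambda>y. v t y + h * W y) x + e * h"
    proof (rule S_mono_add[OF th(3) vt(3)[OF th(1)]])
      show "(\<lambda>y. v t y + h * W y) \<in> C0"
        using C0_ops(1)[OF vt(3)[OF t] C0_ops(3)[OF W W]] .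
      show "v (t - h) y \<le> v t y + h * W y + e * h" for y
        using der[of y] by (simp add: W_def abs_le_iff)
    qed
    also have "S h (\<lambda>y. v t y + h * W y) x \<le> S h (v t) x + h * S h W x"
      by (rule S_subadditive[OF th(3) vt(3)[OF t] W th(3)])
    also have "h * S h W x \<le> h * (- V x + e)"
      using d(3)[of h x] h by (intro mult_left_mono) (auto simp: W_def abs_le_iff)
    finally have "v t x \<le> v t x + h * (?H + e) + h * (- V x + e) + e * h" using gen by linarith
    then have "h * V x \<le> h * (?H + 3 * e)" by (simp add: algebra_simps)
    then show "V x \<le> ?H + e0" using h(1) by (simp add: e_def)
  qed
  then show ?thesis by (simp add: V(2))
qed

lemma L_supersolution:
  assumes f: "f \<in> C0" and v: "test_function \<mu> v" and t: "t > 0"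
    and ge: "\<And>s y. s > 0 \<Longrightarrow> v s y \<le> L s f y" and eq: "v t x = L t f x"
  shows "hjb_op \<delta> \<mu> (v t) x \<le> deriv (\<lambda>s. v s x) t"
proof -
  have vt: "v s \<in> generator_dom \<mu>" "v s \<in> C1_0" "v s \<in> C0" if "s > 0" for s
    using v that by (auto simp: test_function_def C1_0_def)
  obtain V where V: "V \<in> C0" "\<And>x. deriv (\<lambda>s. v s x) t = V x"
    "\<And>e. e > 0 \<Longrightarrow> eventually (\<lambda>h. \<forall>x. \<bar>v (t - h) x - v t x + h * V x\<bar> \<le> e * h) (at_right 0)"
    using test_function_derivative[OF v t] by blast
  let ?H = "hjb_op \<delta> \<mu> (v t) x" and ?D = "gradient (v t) x"
  \<comment> \<open>The admissible drift of steepest ascent. For a vanishing gradient, division by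
    zero gives \<open>a = 0\<close>, and both facts below still hold.\<close>
  define a where "a = (\<delta> / norm ?D) *\<^sub>R ?D"
  have a: "norm a \<le> \<delta>" "a \<bullet> ?D = \<delta> * norm ?D"
    using \<delta> by (auto simp: a_def norm_eq_sqrt_inner[symmetric] power2_norm_eq_inner[symmetric] power2_eq_square)
  have "?H \<le> V x"
  proof (rule field_le_epsilon)
    fix e0 :: real assume "e0 > 0"
    \<comment> \<open>One \<open>e\<close> for the expansion of \<open>P h (v t)\<close>, one for
      the time difference, and two for \<open>P h V\<close> at \<open>?z\<close> against
      \<open>V x\<close>: small time and small displacement.\<close>
    define e where "e = e0 / 4"
    have e: "e > 0" using \<open>e0 > 0\<close> by (simp add: e_def)
    obtain d where d: "d > 0" "\<And>h x. \<lbrakk>0 \<le> h; h < d\<rbrakk> \<Longrightarrow> \<bar>P h V x - V x\<bar> \<le> e"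
      using P_small[OF V(1) e] by blast
    obtain r where r: "r > 0" "\<And>a b. norm (a - b) < r \<Longrightarrow> \<bar>V a - V b\<bar> \<le> e"
      using C0_uniform[OF V(1) e] by blast
    \<comment> \<open>The bound \<open>r / (\<delta> + 1)\<close> keeps the displacement
      \<open>h *\<^sub>R a\<close> shorter than \<open>r\<close>.\<close>
    have "eventually (\<lambda>h. h \<in> {0<..<min t (min d (r / (\<delta> + 1)))}) (at_right 0)"
      using t d(1) r(1) \<delta> by (intro eventually_at_right_real) auto
    then have "eventually (\<lambda>h. h \<in> {0<..<min t (min d (r / (\<delta> + 1)))}
        \<and> P h (v t) (x + h *\<^sub>R a) \<ge> v t x + h * (generator \<mu> (v t) x + a \<bullet> ?D - e)
        \<and> (\<forall>x. \<bar>v (t - h) x - v t x + h * V x\<bar> \<le> e * h)) (at_right 0)"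
      using P_generator_lower[OF vt(1,2)[OF t] e]
      by (intro eventually_conj V(3)[OF e])
    from eventually_compose_filterlim[OF this dyadic_at_right]
    obtain m where "1 / 2 ^ m \<in> {0<..<min t (min d (r / (\<delta> + 1)))}
        \<and> P (1 / 2 ^ m) (v t) (x + (1 / 2 ^ m) *\<^sub>R a) \<ge> v t x + 1 / 2 ^ m * (generator \<mu> (v t) x + a \<bullet> ?D - e)
        \<and> (\<forall>x. \<bar>v (t - 1 / 2 ^ m) x - v t x + 1 / 2 ^ m * V x\<bar> \<le> e * (1 / 2 ^ m))"
      using eventually_happens[of _ sequentially] by auto
    then obtain h where h_def: "h = 1 / 2 ^ m" and h: "0 < h" "h < t" "h < d" "h < r / (\<delta> + 1)"
      and gen: "P h (v t) (x + h *\<^sub>R a) \<ge> v t x + h * (?H - e)"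
      and der: "\<And>x. \<bar>v (t - h) x - v t x + h * V x\<bar> \<le> e * h"
      by (auto simp: a(2) hjb_op_def)
    have th: "t - h > 0" "t \<ge> 0" "h \<ge> 0" using h by auto
    let ?z = "x + h *\<^sub>R a"
    have "norm (?z - x) = h * norm a" using h by simp
    also have "\<dots> \<le> h * (\<delta> + 1)" using a(1) h by (intro mult_left_mono) auto
    also have "\<dots> < r" using h(4) \<delta> by (simp add: pos_less_divide_eq)
    finally have "\<bar>V ?z - V x\<bar> \<le> e" by (rule r(2))
    moreover have "\<bar>P h V ?z - V ?z\<bar> \<le> e" using d(2) h by simp
    ultimately have PV: "P h V ?z \<le> V x + 2 * e" by linarith
    have "P h (v t) ?z - h * P h V ?z = P h (\<lambda>y. v t y - h * V y) ?z"
      unfolding feller_op_def using mu_integrable[OF th(3) vt(3)[OF t]] mu_integrable[OF th(3) V(1)] by simp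
    also have "\<dots> \<le> P h (v (t - h)) ?z + e * h"
    proof (rule P_mono[OF th(3) _ vt(3)[OF th(1)]])
      show "(\<lambda>y. v t y - h * V y) \<in> C0"
        using C0_ops(2)[OF vt(3)[OF t] C0_ops(3)[OF V(1) V(1)]] .
      show "v t y - h * V y \<le> v (t - h) y + e * h" for y
        using der[of y] by (simp add: abs_le_iff)
    qed
    also have "P h (v (t - h)) ?z \<le> P h (L (t - h) f) ?z"
      using P_mono[OF th(3) vt(3)[OF th(1)] L_C0[OF less_imp_le[OF th(1)] f], of 0] ge[OF th(1)] by simp
    also have "\<dots> \<le> v t x"
      using shift_L_le_L[of m t f a x] h f a unfolding h_def[symmetric] eq by simp
    finally have "v t x + h * (?H - e) - h * P h V ?z \<le> v t x + e * h" using gen by linarith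
    moreover have "h * P h V ?z \<le> h * (V x + 2 * e)" using PV h(1) by (intro mult_left_mono) auto
    ultimately have "h * ?H \<le> h * (V x + 4 * e)" by (simp add: algebra_simps)
    then show "?H \<le> V x + e0" using h(1) by (simp add: e_def)
  qed
  then show ?thesis by (simp add: V(2))
qed

lemma L_viscosity_solution:
  assumes f: "f \<in> C0" and u: "\<And>t. t \<ge> 0 \<Longrightarrow> u t = L t f"
  shows "viscosity_solution \<delta> \<mu> f u"
  unfolding viscosity_solution_def viscosity_subsolution_def viscosity_supersolution_def
proof (intro conjI allI impI)
  show "C0_curve u" by (rule L_curve[OF f u])
  then show "C0_curve u" .
  show "u 0 = f" using u[of 0] L_0[OF f] by simp
  then show "u 0 = f" .
next
  fix t x v
  assume t: "t > 0" and v: "test_function \<mu> v" and *: "\<forall>s>0. \<forall>y. u s y \<le> v s y" "v t x = u t x"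
  show "deriv (\<lambda>s. v s x) t \<le> hjb_op \<delta> \<mu> (v t) x"
    by (rule L_subsolution[OF f v t]) (use * u t in simp_all)
next
  fix t x v
  assume t: "t > 0" and v: "test_function \<mu> v" and *: "\<forall>s>0. \<forall>y. v s y \<le> u s y" "v t x = u t x"
  show "hjb_op \<delta> \<mu> (v t) x \<le> deriv (\<lambda>s. v s x) t"
    by (rule L_supersolution[OF f v t]) (use * u t in simp_all)
qed

end

section \<open>Levy processes\<close>

text \<open>Independence and stationarity of two adjacent increments give the convolution law. The
  moment, assumed at time 1 only, is passed down to times in [0, 1] by Fubini and up to all times by
  adding unit intervals.\<close>

lemma levy_wasserstein_perturbation:
  fixes M :: "'w measure" and X :: "real \<Rightarrow> 'w \<Rightarrow> 'a::euclidean_space"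
  assumes p: "p > 1" and \<delta>: "\<delta> \<ge> 0" and levy: "levy_process M X"
    and \<mu>: "\<And>t. t \<ge> 0 \<Longrightarrow> \<mu> t = distr M borel (X t)"
    and int: "integrable (\<mu> 1) (\<lambda>x. norm x powr p)"
  shows "wasserstein_perturbation p \<delta> \<mu>"
proof -
  interpret prob_space M using levy by (simp add: levy_process_def)
  have X [measurable]: "X t \<in> borel_measurable M" if "t \<ge> 0" for t
    using levy that by (simp add: levy_process_def)
  have X0: "AE \<omega> in M. X 0 \<omega> = 0" using levy by (simp add: levy_process_def)
  have stat: "distr M borel (\<lambda>\<omega>. X (s + h) \<omega> - X s \<omega>) = distr M borel (X h)" if "s \<ge> 0" "h \<ge> 0" for s h
    using levy that by (simp add: levy_process_def)
  have prob: "prob_space (\<mu> t)" and sets: "sets (\<mu> t) = sets borel" if "t \<ge> 0" for t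
    using that by (auto simp: \<mu> intro!: prob_space_distr)
  have add: "(\<integral>\<^sup>+z. g z \<partial>\<mu> (s + t)) = (\<integral>\<^sup>+x. \<integral>\<^sup>+y. g (x + y) \<partial>\<mu> t \<partial>\<mu> s)"
    if s: "s \<ge> 0" and t: "t \<ge> 0" and g [measurable]: "g \<in> borel_measurable borel" for s t g
  proof -
    \<comment> \<open>Times 0, s, s + t. The first increment is \<open>X s - X 0\<close>, which
      equals \<open>X s\<close> only almost surely.\<close>
    define \<tau> where "\<tau> = (\<lambda>i::nat. if i = 0 then 0 else if i = 1 then s else s + t)"
    have st: "s + t \<ge> 0" using s t by simp
    note [measurable] = X[OF s] X[OF t] X[OF st] X[OF order_refl]
    have "mono_on {..2} \<tau>" "0 \<le> \<tau> 0" using s t by (auto simp: \<tau>_def mono_on_def)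
    then have "indep_vars (\<lambda>_. borel) (\<lambda>i \<omega>. X (\<tau> (Suc i)) \<omega> - X (\<tau> i) \<omega>) {..<2}"
      using levy unfolding levy_process_def by blast
    from indep_var_restrict[OF this, of "{0}" "{1}"]
    have "indep_var (PiM {0} (\<lambda>_. borel)) (\<lambda>\<omega>. restrict (\<lambda>i. X (\<tau> (Suc i)) \<omega> - X (\<tau> i) \<omega>) {0})
        (PiM {1} (\<lambda>_. borel)) (\<lambda>\<omega>. restrict (\<lambda>i. X (\<tau> (Suc i)) \<omega> - X (\<tau> i) \<omega>) {1})"
      by simp
    from indep_var_compose[OF this, of "\<lambda>w. w 0" borel "\<lambda>w. w 1" borel]
    have ind: "indep_var borel (\<lambda>\<omega>. X s \<omega> - X 0 \<omega>) borel (\<lambda>\<omega>. X (s + t) \<omega> - X s \<omega>)"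
      by (simp add: comp_def \<tau>_def)
    interpret t: prob_space "\<mu> t" by (rule prob[OF t])
    have d1: "distr M borel (\<lambda>\<omega>. X s \<omega> - X 0 \<omega>) = \<mu> s" using stat[of 0 s] s by (simp add: \<mu>)
    have d2: "distr M borel (\<lambda>\<omega>. X (s + t) \<omega> - X s \<omega>) = \<mu> t" using stat[OF s t] t by (simp add: \<mu>)
    have joint: "\<mu> s \<Otimes>\<^sub>M \<mu> t = distr M (borel \<Otimes>\<^sub>M borel) (\<lambda>\<omega>. (X s \<omega> - X 0 \<omega>, X (s + t) \<omega> - X s \<omega>))"
      using ind unfolding indep_var_distribution_eq d1 d2 by simp
    have m: "(\<lambda>z. g (fst z + snd z)) \<in> borel_measurable (\<mu> s \<Otimes>\<^sub>M \<mu> t)"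
      using sets[OF s, measurable_cong] sets[OF t, measurable_cong] by measurable
    have "(\<integral>\<^sup>+z. g z \<partial>\<mu> (s + t)) = (\<integral>\<^sup>+\<omega>. g (X (s + t) \<omega>) \<partial>M)"
      unfolding \<mu>[OF st] by (rule nn_integral_distr) auto
    also have "\<dots> = (\<integral>\<^sup>+\<omega>. g ((X s \<omega> - X 0 \<omega>) + (X (s + t) \<omega> - X s \<omega>)) \<partial>M)"
      by (rule nn_integral_cong_AE) (use X0 in eventually_elim, simp)
    also have "\<dots> = (\<integral>\<^sup>+z. g (fst z + snd z) \<partial>(\<mu> s \<Otimes>\<^sub>M \<mu> t))"
      unfolding joint by (subst nn_integral_distr) auto
    also have "\<dots> = (\<integral>\<^sup>+x. \<integral>\<^sup>+y. g (x + y) \<partial>\<mu> t \<partial>\<mu> s)"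
      using t.nn_integral_fst[OF m] by simp
    finally show ?thesis .
  qed
  define mom where "mom = (\<lambda>t. \<integral>\<^sup>+x. ennreal (norm x powr p) \<partial>\<mu> t)"
  have tri: "ennreal (norm (x + y) powr p) \<le>
      ennreal (2 powr (p - 1)) * ennreal (norm x powr p) + ennreal (2 powr (p - 1)) * ennreal (norm y powr p)"
    for x y :: 'a
  proof -
    have "norm (x + y) powr p \<le> (norm x + norm y) powr p"
      using p norm_triangle_ineq by (intro powr_mono2) auto
    also have "\<dots> \<le> 2 powr (p - 1) * (norm x powr p + norm y powr p)"
      using powr_add_weighted[OF p, of 1 1] by simp
    finally show ?thesis by (simp add: ennreal_leI distrib_left flip: ennreal_plus ennreal_mult)
  qed
  have mom1: "mom 1 < \<infinity>"
    using int unfolding mom_def by (simp add: integrable_iff_bounded)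
  have mom_le1: "mom t < \<infinity>" if t: "0 \<le> t" "t \<le> 1" for t
  proof -
    interpret t: prob_space "\<mu> t" by (rule prob[OF t(1)])
    interpret s: prob_space "\<mu> (1 - t)" by (rule prob) (use t in simp)
    note [measurable_cong] = sets[OF t(1)]
    have "mom 1 = (\<integral>\<^sup>+x. \<integral>\<^sup>+y. ennreal (norm (x + y) powr p) \<partial>\<mu> t \<partial>\<mu> (1 - t))"
      using add[of "1 - t" t "\<lambda>x. ennreal (norm x powr p)"] t by (simp add: mom_def)
    moreover have "(\<integral>\<^sup>+x. \<infinity> \<partial>\<mu> (1 - t)) = \<infinity>" by (simp add: s.emeasure_space_1)
    \<comment> \<open>A finite iterated integral forces the inner one to be finite at some
      \<open>x\<close>; writing y as -x + (x + y) then bounds the moment of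
      \<open>\<mu> t\<close>.\<close>
    ultimately have "(\<lambda>x. \<integral>\<^sup>+y. ennreal (norm (x + y) powr p) \<partial>\<mu> t) \<noteq> (\<lambda>_. \<infinity>)"
      using mom1 by auto
    then obtain x where x: "(\<integral>\<^sup>+y. ennreal (norm (x + y) powr p) \<partial>\<mu> t) < \<infinity>"
      unfolding fun_eq_iff by (auto simp: less_top)
    have "mom t \<le> (\<integral>\<^sup>+y. ennreal (2 powr (p - 1)) * ennreal (norm (- x) powr p)
        + ennreal (2 powr (p - 1)) * ennreal (norm (x + y) powr p) \<partial>\<mu> t)"
      unfolding mom_def using tri[of "- x" "x + _"] by (intro nn_integral_mono) simp
    also have "\<dots> = ennreal (2 powr (p - 1)) * ennreal (norm (- x) powr p)
        + ennreal (2 powr (p - 1)) * (\<integral>\<^sup>+y. ennreal (norm (x + y) powr p) \<partial>\<mu> t)"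
      by (subst nn_integral_add) (auto simp: nn_integral_cmult t.emeasure_space_1)
    also have "\<dots> < \<infinity>" using x by (simp add: ennreal_mult_less_top)
    finally show ?thesis .
  qed
  have mom_add: "mom (s + t) < \<infinity>" if s: "s \<ge> 0" "mom s < \<infinity>" and t: "t \<ge> 0" "mom t < \<infinity>" for s t
  proof -
    interpret s: prob_space "\<mu> s" by (rule prob[OF s(1)])
    interpret t: prob_space "\<mu> t" by (rule prob[OF t(1)])
    note [measurable_cong] = sets[OF s(1)] sets[OF t(1)]
    have "mom (s + t) = (\<integral>\<^sup>+x. \<integral>\<^sup>+y. ennreal (norm (x + y) powr p) \<partial>\<mu> t \<partial>\<mu> s)"
      unfolding mom_def by (rule add[OF s(1) t(1)]) measurable
    also have "\<dots> \<le> (\<integral>\<^sup>+x. \<integral>\<^sup>+y. ennreal (2 powr (p - 1)) * ennreal (norm x powr p)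
        + ennreal (2 powr (p - 1)) * ennreal (norm y powr p) \<partial>\<mu> t \<partial>\<mu> s)"
      by (intro nn_integral_mono tri)
    also have "\<dots> = ennreal (2 powr (p - 1)) * mom s + ennreal (2 powr (p - 1)) * mom t"
      by (simp add: mom_def nn_integral_add nn_integral_cmult s.emeasure_space_1 t.emeasure_space_1)
    also have "\<dots> < \<infinity>" using s(2) t(2) by (simp add: ennreal_mult_less_top)
    finally show ?thesis .
  qed
  have mom_n: "mom t < \<infinity>" if "0 \<le> t" "t \<le> real (Suc n)" for t n
    using that
  proof (induction n arbitrary: t)
    case (Suc n)
    show ?case
    proof (cases "t \<le> 1")
      case False
      have "mom (1 + (t - 1)) < \<infinity>" using False Suc mom1 by (intro mom_add) auto
      then show ?thesis by simp
    qed (use mom_le1 Suc in simp)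
  qed (use mom_le1 in simp)
  have fin: "mom t < \<infinity>" if t: "t \<ge> 0" for t
  proof -
    obtain n where "t \<le> real n" using real_arch_simple by blast
    then show ?thesis using mom_n[of t n] t by simp
  qed
  show ?thesis
  proof
    show "\<mu> t \<in> wasserstein_space p" if "t \<ge> 0" for t
      using prob[OF that] sets[OF that] fin[OF that] by (simp add: wasserstein_space_nn mom_def)
    show "\<mu> 0 = return borel 0"
    proof -
      have "distr M borel (X 0) = distr M borel (\<lambda>_. 0)"
        using X[of 0] X0 by (intro distr_cong_AE) auto
      then show ?thesis by (simp add: \<mu>)
    qed
    show "((\<lambda>h. measure (\<mu> h) {y. norm y > r}) \<longlongrightarrow> 0) (at_right 0)" if r: "r > 0" for r
    proof -
      have "((\<lambda>s. measure M {\<omega> \<in> space M. norm (X s \<omega> - X 0 \<omega>) > r}) \<longlongrightarrow> 0) (at 0 within {0..})"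
        using levy r by (simp add: levy_process_def)
      then have "((\<lambda>s. measure M {\<omega> \<in> space M. norm (X s \<omega> - X 0 \<omega>) > r}) \<longlongrightarrow> 0) (at_right 0)"
        by (rule tendsto_within_subset) auto
      moreover have "eventually (\<lambda>s. measure M {\<omega> \<in> space M. norm (X s \<omega> - X 0 \<omega>) > r}
          = measure (\<mu> s) {y. norm y > r}) (at_right 0)"
        unfolding eventually_at_right_field
      proof (intro exI[of _ 1] conjI allI impI)
        fix s :: real assume "0 < s"
        then have s: "s \<ge> 0" by simp
        note [measurable] = X[OF s] X[OF order_refl]
        have "measure (\<mu> s) {y. norm y > r} = measure M {\<omega> \<in> space M. norm (X s \<omega>) > r}"
          unfolding \<mu>[OF s] by (subst measure_distr) (auto simp: vimage_def Int_def conj_commute)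
        also have "\<dots> = measure M {\<omega> \<in> space M. norm (X s \<omega> - X 0 \<omega>) > r}"
          using X0 by (intro measure_eq_AE) auto
        finally show "measure M {\<omega> \<in> space M. norm (X s \<omega> - X 0 \<omega>) > r} = measure (\<mu> s) {y. norm y > r}"
          by simp
      qed simp
      ultimately show ?thesis by (rule Lim_transform_eventually)
    qed
  qed (use p \<delta> add in auto)
qed

theorem theorem1p2:
  fixes p \<delta> :: real
    and M :: "'w measure"
    and X :: "real \<Rightarrow> 'w \<Rightarrow> 'a::euclidean_space"
    and \<mu> :: "real \<Rightarrow> 'a measure"
    and f :: "'a \<Rightarrow> real"
    and u :: "real \<Rightarrow> 'a \<Rightarrow> real"
  assumes "p > 1" and "\<delta> \<ge> 0"
    and "levy_process M X"
    and "\<And>t. t \<ge> 0 \<Longrightarrow> \<mu> t = distr M borel (X t)"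
    and "integrable (\<mu> 1) (\<lambda>x. norm x powr p)"
    and "f \<in> C0"
    and "\<And>t x. t \<ge> 0 \<Longrightarrow> u t x = limit_op p \<delta> \<mu> t f x"
  shows "viscosity_solution \<delta> \<mu> f u"
proof -
  interpret wasserstein_perturbation p \<delta> \<mu>
    using assms(1-5) by (rule levy_wasserstein_perturbation)
  show ?thesis using assms(6,7) by (intro L_viscosity_solution) auto
qed

end
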